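(* Let $d\geq 2$ and let $(\psi_n)_{n\geq 0}$ be the family of $L^2(\mathbb{R}^d)$-normalized radial Hermite functions, with $H\psi_n=(4n+d)\psi_n$. Then: (i) if $\frac{2d}{d-1}<p\leq+\infty$, there are constants $c_p,C_p>0$ such that for all $n\geq 1$ $$c_p\,n^{\frac d2\left(\frac12-\frac1p\right)-\frac12}\leq\|\psi_n\|_{L^p(\mathbb{R}^d)}\leq C_p\,n^{\frac d2\left(\frac12-\frac1p\right)-\frac12};$$ (ii) if $p=\frac{2d}{d-1}$, there is a constant $C_p>0$ such that for all $n\geq 2$ $$\|\psi_n\|_{L^p(\mathbb{R}^d)}\leq C_p\,n^{-\frac14}\ln^{\frac1p}(n);$$ (iii) if $2\leq p<\frac{2d}{d-1}$, there is a constant $C_p>0$ such that for all $n\geq 1$ $$\|\psi_n\|_{L^p(\mathbb{R}^d)}\leq C_p\,n^{-\frac d2\left(\frac12-\frac1p\right)}.$$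
   Context: $H=-\Delta+|x|^2$ is the harmonic oscillator on $L^2(\mathbb{R}^d)$. The radial ($SO(d)$-invariant) eigenfunctions of $H$ have eigenvalues $4n+d$, $n\in\mathbb{N}$, and each radial eigenspace is one-dimensional; $\psi_n$ is the $L^2(\mathbb{R}^d)$-normalized radial eigenfunction for $4n+d$ (proportional to $L_n^{(d/2-1)}(|x|^2)e^{-|x|^2/2}$, with $L_n^{(\alpha)}$ the Laguerre polynomials). The constants may depend on $p$ and $d$ but not on $n$. For $p=+\infty$, $1/p=0$. *)

theory Defs
  imports "HOL-Analysis.Analysis" "HOL-Probability.Essential_Supremum"
begin

definition recip :: "ennreal \<Rightarrow> real" where
  "recip p = enn2real (1 / p)"

lemma recip_top: "recip \<infinity> = 0"
  by (simp add: recip_def)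

lemma recip_ennreal: "0 < p \<Longrightarrow> recip (ennreal p) = 1 / p"
  by (simp add: recip_def divide_ennreal[symmetric] flip: ennreal_1)

(* The L^p norm on R^d with values in [0, \<infinity>], so that an upper bound on it includes membership
   in L^p. The conditional is needed because enn2real maps \<infinity> to 0. *)
definition Lp_norm :: "ennreal \<Rightarrow> ('a::euclidean_space \<Rightarrow> 'b::real_normed_vector) \<Rightarrow> ennreal" where
  "Lp_norm p f =
     (if p = \<infinity> then esssup lborel (\<lambda>x. ennreal (norm (f x)))
      else let I = (\<integral>\<^sup>+ x. ennreal (norm (f x) powr enn2real p) \<partial>lborel)
           in if I = \<infinity> then \<infinity> else ennreal (enn2real I powr recip p))"

definition partial_derivative ::
    "'a::euclidean_space \<Rightarrow> ('a \<Rightarrow> 'b::real_normed_vector) \<Rightarrow> 'a \<Rightarrow> 'b" where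
  "partial_derivative b f x = frechet_derivative f (at x) b"

definition C2 :: "('a::euclidean_space \<Rightarrow> 'b::real_normed_vector) \<Rightarrow> bool" where
  "C2 f \<longleftrightarrow>
     f differentiable_on UNIV \<and>
     (\<forall>b\<in>Basis. partial_derivative b f differentiable_on UNIV) \<and>
     (\<forall>b\<in>Basis. \<forall>c\<in>Basis. continuous_on UNIV (partial_derivative c (partial_derivative b f)))"

definition laplacian :: "('a::euclidean_space \<Rightarrow> 'b::real_normed_vector) \<Rightarrow> 'a \<Rightarrow> 'b" where
  "laplacian f x = (\<Sum>b\<in>Basis. partial_derivative b (partial_derivative b f) x)"

definition harmonic_oscillator ::
    "('a::euclidean_space \<Rightarrow> 'b::real_normed_vector) \<Rightarrow> 'a \<Rightarrow> 'b" where
  "harmonic_oscillator f x = - laplacian f x + (norm x)\<^sup>2 *\<^sub>R f x"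

definition radial :: "(real ^ 'd \<Rightarrow> 'b) \<Rightarrow> bool" where
  "radial f \<longleftrightarrow> (\<forall>Q. rotation_matrix Q \<longrightarrow> (\<forall>x. f (Q *v x) = f x))"

(* By elliptic regularity, every L^2 eigenfunction of H has a smooth representative; conversely a
   C^2 function in L^2 with H f = \<lambda> f pointwise lies in the (maximal) domain of H. So eigenfunctions
   are taken to be classical C^2 solutions, a representative being unique by continuity. *)
definition radial_hermite_function :: "nat \<Rightarrow> (real ^ 'd \<Rightarrow> complex) \<Rightarrow> bool" where
  "radial_hermite_function n f \<longleftrightarrow>
     C2 f \<and> radial f \<and> Lp_norm 2 f = 1 \<and>
     (\<forall>x. harmonic_oscillator f x = (4 * real n + real CARD('d)) *\<^sub>R f x)"

end

theory Submission
  imports Defs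
begin

text \<open>
  A radial eigenfunction has the form \<open>f x = u (norm x)\<close>. With \<open>\<kappa> = (d - 1) / 2\<close> and
  \<open>E = 4 n + d\<close>, the profile solves \<open>u'' + (2 \<kappa> / r) u' + (E - r\<^sup>2) u = 0\<close>, and the Liouville
  transform \<open>v = r powr \<kappa> * u\<close> solves \<open>v'' + (E - r\<^sup>2 - \<kappa> (\<kappa> - 1) / r\<^sup>2) v = 0\<close>. All estimates
  are read off these equations; Laguerre polynomials do not appear. Besides the equation, only
  the regularity at the origin and the \<open>L\<^sup>2\<close> normalisation enter, the latter in
  the form \<open>\<integral> \<bar>v\<bar>\<^sup>2 = 1 / \<sigma>\<close>, where \<open>\<sigma>\<close> is the area of the unit sphere. Existence of the
  eigenfunctions is a hypothesis, and the estimates hold uniformly in the real parameter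
  \<open>E \<ge> 6\<close>.

  The heuristic is the WKB approximation: in the oscillating region \<open>\<bar>v\<bar>\<close> is of the order of
  \<open>(E - r\<^sup>2) powr (-1/4)\<close>, because \<open>\<integral> (E - r\<^sup>2) powr (-1/2)\<close> is of order one. Hence \<open>\<bar>u\<bar>\<close> is of the
  order of \<open>r powr (-\<kappa>) * (E - r\<^sup>2) powr (-1/4)\<close> for \<open>E powr (-1/2) \<le> r \<le> sqrt E\<close>, it saturates at
  \<open>E powr ((d - 2) / 4)\<close> for smaller \<open>r\<close>, and it is negligible beyond the turning point \<open>sqrt E\<close>.
  The integral of \<open>\<bar>u\<bar> powr p * r powr (2 \<kappa>)\<close> is therefore dominated by the origin if
  \<open>\<kappa> (p - 2) > 1\<close>, by the bulk if \<open>\<kappa> (p - 2) < 1\<close>, and all dyadic scales contribute equally if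
  \<open>\<kappa> (p - 2) = 1\<close>, which produces the logarithm. The condition \<open>\<kappa> (p - 2) = 1\<close> is
  \<open>p = 2 d / (d - 1)\<close>.

  The rigorous form has the following parts.
  \<^item> The quadratic form \<open>W = sqrt (E - r\<^sup>2) \<bar>v\<bar>\<^sup>2 + \<bar>v'\<bar>\<^sup>2 / sqrt (E - r\<^sup>2)\<close> is constant up to bounded
    factors between \<open>r \<sim> E powr (-1/2)\<close> and a distance \<open>E powr (-1/6)\<close> from the turning point
    (lemma \<open>W_comparison\<close>). The leading error is removed by adding a multiple of
    \<open>Re (v * cnj v')\<close>, and the rest is integrable.
  \<^item> Across the turning point a Gronwall argument on the Airy scale \<open>E powr (-1/6)\<close> suffices
    (\<open>airy_zone\<close>), and beyond it \<open>\<bar>v\<bar>\<^sup>2\<close> is convex and integrable, hence decreasing, and its mass is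
    controlled by its slope (\<open>tail_mass\<close>).
  \<^item> The common value of \<open>W\<close> is comparable to the mass. It is bounded by the mass through a
    Caccioppoli estimate in the bulk (\<open>W_r1_le_mass\<close>); the converse is the case \<open>p = 2\<close> of the upper
    bound for the power integrals (\<open>M_le_a\<close>).
  \<^item> Near the origin the energy \<open>\<bar>u'\<bar>\<^sup>2 + (E - r\<^sup>2) \<bar>u\<bar>\<^sup>2\<close> decreases, so \<open>\<bar>u\<bar>\<close> is comparable to
    \<open>\<bar>u 0\<bar>\<close> for \<open>r \<le> E powr (-1/2) / 2\<close> (\<open>near_origin\<close>, \<open>near_origin_ge\<close>), and \<open>\<bar>u 0\<bar>\<^sup>2\<close> is comparable
    to \<open>E powr (d / 2 - 1) * W\<close>. This yields the lower bounds.

  The natural lengths are \<open>E powr (-1/2)\<close>, \<open>E powr (-1/6)\<close> and \<open>E powr (1/2)\<close>. For this reason the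
  frequency is measured by \<open>e\<close> with \<open>e ^ 6 = E\<close>, which turns them into \<open>1 / e ^ 3\<close>, \<open>1 / e\<close> and
  \<open>e ^ 3\<close>.
\<close>

section \<open>Integral and differential inequalities\<close>

text \<open>A two-sided Gronwall inequality: \<open>W * exp (- F)\<close> decreases and \<open>W * exp F\<close> increases, so values
  at any two points are comparable, whatever their order.\<close>

lemma gronwall_comparison:
  fixes W W' F F' :: "real \<Rightarrow> real"
  assumes W: "\<And>r. r \<in> {a..b} \<Longrightarrow> (W has_real_derivative W' r) (at r)"
    and F: "\<And>r. r \<in> {a..b} \<Longrightarrow> (F has_real_derivative F' r) (at r)"
    and bnd: "\<And>r. r \<in> {a..b} \<Longrightarrow> \<bar>W' r\<bar> \<le> F' r * W r"
    and nonneg: "\<And>r. r \<in> {a..b} \<Longrightarrow> 0 \<le> W r"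
    and s: "s \<in> {a..b}" and t: "t \<in> {a..b}"
  shows "W s \<le> exp \<bar>F s - F t\<bar> * W t"
proof -
  have mono1: "W y * exp (- F y) \<le> W x * exp (- F x)" if "a \<le> x" "x \<le> y" "y \<le> b" for x y
  proof (rule DERIV_nonpos_imp_nonincreasing[OF that(2)])
    fix r assume r: "x \<le> r" "r \<le> y"
    then have r': "r \<in> {a..b}" using that by auto
    have "((\<lambda>r. W r * exp (- F r)) has_real_derivative (W' r - F' r * W r) * exp (- F r)) (at r)"
      by (auto intro!: derivative_eq_intros W F r' simp: algebra_simps)
    moreover have "(W' r - F' r * W r) * exp (- F r) \<le> 0"
      using bnd[OF r'] by (intro mult_nonpos_nonneg) auto
    ultimately show "\<exists>D. ((\<lambda>r. W r * exp (- F r)) has_real_derivative D) (at r) \<and> D \<le> 0" by blast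
  qed
  have mono2: "W x * exp (F x) \<le> W y * exp (F y)" if "a \<le> x" "x \<le> y" "y \<le> b" for x y
  proof (rule DERIV_nonneg_imp_nondecreasing[OF that(2)])
    fix r assume r: "x \<le> r" "r \<le> y"
    then have r': "r \<in> {a..b}" using that by auto
    have "((\<lambda>r. W r * exp (F r)) has_real_derivative (W' r + F' r * W r) * exp (F r)) (at r)"
      by (auto intro!: derivative_eq_intros W F r' simp: algebra_simps)
    moreover have "(W' r + F' r * W r) * exp (F r) \<ge> 0"
      using bnd[OF r'] by (intro mult_nonneg_nonneg) auto
    ultimately show "\<exists>D. ((\<lambda>r. W r * exp (F r)) has_real_derivative D) (at r) \<and> D \<ge> 0" by blast
  qed
  have "exp (F s - F t) * W t \<le> exp \<bar>F s - F t\<bar> * W t" "exp (F t - F s) * W t \<le> exp \<bar>F s - F t\<bar> * W t"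
    using nonneg[OF t] by (auto intro!: mult_right_mono)
  moreover have "W s \<le> exp (F s - F t) * W t" if "t \<le> s"
    using mono1[of t s] that s t by (auto simp: exp_diff exp_minus field_simps)
  moreover have "W s \<le> exp (F t - F s) * W t" if "s \<le> t"
    using mono2[of s t] that s t by (auto simp: exp_diff exp_minus field_simps)
  ultimately show ?thesis by (meson linear order_trans)
qed

text \<open>Polar coordinates for radial integrands. The distribution of the norm under Lebesgue measure is
  determined by the volumes of balls, and the weight is the derivative of
  \<open>unit_ball_vol d * r ^ d\<close>.\<close>

lemma nn_integral_radial:
  fixes F :: "real \<Rightarrow> ennreal"
  assumes F[measurable]: "F \<in> borel_measurable borel"
  shows "(\<integral>\<^sup>+x. F (norm (x::'a::euclidean_space)) \<partial>lborel) =
    (\<integral>\<^sup>+r. ennreal (DIM('a) * unit_ball_vol DIM('a) * r ^ (DIM('a) - 1)) * indicator {0..} r * F r \<partial>lborel)"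
proof -
  let ?w = "\<lambda>r. ennreal (DIM('a) * unit_ball_vol DIM('a) * r ^ (DIM('a) - 1)) * indicator {0..} r"
  let ?M = "distr lborel borel (norm :: 'a \<Rightarrow> real)" and ?N = "density lborel ?w"
  have atm: "emeasure ?M {..R}
      = (if R < 0 then 0 else ennreal (unit_ball_vol DIM('a) * R ^ DIM('a)))" for R
  proof -
    have "emeasure ?M {..R} = emeasure lborel (cball (0::'a) R)"
      by (subst emeasure_distr) (auto intro!: arg_cong[where f="emeasure lborel"] simp: dist_norm)
    then show ?thesis by (auto simp: emeasure_cball)
  qed
  have "?M = ?N"
  proof (rule measure_eqI_generator_eq[where \<Omega> = UNIV and E = "range atMost" and A = "\<lambda>n. {..real n}"])
    show "Int_stable (range atMost :: real set set)"
      by (auto simp: Int_stable_def)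
    show "sets ?M = sigma_sets UNIV (range atMost)" "sets ?N = sigma_sets UNIV (range atMost)"
      by (simp_all add: borel_eq_atMost)
    show "(\<Union>i. {..real i}) = UNIV" using real_arch_simple by auto
    show "emeasure ?M {..real i} \<noteq> \<infinity>" for i by (simp add: atm)
    fix X :: "real set" assume "X \<in> range atMost"
    then obtain R where X: "X = {..R}" by auto
    have "emeasure ?N {..R} = (\<integral>\<^sup>+r. ?w r * indicator {..R} r \<partial>lborel)"
      by (rule emeasure_density) auto
    also have "...
        = (\<integral>\<^sup>+r. ennreal (DIM('a) * unit_ball_vol DIM('a) * r ^ (DIM('a) - 1)) * indicator {0..R} r \<partial>lborel)"
      by (intro nn_integral_cong) (auto simp: indicator_def)
    also have "... = emeasure ?M {..R}"
    proof (cases "R < 0")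
      case False
      have "(\<integral>\<^sup>+r. ennreal (DIM('a) * unit_ball_vol DIM('a) * r ^ (DIM('a) - 1)) * indicator {0..R} r \<partial>lborel)
         = ennreal (unit_ball_vol DIM('a) * R ^ DIM('a) - unit_ball_vol DIM('a) * 0 ^ DIM('a))"
        using False by (intro nn_integral_FTC_Icc) (auto intro!: derivative_eq_intros)
      then show ?thesis using False by (simp add: atm power_0_left)
    qed (simp add: atm)
    finally show "emeasure ?M X = emeasure ?N X" by (simp add: X)
  qed auto
  have "(\<integral>\<^sup>+x. F (norm (x::'a)) \<partial>lborel) = (\<integral>\<^sup>+r. F r \<partial>?M)"
    by (rule nn_integral_distr[symmetric]) auto
  also have "... = (\<integral>\<^sup>+r. ?w r * F r \<partial>lborel)"
    unfolding \<open>?M = ?N\<close> by (rule nn_integral_density) auto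
  finally show ?thesis .
qed

lemma nn_integral_radial_powr:
  fixes F :: "real \<Rightarrow> real"
  assumes [measurable]: "F \<in> borel_measurable borel" and F: "\<And>r. F r \<ge> 0" and D: "DIM('a::euclidean_space) \<ge> 2"
  shows "(\<integral>\<^sup>+x. ennreal (F (norm (x::'a))) \<partial>lborel) =
    ennreal (DIM('a) * unit_ball_vol DIM('a)) *
    (\<integral>\<^sup>+r. ennreal (F r * r powr (real DIM('a) - 1)) * indicator {0<..} r \<partial>lborel)"
proof -
  have "(\<integral>\<^sup>+x. ennreal (F (norm (x::'a))) \<partial>lborel) =
    (\<integral>\<^sup>+r. ennreal (DIM('a) * unit_ball_vol DIM('a) * r ^ (DIM('a) - 1)) * indicator {0..} r * ennreal (F r) \<partial>lborel)"
    by (rule nn_integral_radial) measurable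
  also have "...
      = (\<integral>\<^sup>+r. ennreal (DIM('a) * unit_ball_vol DIM('a)) * (ennreal (F r * r powr (real DIM('a) - 1)) * indicator {0<..} r) \<partial>lborel)"
  proof (intro nn_integral_cong)
    fix r :: real
    consider "r < 0" | "r = 0" | "r > 0" by linarith
    then show "ennreal (DIM('a) * unit_ball_vol DIM('a) * r ^ (DIM('a) - 1)) * indicator {0..} r * ennreal (F r)
      = ennreal (DIM('a) * unit_ball_vol DIM('a)) * (ennreal (F r * r powr (real DIM('a) - 1)) * indicator {0<..} r)"
    proof cases
      case 2
      then show ?thesis using D by (simp add: power_0_left)
    next
      case 3
      have "r powr (real DIM('a) - 1) = r ^ (DIM('a) - 1)"
        using 3 D powr_realpow[OF 3, of "DIM('a) - 1"] by (simp add: of_nat_diff)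
      then show ?thesis using 3 F[of r] by (simp add: ennreal_mult[symmetric] mult_ac)
    qed simp
  qed
  also have "... = ennreal (DIM('a) * unit_ball_vol DIM('a)) *
    (\<integral>\<^sup>+r. ennreal (F r * r powr (real DIM('a) - 1)) * indicator {0<..} r \<partial>lborel)"
    by (intro nn_integral_cmult) measurable
  finally show ?thesis .
qed

text \<open>The size of \<open>\<integral> x powr (- q)\<close> over \<open>{a..b}\<close>: the integral is governed by the upper end for
  \<open>q < 1\<close>, by the lower end for \<open>q > 1\<close>, and by all scales for \<open>q = 1\<close>.\<close>

definition power_bound :: "real \<Rightarrow> real \<Rightarrow> real \<Rightarrow> real" where
  "power_bound q a b =
     (if q < 1 then b powr (1 - q) / (1 - q) else if q = 1 then ln (b / a) else a powr (1 - q) / (q - 1))"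

lemma power_bound_nonneg: "0 < a \<Longrightarrow> a \<le> b \<Longrightarrow> 0 \<le> power_bound q a b"
  by (auto simp: power_bound_def)

lemma nn_integral_inverse_power_le:
  fixes a b q :: real
  assumes "0 < a" "a \<le> b"
  shows "(\<integral>\<^sup>+x. ennreal (x powr (-q)) * indicator {a..b} x \<partial>lborel) \<le> ennreal (power_bound q a b)"
proof (cases "q = 1")
  case True
  have "(\<integral>\<^sup>+x. ennreal (x powr (-q)) * indicator {a..b} x \<partial>lborel) = ennreal (ln b - ln a)"
    using assms True
    by (intro nn_integral_FTC_Icc) (auto intro!: derivative_eq_intros simp: powr_minus field_simps)
  then show ?thesis using True assms by (simp add: ln_div power_bound_def)
next
  case False
  have "(\<integral>\<^sup>+x. ennreal (x powr (-q)) * indicator {a..b} x \<partial>lborel)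
      = ennreal (b powr (1 - q) / (1 - q) - a powr (1 - q) / (1 - q))"
    using assms False
    by (intro nn_integral_FTC_Icc) (auto intro!: derivative_eq_intros simp: divide_simps)
  moreover have "b powr (1 - q) / (1 - q) - a powr (1 - q) / (1 - q)
      \<le> (if q < 1 then b powr (1 - q) / (1 - q) else a powr (1 - q) / (q - 1))"
  proof (cases "q < 1")
    case True then show ?thesis by simp
  next
    case q: False
    have "b powr (1 - q) / (1 - q) \<le> 0" using q by (intro divide_nonneg_nonpos) auto
    moreover have "- (a powr (1 - q) / (1 - q)) = a powr (1 - q) / (q - 1)"
      by (metis minus_diff_eq minus_divide_right)
    ultimately show ?thesis using q by simp
  qed
  ultimately show ?thesis using False by (auto simp: power_bound_def intro: ennreal_leI)
qed

section \<open>WKB bounds for the Liouville normal form\<close>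

text \<open>The functions \<open>g\<close>, \<open>m\<close>, \<open>h\<close> stand for \<open>\<bar>v\<bar>\<^sup>2\<close>, \<open>Re (v * cnj v')\<close> and \<open>\<bar>v'\<bar>\<^sup>2\<close>, where \<open>v\<close> solves
  \<open>v'' + Q v = 0\<close> with \<open>Q r = e ^ 6 - r\<^sup>2 - \<kappa> (\<kappa> - 1) / r\<^sup>2\<close>. The three quantities satisfy a closed
  linear system, and the analysis needs of \<open>v\<close> no more than this system and the
  Cauchy-Schwarz inequality.\<close>

locale liouville_solution =
  fixes e \<kappa> M :: real and g m h :: "real \<Rightarrow> real"
  assumes e_large: "e \<ge> 1" "e ^ 4 \<ge> 2"
    and kappa_ge: "\<kappa> \<ge> 1 / 2"
    and g_deriv: "\<And>r. r > 0 \<Longrightarrow> (g has_real_derivative 2 * m r) (at r)"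
    and m_deriv: "\<And>r. r > 0 \<Longrightarrow>
      (m has_real_derivative h r - (e ^ 6 - r\<^sup>2 - \<kappa> * (\<kappa> - 1) / r\<^sup>2) * g r) (at r)"
    and h_deriv: "\<And>r. r > 0 \<Longrightarrow>
      (h has_real_derivative - 2 * (e ^ 6 - r\<^sup>2 - \<kappa> * (\<kappa> - 1) / r\<^sup>2) * m r) (at r)"
    and g_nonneg: "\<And>r. 0 \<le> g r" and h_nonneg: "\<And>r. 0 \<le> h r"
    and m_bound: "\<And>r. (m r)\<^sup>2 \<le> g r * h r"
    and g_meas [measurable]: "g \<in> borel_measurable borel"
    and h_meas [measurable]: "h \<in> borel_measurable borel"
    and mass: "(\<integral>\<^sup>+r. ennreal (g r) * indicator {0<..} r \<partial>lborel) = ennreal M"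
    and M_pos: "M > 0"
begin

text \<open>This coefficient is nonnegative except in dimension two, where it equals \<open>-1/4\<close>. In that case
  \<open>P - c / r\<^sup>2\<close> is not concave near the origin and the WKB error terms lose their sign. Therefore
  the inverse square term is treated as a perturbation of \<open>P\<close>.\<close>

definition c where "c = \<kappa> * (\<kappa> - 1)"
definition P where "P r = e ^ 6 - r\<^sup>2"

text \<open>The WKB energy: for \<open>v\<close> of the form \<open>P powr (-1/4) * cos \<theta>\<close> with \<open>\<theta>' = sqrt P\<close>, it is constant up
  to lower order terms.\<close>

definition W where "W r = sqrt (P r) * g r + h r / sqrt (P r)"

text \<open>The oscillating region extends from \<open>r1\<close> to \<open>r2\<close>, where \<open>P\<close> equals \<open>e\<^sup>2\<close>; the Airy zone around the
  turning point \<open>e ^ 3\<close> extends from \<open>r2\<close> to \<open>r0\<close>.\<close>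

definition r1 where "r1 = 1 / (2 * e ^ 3)"
definition r2 where "r2 = sqrt (e ^ 6 - e\<^sup>2)"
definition r0 where "r0 = e ^ 3 + 1 / e"

lemma e_pos: "e > 0" using e_large by linarith

lemma e_power_bounds: "e\<^sup>2 \<le> e ^ 6 / 2" "e ^ 6 \<ge> 2" "e ^ 2 \<ge> 1"  "e ^ 3 \<ge> 1"
proof -
  have "e\<^sup>2 * 2 \<le> e\<^sup>2 * e ^ 4" using e_large by (intro mult_left_mono) auto
  then show "e\<^sup>2 \<le> e ^ 6 / 2" by (simp add: power_add[symmetric])
  show "e ^ 2 \<ge> 1"  "e ^ 3 \<ge> 1" using e_large by auto
  have "2 * 1 \<le> e ^ 4 * e ^ 2" using e_large by (intro mult_mono) auto
  then show "e ^ 6 \<ge> 2" by (simp add: power_add[symmetric])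
qed

lemma c_bounds: "\<bar>c\<bar> \<le> \<kappa>\<^sup>2" "c \<ge> - 1 / 4"
proof -
  show "\<bar>c\<bar> \<le> \<kappa>\<^sup>2" using kappa_ge by (auto simp: c_def abs_mult power2_eq_square intro!: mult_left_mono)
  have "c + 1/4 = (\<kappa> - 1/2)\<^sup>2" by (simp add: c_def power2_eq_square algebra_simps)
  moreover have "(\<kappa> - 1/2)\<^sup>2 \<ge> 0" by simp
  ultimately show "c \<ge> - 1 / 4" by linarith
qed

lemma r2_sq: "r2\<^sup>2 = e ^ 6 - e\<^sup>2"
  unfolding r2_def using e_power_bounds by (intro real_sqrt_pow2) linarith

lemma r2_bounds: "r2 > 0" "r2 \<le> e ^ 3" "e ^ 3 / 2 \<le> r2" "r2\<^sup>2 \<ge> e ^ 6 / 2"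
proof -
  show "r2\<^sup>2 \<ge> e ^ 6 / 2" using r2_sq e_power_bounds by linarith
  then show "r2 > 0" using e_power_bounds by (simp add: r2_def)
  have "r2\<^sup>2 \<le> (e ^ 3)\<^sup>2" by (simp add: r2_sq flip: power_mult)
  then show "r2 \<le> e ^ 3" by (rule power2_le_imp_le) (use e_pos in auto)
  have "(e ^ 3 / 2)\<^sup>2 = e ^ 6 / 4" by (simp add: power_divide flip: power_mult)
  then have "(e ^ 3 / 2)\<^sup>2 \<le> r2\<^sup>2" using \<open>r2\<^sup>2 \<ge> e ^ 6 / 2\<close> e_power_bounds by linarith
  then show "e ^ 3 / 2 \<le> r2" by (rule power2_le_imp_le) (use \<open>r2 > 0\<close> in auto)
qed

lemma r1_bounds: "r1 > 0" "r1 \<le> e ^ 3 / 4" "r1 \<le> r2"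
proof -
  show "r1 > 0" using e_pos by (simp add: r1_def)
  have "2 \<le> e ^ 3 * e ^ 3" using e_power_bounds by (simp add: power_add[symmetric])
  then show "r1 \<le> e ^ 3 / 4" using e_pos by (simp add: r1_def field_simps)
  then show "r1 \<le> r2" using r2_bounds(3) e_power_bounds by linarith
qed

lemma P_ge: assumes "0 < r" "r \<le> r2" shows "P r \<ge> e\<^sup>2" "P r > 0" "P r \<ge> 1"
proof -
  have "r\<^sup>2 \<le> r2\<^sup>2" using assms by (intro power_mono) auto
  then show "P r \<ge> e\<^sup>2" by (simp add: P_def r2_sq)
  then show "P r > 0" "P r \<ge> 1" using e_power_bounds by linarith+
qed

lemma abs_m_le: assumes "w > 0" shows "\<bar>m r\<bar> \<le> (w * g r + h r / w) / 2"
proof -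
  have "\<bar>m r\<bar> = sqrt ((m r)\<^sup>2)" by simp
  also have "... \<le> sqrt ((w * g r) * (h r / w))"
    using assms m_bound by (intro real_sqrt_le_mono) auto
  also have "... \<le> (w * g r + h r / w) / 2"
    using assms g_nonneg h_nonneg by (intro arith_geo_mean_sqrt) auto
  finally show ?thesis .
qed

lemma W_nonneg: "0 < r \<Longrightarrow> r \<le> r2 \<Longrightarrow> 0 \<le> W r"
  unfolding W_def using g_nonneg[of r] h_nonneg[of r] P_ge[of r] by simp

text \<open>The derivative of \<open>W\<close> contains \<open>(r / P powr (3/2)) * m'\<close>, which is too large to be estimated
  directly. Adding \<open>\<phi> * m\<close> with \<open>\<phi> = - r / P powr (3/2)\<close> replaces it by \<open>\<phi>' * m\<close>. Since \<open>\<phi>\<close> is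
  monotone with values in \<open>[-1, 0]\<close>, its derivative has bounded integral. The inverse square
  perturbation contributes terms that are controlled by \<open>\<phi>'\<close> and by \<open>1 / (r\<^sup>2 * sqrt P)\<close>, and the
  latter has the bounded primitive \<open>- sqrt P / (e ^ 6 * r)\<close>. Thus the corrected energy satisfies a Gronwall inequality with a weight
  of bounded total variation.\<close>

lemma W_comparison:
  assumes s: "s \<in> {r1..r2}" and t: "t \<in> {r1..r2}"
  shows "W s \<le> 3 * exp (6 * (2 * \<bar>c\<bar> + 1)) * W t"
proof -
  define k where "k = 2 * \<bar>c\<bar> + 1"
  define \<phi> where "\<phi> r = - r / (P r * sqrt (P r))" for r
  define \<phi>' where "\<phi>' r = - 1 / (P r * sqrt (P r)) - 3 * r\<^sup>2 / ((P r)\<^sup>2 * sqrt (P r))" for r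
  define V where "V r = W r + \<phi> r * m r" for r
  define x where "x r = 1 / (r\<^sup>2 * sqrt (P r))" for r
  define F where "F r = 2 * k * (- sqrt (P r) / (e ^ 6 * r) - \<phi> r)" for r
  have basic: "r > 0" "P r > 0" "P r \<ge> 1" "P r \<ge> e\<^sup>2" if "r \<in> {r1..r2}" for r
    using that r1_bounds P_ge[of r] by auto
  have dP: "(P has_real_derivative - 2 * r) (at r)" for r
    unfolding P_def[abs_def] by (auto intro!: derivative_eq_intros)
  have dS: "((\<lambda>r. sqrt (P r)) has_real_derivative - r / sqrt (P r)) (at r)" if "P r > 0" for r
    using that by (auto intro!: derivative_eq_intros dP simp: field_simps)
  have phi_range: "-1 \<le> \<phi> r" "\<phi> r \<le> 0" if "r \<in> {r1..r2}" for r
  proof -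
    have "sqrt (P r) \<ge> e" using basic[OF that] e_pos by (intro real_le_rsqrt) auto
    then have "e\<^sup>2 * e \<le> P r * sqrt (P r)" using basic[OF that] e_pos by (intro mult_mono) auto
    moreover have "r \<le> e ^ 3" using that r2_bounds by auto
    ultimately have "r \<le> P r * sqrt (P r)" by (simp add: power2_eq_square power3_eq_cube)
    then show "-1 \<le> \<phi> r" "\<phi> r \<le> 0" using basic[OF that] by (auto simp: \<phi>_def field_simps)
  qed
  have m_W: "\<bar>m r\<bar> \<le> W r / 2" if "r \<in> {r1..r2}" for r
    using abs_m_le[of "sqrt (P r)" r] basic[OF that] by (simp add: W_def)
  have W_nn: "W r \<ge> 0" if "r \<in> {r1..r2}" for r using W_nonneg basic[OF that] that by auto
  have phi_m: "\<bar>\<phi> r * m r\<bar> \<le> W r / 2" if "r \<in> {r1..r2}" for r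
  proof -
    have "\<bar>\<phi> r\<bar> * \<bar>m r\<bar> \<le> 1 * (W r / 2)"
      using phi_range[OF that] m_W[OF that] by (intro mult_mono) auto
    then show ?thesis by (simp add: abs_mult)
  qed
  have V_W: "W r \<le> 2 * V r" "V r \<le> 3 / 2 * W r" "V r \<ge> 0" if "r \<in> {r1..r2}" for r
    using phi_m[OF that] W_nn[OF that] by (auto simp: V_def abs_le_iff)
  have dphi: "(\<phi> has_real_derivative \<phi>' r) (at r)" if "r \<in> {r1..r2}" for r
  proof -
    note b = basic[OF that]
    define s where "s = sqrt (P r)"
    have s: "s > 0" "P r = s\<^sup>2" using b by (auto simp: s_def)
    have "(\<phi> has_real_derivative
       ((- 1) * (P r * sqrt (P r)) - (- r) * ((- 2 * r) * sqrt (P r) + (- r / sqrt (P r)) * P r)) / ((P r * sqrt (P r)) * (P r * sqrt (P r)))) (at r)"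
      unfolding \<phi>_def[abs_def]
      by (rule DERIV_divide DERIV_mult DERIV_minus dP dS DERIV_ident | use b in simp)+
    moreover have "((- 1) * (P r * sqrt (P r)) - (- r) * ((- 2 * r) * sqrt (P r) + (- r / sqrt (P r)) * P r)) / ((P r * sqrt (P r)) * (P r * sqrt (P r))) = \<phi>' r"
      unfolding \<phi>'_def s_def[symmetric] unfolding s(2) using s(1)
      by (simp add: field_simps power2_eq_square)
    ultimately show ?thesis by simp
  qed
  \<comment> \<open>In the derivative of \<open>V\<close> the terms without \<open>c\<close> cancel, except \<open>\<phi>' * m\<close>.\<close>
  define V' where "V' r
      = - c * g r / (r * P r * sqrt (P r)) + 2 * c * m r / (r\<^sup>2 * sqrt (P r)) + \<phi>' r * m r" for r
  have dV: "(V has_real_derivative V' r) (at r)" if "r \<in> {r1..r2}" for r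
  proof -
    note b = basic[OF that]
    define s where "s = sqrt (P r)"
    have s: "s > 0" "P r = s\<^sup>2" using b by (auto simp: s_def)
    have Q: "e ^ 6 - r\<^sup>2 - \<kappa> * (\<kappa> - 1) / r\<^sup>2 = P r - c / r\<^sup>2" by (simp add: P_def c_def)
    have dg: "(g has_real_derivative 2 * m r) (at r)"
      and dm: "(m has_real_derivative h r - (s\<^sup>2 - c / r\<^sup>2) * g r) (at r)"
      and dh: "(h has_real_derivative - 2 * (s\<^sup>2 - c / r\<^sup>2) * m r) (at r)"
      using g_deriv[OF b(1)] m_deriv[OF b(1)] h_deriv[OF b(1)] unfolding Q s(2) by auto
    have sr: "sqrt (P r) = s" by (simp add: s_def)
    have "(V has_real_derivative
       (- r / s * g r + 2 * m r * s)
       + (- 2 * (s\<^sup>2 - c / r\<^sup>2) * m r * s - h r * (- r / s)) / (s * s)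
       + (\<phi>' r * m r + (h r - (s\<^sup>2 - c / r\<^sup>2) * g r) * \<phi> r)) (at r)"
      using DERIV_add[OF DERIV_add[OF DERIV_mult[OF dS[OF b(2)] dg] DERIV_divide[OF dh dS[OF b(2)]]]
          DERIV_mult[OF dphi[OF that] dm], unfolded sr] s(1)
      unfolding V_def[abs_def] W_def[abs_def] by simp
    moreover have "(- r / s * g r + 2 * m r * s)
       + (- 2 * (s\<^sup>2 - c / r\<^sup>2) * m r * s - h r * (- r / s)) / (s * s)
       + (\<phi>' r * m r + (h r - (s\<^sup>2 - c / r\<^sup>2) * g r) * \<phi> r) = V' r"
    proof -
      define G H N N' where "G = r / s * g r" and "H = r * h r / (s\<^sup>2 * s)"
        and "N = 2 * s * m r" and "N' = 2 * c * m r / (r\<^sup>2 * s)"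
      have 1: "- 2 * (s\<^sup>2 - c / r\<^sup>2) * m r * s / (s * s) = - N + N'"
        unfolding N_def N'_def using s(1) b(1)
        by (simp add: divide_simps) (simp add: algebra_simps power2_eq_square)
      have 2: "h r * (- r / s) / (s * s) = - H"
        unfolding H_def by (simp add: power2_eq_square mult.commute)
      have 3: "(h r - (s\<^sup>2 - c / r\<^sup>2) * g r) * \<phi> r = - H + G - c * g r / (r * s\<^sup>2 * s)"
        unfolding \<phi>_def sr unfolding s(2) G_def H_def using s(1) b(1)
        by (simp add: divide_simps) (simp add: algebra_simps power2_eq_square)
      have 4: "- r / s * g r = - G" "2 * m r * s = N" unfolding G_def N_def by simp_all
      have V': "V' r = - c * g r / (r * s\<^sup>2 * s) + N' + \<phi>' r * m r"
        unfolding V'_def N'_def sr unfolding s(2) ..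
      show ?thesis unfolding diff_divide_distrib 1 2 3 4 V' by linarith
    qed
    ultimately show ?thesis by simp
  qed
  have dF: "(F has_real_derivative 2 * k * (x r - \<phi>' r)) (at r)" if "r \<in> {r1..r2}" for r
  proof -
    note b = basic[OF that]
    define s where "s = sqrt (P r)"
    have s: "s > 0" "P r = s\<^sup>2" using b by (auto simp: s_def)
    have e: "e ^ 6 = s\<^sup>2 + r\<^sup>2" using s(2) by (simp add: P_def)
    have e0: "e ^ 6 > 0" using e_pos by simp
    have "((\<lambda>r. e ^ 6 * r) has_real_derivative e ^ 6) (at r)"
      by (auto intro!: derivative_eq_intros)
    from DERIV_cmult[OF DERIV_diff[OF DERIV_divide[OF DERIV_minus[OF dS[OF b(2)]] this] dphi[OF that]], of "2 * k"]
    have "(F has_real_derivative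
       2 * k * ((- (- r / sqrt (P r)) * (e ^ 6 * r) - (- sqrt (P r)) * (e ^ 6)) / ((e ^ 6 * r) * (e ^ 6 * r)) - \<phi>' r)) (at r)"
      unfolding F_def[abs_def] using b e0 by (simp add: mult.assoc)
    moreover have "(- (- r / sqrt (P r)) * (e ^ 6 * r) - (- sqrt (P r)) * (e ^ 6)) / ((e ^ 6 * r) * (e ^ 6 * r)) = (r\<^sup>2 + s\<^sup>2) / (e ^ 6 * r\<^sup>2 * s)"
      unfolding s_def[symmetric] using s(1) b(1) e_pos by (simp add: field_simps power2_eq_square)
    moreover have "... = x r" unfolding x_def s_def[symmetric] using e e0 by (simp add: add.commute)
    ultimately show ?thesis by simp
  qed
  have bound: "\<bar>V' r\<bar> \<le> 2 * k * (x r - \<phi>' r) * V r" if "r \<in> {r1..r2}" for r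
  proof -
    note b = basic[OF that]
    define s where "s = sqrt (P r)"
    have s: "s > 0" "P r = s\<^sup>2" "s \<ge> 1" using b by (auto simp: s_def)
    define y where "y = - \<phi>' r"
    have x0: "x r \<ge> 0" by (simp add: x_def b less_imp_le)
    have "y = 1 / (P r * s) + 3 * r\<^sup>2 / ((P r)\<^sup>2 * s)" unfolding y_def \<phi>'_def s_def[symmetric] by simp
    moreover have "3 * r\<^sup>2 / ((P r)\<^sup>2 * s) \<ge> 0" using s(1)
      by (intro divide_nonneg_nonneg mult_nonneg_nonneg) auto
    moreover have "1 / (P r * s) \<ge> 0" using s(1) b by (intro divide_nonneg_nonneg mult_nonneg_nonneg) auto
    ultimately have y1: "1 / (P r * s) \<le> y" and y0: "y \<ge> 0" by linarith+
    have g: "g r \<le> W r / s" using h_nonneg[of r] s(1) by (simp add: W_def s_def[symmetric] field_simps)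
    have amgm: "1 / (r * P r * s) * (1 / s) \<le> (x r + y) / 2"
    proof -
      have "1 / (r * P r) = (1 / r) * (1 / s) * (1 / s)" using s by (simp add: power2_eq_square)
      also have "... = sqrt (x r * (1 / (P r * s)))"
        by (rule real_sqrt_unique[symmetric]) (use s b in \<open>auto simp: x_def s_def[symmetric] field_simps power2_eq_square\<close>)
      also have "... \<le> (x r + 1 / (P r * s)) / 2" using x0 s by (intro arith_geo_mean_sqrt) auto
      also have "... \<le> (x r + y) / 2" using y1 by (intro divide_right_mono add_left_mono) auto
      finally have 1: "1 / (r * P r) \<le> (x r + y) / 2" .
      have "1 / (r * P r * s) * (1 / s) = 1 / (r * P r) * (1 / P r)" using s
        by (simp add: power2_eq_square)
      also have "... \<le> 1 / (r * P r) * 1" using b by (intro mult_left_mono) auto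
      also have "... \<le> (x r + y) / 2" using 1 by simp
      finally show ?thesis .
    qed
    have t1: "\<bar>- c * g r / (r * P r * s)\<bar> \<le> \<bar>c\<bar> * ((x r + y) / 2) * W r"
    proof -
      have "\<bar>- c * g r / (r * P r * s)\<bar> = \<bar>c\<bar> * (1 / (r * P r * s) * g r)"
        using b s g_nonneg[of r] by (simp add: abs_mult)
      also have "... \<le> \<bar>c\<bar> * (1 / (r * P r * s) * (W r / s))"
        using g b s by (intro mult_left_mono) auto
      also have "... = \<bar>c\<bar> * (1 / (r * P r * s) * (1 / s)) * W r" by simp
      also have "... \<le> \<bar>c\<bar> * ((x r + y) / 2) * W r"
        using amgm W_nn[OF that] by (intro mult_left_mono mult_right_mono) auto
      finally show ?thesis .
    qed
    have t2: "\<bar>2 * c * m r / (r\<^sup>2 * s)\<bar> \<le> \<bar>c\<bar> * x r * W r"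
    proof -
      have "\<bar>2 * c * m r / (r\<^sup>2 * s)\<bar> = \<bar>c\<bar> * x r * (2 * \<bar>m r\<bar>)"
        using b s by (simp add: abs_mult x_def s_def[symmetric])
      also have "... \<le> \<bar>c\<bar> * x r * W r" using m_W[OF that] x0 by (intro mult_left_mono) auto
      finally show ?thesis .
    qed
    have t3: "\<bar>\<phi>' r * m r\<bar> \<le> y / 2 * W r"
    proof -
      have "\<bar>\<phi>' r * m r\<bar> = y * \<bar>m r\<bar>" using y0 by (simp add: abs_mult y_def)
      also have "... \<le> y * (W r / 2)" using m_W[OF that] y0 by (intro mult_left_mono) auto
      finally show ?thesis by simp
    qed
    have "\<bar>V' r\<bar> \<le> \<bar>c\<bar> * ((x r + y) / 2) * W r + \<bar>c\<bar> * x r * W r + y / 2 * W r"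
      using t1 t2 t3 unfolding V'_def s_def by linarith
    also have "... = (\<bar>c\<bar> * ((x r + y) / 2) + \<bar>c\<bar> * x r + y / 2) * W r" by (simp add: algebra_simps)
    also have "... \<le> (k * (x r + y)) * W r"
    proof (intro mult_right_mono W_nn[OF that])
      define cx cy where "cx = \<bar>c\<bar> * x r" and "cy = \<bar>c\<bar> * y"
      have "cx \<ge> 0" "cy \<ge> 0" using x0 y0 by (auto simp: cx_def cy_def)
      moreover have 1: "\<bar>c\<bar> * ((x r + y) / 2) = (cx + cy) / 2"
        "k * (x r + y) = 2 * cx + 2 * cy + x r + y"
        unfolding k_def cx_def cy_def by (simp_all add: algebra_simps add_divide_distrib)
      ultimately show "\<bar>c\<bar> * ((x r + y) / 2) + \<bar>c\<bar> * x r + y / 2 \<le> k * (x r + y)"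
        using x0 y0 unfolding 1 cx_def[symmetric] by (simp add: field_simps)
    qed
    also have "... \<le> (k * (x r + y)) * (2 * V r)"
      using V_W[OF that] x0 y0 by (intro mult_left_mono) (auto simp: k_def)
    finally show ?thesis by (simp add: y_def algebra_simps)
  qed
  have F_range: "- 4 * k \<le> F r" "F r \<le> 2 * k" if "r \<in> {r1..r2}" for r
  proof -
    note b = basic[OF that]
    have k: "k > 0" by (simp add: k_def)
    have "P r \<le> (e ^ 3)\<^sup>2" by (simp add: P_def flip: power_mult)
    then have "sqrt (P r) \<le> e ^ 3" using e_pos b by (intro real_le_lsqrt) auto
    moreover have "1 \<le> 2 * e ^ 3 * r" using that e_pos by (auto simp: r1_def field_simps)
    then have "e ^ 3 * 1 \<le> e ^ 3 * (2 * e ^ 3 * r)" using e_pos by (intro mult_left_mono) auto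
    moreover have "e ^ 3 * (2 * e ^ 3 * r) = 2 * (e ^ 6 * r)" by (simp add: power_add[symmetric])
    ultimately have 1: "sqrt (P r) \<le> 2 * (e ^ 6 * r)" by linarith
    have D: "e ^ 6 * r > 0" using b e_pos by simp
    have "- 2 \<le> - sqrt (P r) / (e ^ 6 * r)" "- sqrt (P r) / (e ^ 6 * r) \<le> 0"
      using 1 D b by (auto simp only: pos_le_divide_eq pos_divide_le_eq) auto
    then have "- 2 \<le> - sqrt (P r) / (e ^ 6 * r) - \<phi> r" "- sqrt (P r) / (e ^ 6 * r) - \<phi> r \<le> 1"
      using phi_range[OF that] by linarith+
    then have "2 * k * (- 2) \<le> F r" "F r \<le> 2 * k * 1"
      unfolding F_def using k by (intro mult_left_mono; simp)+
    then show "- 4 * k \<le> F r" "F r \<le> 2 * k" by auto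
  qed
  have "W s \<le> 2 * V s" by (rule V_W[OF s])
  also have "V s \<le> exp \<bar>F s - F t\<bar> * V t"
    by (rule gronwall_comparison[where W = V and W' = V' and F = F and a = r1 and b = r2
          and F' = "\<lambda>r. 2 * k * (x r - \<phi>' r)"])
      (use dV dF bound V_W(3) s t in auto)
  also have "... \<le> exp (6 * k) * (3 / 2 * W t)"
  proof (intro mult_mono)
    show "exp \<bar>F s - F t\<bar> \<le> exp (6 * k)" using F_range[OF s] F_range[OF t] by auto
  qed (use V_W[OF t] in auto)
  finally show ?thesis by (simp add: k_def mult_ac)
qed

section \<open>The turning point and the forbidden region\<close>

text \<open>The constants \<open>K1\<close> and \<open>K2\<close> depend on \<open>\<kappa>\<close> alone. This independence of \<open>e\<close> makes the final bounds
  uniform in the frequency.\<close>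

definition K1 where "K1 = 3 * exp (6 * (2 * \<bar>c\<bar> + 1))"
definition K2 where "K2 = exp (4 * (4 + \<kappa>\<^sup>2))"

lemma K1_K2_ge_one: "K1 \<ge> 1" "K2 \<ge> 1"
proof -
  have "exp (6 * (2 * \<bar>c\<bar> + 1)) \<ge> 1" by simp
  then show "K1 \<ge> 1" unfolding K1_def by linarith
  show "K2 \<ge> 1" by (simp add: K2_def)
qed

lemma r0_bounds: "r2 \<le> r0" "r0 - r2 \<le> 4 / e" "r0\<^sup>2 = e ^ 6 + 2 * e\<^sup>2 + 1 / e\<^sup>2" "r0 > 0"
proof -
  show sq: "r0\<^sup>2 = e ^ 6 + 2 * e\<^sup>2 + 1 / e\<^sup>2"
    using e_pos
    by (simp add: r0_def power2_sum power_divide power3_eq_cube power2_eq_square flip: power_mult)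
      (simp add: eval_nat_numeral field_simps)
  show "r2 \<le> r0" "r0 > 0" using r2_bounds e_pos
    by (auto simp: r0_def intro: add_nonneg_pos add_increasing2)
  have "1 / e\<^sup>2 \<le> 1" using e_power_bounds(3) by (simp add: divide_le_eq_1)
  then have "r0\<^sup>2 - r2\<^sup>2 \<le> 4 * e\<^sup>2" using sq r2_sq e_power_bounds by linarith
  then have "(r0 - r2) * (r0 + r2) \<le> 4 * e\<^sup>2" by (simp add: algebra_simps power2_eq_square)
  moreover have "(r0 - r2) * e ^ 3 \<le> (r0 - r2) * (r0 + r2)"
    using \<open>r2 \<le> r0\<close> r2_bounds e_pos by (intro mult_left_mono) (auto simp: r0_def)
  ultimately have "(r0 - r2) * e * e\<^sup>2 \<le> 4 * e\<^sup>2" by (simp add: eval_nat_numeral mult_ac)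
  then have "(r0 - r2) * e \<le> 4" using e_pos by (subst (asm) mult_le_cancel_right) auto
  then show "r0 - r2 \<le> 4 / e" using e_pos by (simp add: field_simps)
qed

lemma W_r2: "W r2 = e * g r2 + h r2 / e"
  using e_pos by (simp add: W_def P_def r2_sq)

text \<open>The zone has width of order \<open>1 / e\<close> and the potential is at most of order \<open>e\<^sup>2\<close> there. In the rescaled
  variable \<open>e * r\<close> the equation has bounded coefficients on a bounded interval.\<close>

lemma airy_zone:
  assumes r: "r \<in> {r2..r0}"
  shows "e * g r + h r / e \<le> K2 * W r2"
proof -
  define U where "U r = e * g r + h r / e" for r
  define Q where "Q r = e ^ 6 - r\<^sup>2 - \<kappa> * (\<kappa> - 1) / r\<^sup>2" for r
  have dU: "(U has_real_derivative 2 * (e - Q r / e) * m r) (at r)" if "r \<in> {r2..r0}" for r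
  proof -
    have "r > 0" using that r2_bounds by auto
    from DERIV_add[OF DERIV_cmult[OF g_deriv[OF this], of e] DERIV_cdivide[OF h_deriv[OF this], of e]]
    show ?thesis unfolding U_def[abs_def] Q_def[symmetric]
      by (simp add: algebra_simps diff_divide_distrib)
  qed
  have dF: "((\<lambda>r. (4 + \<kappa>\<^sup>2) * e * r) has_real_derivative (4 + \<kappa>\<^sup>2) * e) (at r)" for r
    by (auto intro!: derivative_eq_intros)
  have Q_bound: "\<bar>Q r\<bar> \<le> (3 + \<kappa>\<^sup>2) * e\<^sup>2" if "r \<in> {r2..r0}" for r
  proof -
    have "r2\<^sup>2 \<le> r\<^sup>2" "r\<^sup>2 \<le> r0\<^sup>2" using that r2_bounds by (auto intro!: power_mono)
    moreover have "1 / e\<^sup>2 \<le> 1" using e_power_bounds(3) by (simp add: divide_le_eq_1)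
    ultimately have 1: "\<bar>e ^ 6 - r\<^sup>2\<bar> \<le> 3 * e\<^sup>2" "r\<^sup>2 \<ge> 1"
      using r0_bounds(3) r2_sq e_power_bounds by linarith+
    have "\<bar>c\<bar> / r\<^sup>2 \<le> \<bar>c\<bar> / 1" using 1 by (intro divide_left_mono) auto
    also have "... \<le> \<kappa>\<^sup>2" using c_bounds by simp
    also have "... \<le> \<kappa>\<^sup>2 * e\<^sup>2" using e_power_bounds
      by (simp add: mult_left_le_one_le mult_le_cancel_left1)
    finally have "\<bar>c / r\<^sup>2\<bar> \<le> \<kappa>\<^sup>2 * e\<^sup>2" by simp
    moreover have "Q r = (e ^ 6 - r\<^sup>2) - c / r\<^sup>2" "(3 + \<kappa>\<^sup>2) * e\<^sup>2 = 3 * e\<^sup>2 + \<kappa>\<^sup>2 * e\<^sup>2"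
      by (simp_all add: Q_def c_def algebra_simps)
    ultimately show ?thesis using 1 by linarith
  qed
  have U_nonneg: "U r \<ge> 0" for r using g_nonneg h_nonneg e_pos by (simp add: U_def)
  have bound: "\<bar>2 * (e - Q r / e) * m r\<bar> \<le> (4 + \<kappa>\<^sup>2) * e * U r" if "r \<in> {r2..r0}" for r
  proof -
    have "\<bar>Q r\<bar> / e \<le> (3 + \<kappa>\<^sup>2) * e\<^sup>2 / e"
      using Q_bound[OF that] e_pos by (intro divide_right_mono) auto
    then have "\<bar>Q r / e\<bar> \<le> (3 + \<kappa>\<^sup>2) * e" using e_pos by (simp add: power2_eq_square)
    moreover have "(4 + \<kappa>\<^sup>2) * e = e + (3 + \<kappa>\<^sup>2) * e" by (simp add: algebra_simps)
    ultimately have "\<bar>e - Q r / e\<bar> \<le> (4 + \<kappa>\<^sup>2) * e" using e_pos by linarith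
    moreover have "2 * \<bar>m r\<bar> \<le> U r" using abs_m_le[OF e_pos, of r] by (simp add: U_def)
    ultimately have "\<bar>e - Q r / e\<bar> * (2 * \<bar>m r\<bar>) \<le> ((4 + \<kappa>\<^sup>2) * e) * U r"
      using U_nonneg e_pos by (intro mult_mono) auto
    moreover have "\<bar>2 * (e - Q r / e) * m r\<bar> = \<bar>e - Q r / e\<bar> * (2 * \<bar>m r\<bar>)"
      by (simp only: abs_mult abs_numeral mult_ac)
    ultimately show ?thesis by simp
  qed
  have "U r \<le> exp \<bar>(4 + \<kappa>\<^sup>2) * e * r - (4 + \<kappa>\<^sup>2) * e * r2\<bar> * U r2"
    by (rule gronwall_comparison[where a = r2 and b = r0, OF dU dF bound U_nonneg])
      (use r r0_bounds in auto)
  also have "... \<le> K2 * U r2"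
  proof (intro mult_right_mono U_nonneg)
    have "(4 + \<kappa>\<^sup>2) * e * (r - r2) \<le> (4 + \<kappa>\<^sup>2) * e * (4 / e)"
      using r r0_bounds e_pos by (intro mult_left_mono) auto
    moreover have "(4 + \<kappa>\<^sup>2) * e * (r - r2) \<ge> 0" using r e_pos by auto
    ultimately show "exp \<bar>(4 + \<kappa>\<^sup>2) * e * r - (4 + \<kappa>\<^sup>2) * e * r2\<bar> \<le> K2"
      using e_pos by (simp add: K2_def right_diff_distrib[symmetric])
  qed
  finally show ?thesis by (simp add: U_def W_r2)
qed

text \<open>Beyond \<open>r0\<close> the potential is at most \<open>- e\<^sup>2\<close>. As \<open>g' = 2 m\<close>, this says that \<open>g\<close> is convex there,
  with a quantitative lower bound for its second derivative.\<close>

lemma m_deriv_ge: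
  assumes "r \<ge> r0"
  shows "(m has_real_derivative h r - (e ^ 6 - r\<^sup>2 - c / r\<^sup>2) * g r) (at r)"
    and "e\<^sup>2 * g r \<le> h r - (e ^ 6 - r\<^sup>2 - c / r\<^sup>2) * g r"
proof -
  have r: "r > 0" using assms r0_bounds by linarith
  show "(m has_real_derivative h r - (e ^ 6 - r\<^sup>2 - c / r\<^sup>2) * g r) (at r)"
    using m_deriv[OF r] by (simp add: c_def)
  have sq: "r0\<^sup>2 \<le> r\<^sup>2" using assms r0_bounds by (intro power_mono) auto
  moreover have "1 / e\<^sup>2 \<ge> 0" by simp
  ultimately have 1: "e ^ 6 - r\<^sup>2 \<le> - 2 * e\<^sup>2" "r\<^sup>2 \<ge> 1" using r0_bounds(3) e_power_bounds by linarith+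
  have "- c / r\<^sup>2 \<le> (1 / 4) / r\<^sup>2" using c_bounds by (intro divide_right_mono) auto
  also have "... \<le> (1 / 4) / 1" using 1 by (intro divide_left_mono) auto
  finally have "- (c / r\<^sup>2) \<le> 1 / 4" by simp
  then have "e\<^sup>2 \<le> - (e ^ 6 - r\<^sup>2 - c / r\<^sup>2)" using 1 e_power_bounds by linarith
  then have "e\<^sup>2 * g r \<le> - (e ^ 6 - r\<^sup>2 - c / r\<^sup>2) * g r" using g_nonneg by (intro mult_right_mono) auto
  then show "e\<^sup>2 * g r \<le> h r - (e ^ 6 - r\<^sup>2 - c / r\<^sup>2) * g r" using h_nonneg[of r] by linarith
qed

lemma m_mono: assumes "r0 \<le> x" "x \<le> y" shows "m x \<le> m y"
proof (rule DERIV_nonneg_imp_nondecreasing[OF assms(2)])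
  fix r assume "x \<le> r" "r \<le> y"
  then have "r \<ge> r0" using assms by linarith
  from m_deriv_ge[OF this] show "\<exists>D. (m has_real_derivative D) (at r) \<and> 0 \<le> D"
    using g_nonneg[of r] by (meson order_trans mult_nonneg_nonneg zero_le_power2)
qed

text \<open>A convex function with a positive slope somewhere grows linearly and has infinite mass.\<close>

lemma m_nonpos: assumes b: "r0 \<le> b" shows "m b \<le> 0"
proof (rule ccontr)
  assume "\<not> m b \<le> 0"
  then have mb: "m b > 0" by simp
  have b0: "b > 0" using b r0_bounds by linarith
  have g_ge: "2 * m b \<le> g r" if "r \<ge> b + 1" for r
  proof -
    have "b \<le> r" using that by simp
    then have "g b - 2 * m b * b \<le> g r - 2 * m b * r"
    proof (rule DERIV_nonneg_imp_nondecreasing[where f = "\<lambda>x. g x - 2 * m b * x"])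
      fix x assume x: "b \<le> x" "x \<le> r"
      have "((\<lambda>x. g x - 2 * m b * x) has_real_derivative 2 * m x - 2 * m b) (at x)"
        using x b0 by (auto intro!: derivative_eq_intros g_deriv)
      then show "\<exists>D. ((\<lambda>x. g x - 2 * m b * x) has_real_derivative D) (at x) \<and> 0 \<le> D"
        using m_mono[OF b x(1)] by fastforce
    qed
    moreover have "2 * m b * (b + 1) \<le> 2 * m b * r" using that mb by (intro mult_left_mono) auto
    ultimately show ?thesis using g_nonneg[of b] by (simp add: algebra_simps)
  qed
  \<comment> \<open>On an interval of this length the lower bound \<open>2 * m b\<close> alone exceeds the mass.\<close>
  define N where "N = (M + 1) / (2 * m b)"
  have N: "N \<ge> 0" using mb M_pos by (simp add: N_def)
  have "ennreal (M + 1) = ennreal (2 * m b) * emeasure lborel {b + 1..b + 1 + N}"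
    using N mb by (simp add: ennreal_mult[symmetric] del: ennreal_plus) (simp add: N_def)
  also have "... = (\<integral>\<^sup>+r. ennreal (2 * m b) * indicator {b + 1..b + 1 + N} r \<partial>lborel)"
    by (simp add: nn_integral_cmult)
  also have "... \<le> (\<integral>\<^sup>+r. ennreal (g r) * indicator {0<..} r \<partial>lborel)"
    using b0 by (intro nn_integral_mono) (auto simp: indicator_def intro!: ennreal_leI g_ge)
  also have "... = ennreal M" by (rule mass)
  finally show False using M_pos by (simp add: ennreal_le_iff2 del: ennreal_plus)
qed

lemma tail_sup: assumes "r \<ge> r0" shows "g r \<le> g r0"
proof (rule DERIV_nonpos_imp_nonincreasing[OF assms])
  fix x assume "r0 \<le> x" "x \<le> r"
  then show "\<exists>D. (g has_real_derivative D) (at x) \<and> D \<le> 0"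
    using m_nonpos[of x] g_deriv[of x] r0_bounds by (intro exI[of _ "2 * m x"]) auto
qed

text \<open>Integrating \<open>e\<^sup>2 * g \<le> m'\<close> from \<open>r0\<close> to infinity gives at most \<open>- m r0\<close>, because \<open>m\<close> stays
  nonpositive. The slope at \<open>r0\<close> is known from the Airy zone, so no exponential decay is needed.\<close>

lemma tail_mass:
  "(\<integral>\<^sup>+r. ennreal (g r) * indicator {r0..} r \<partial>lborel) \<le> ennreal (K2 * W r2 / e\<^sup>2)"
proof -
  define f where "f r = h r - (e ^ 6 - r\<^sup>2 - c / r\<^sup>2) * g r" for r
  have [measurable]: "f \<in> borel_measurable borel" unfolding f_def[abs_def] by measurable
  have mr0: "- m r0 \<le> K2 * W r2"
    using abs_m_le[OF e_pos, of r0] airy_zone[of r0] r0_bounds K1_K2_ge_one W_nonneg[of r2] r2_bounds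
    by (auto simp: abs_le_iff)
  have fin: "(\<integral>\<^sup>+r. ennreal (e\<^sup>2 * g r) * indicator {r0..r0 + real i} r \<partial>lborel)
      \<le> ennreal (K2 * W r2)" for i
  proof -
    have "(\<integral>\<^sup>+r. ennreal (e\<^sup>2 * g r) * indicator {r0..r0 + real i} r \<partial>lborel)
      \<le> (\<integral>\<^sup>+r. ennreal (f r) * indicator {r0..r0 + real i} r \<partial>lborel)"
      using m_deriv_ge(2) by (intro nn_integral_mono) (auto simp: f_def indicator_def intro!: ennreal_leI)
    also have "... = ennreal (m (r0 + real i) - m r0)"
    proof (rule nn_integral_FTC_Icc)
      show "(m has_real_derivative f x) (at x)" if "x \<in> {r0..r0 + real i}" for x
        using m_deriv_ge(1)[of x] that by (simp add: f_def)
      show "0 \<le> f x" if "x \<in> {r0..r0 + real i}" for x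
        using m_deriv_ge(2)[of x] that mult_nonneg_nonneg[OF zero_le_power2[of e] g_nonneg[of x]]
        unfolding f_def by simp
    qed auto
    also have "... \<le> ennreal (K2 * W r2)"
      using m_nonpos[of "r0 + real i"] mr0 by (intro ennreal_leI) auto
    finally show ?thesis .
  qed
  have SUP_eq: "ennreal (e\<^sup>2 * g r) * indicator {r0..} r
    = (SUP i. ennreal (e\<^sup>2 * g r) * indicator {r0..r0 + real i} r)" for r
  proof -
    have inc: "incseq (\<lambda>i. ennreal (e\<^sup>2 * g r) * indicator {r0..r0 + real i} r)"
      by (auto simp: incseq_def indicator_def)
    obtain n where n: "r - r0 \<le> real n" using real_arch_simple by blast
    have "eventually (\<lambda>i. ennreal (e\<^sup>2 * g r) * indicator {r0..r0 + real i} r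
        = ennreal (e\<^sup>2 * g r) * indicator {r0..} r) sequentially"
      using eventually_ge_at_top[of n] by eventually_elim (use n in \<open>auto simp: indicator_def\<close>)
    then have lim: "(\<lambda>i. ennreal (e\<^sup>2 * g r) * indicator {r0..r0 + real i} r) \<longlonglongrightarrow> ennreal (e\<^sup>2 * g r) * indicator {r0..} r"
      by (rule tendsto_eventually)
    show ?thesis
      by (rule LIMSEQ_unique[OF lim LIMSEQ_SUP[OF inc]])
  qed
  have "(\<integral>\<^sup>+r. ennreal (e\<^sup>2 * g r) * indicator {r0..} r \<partial>lborel)
    = (\<integral>\<^sup>+r. (SUP i. ennreal (e\<^sup>2 * g r) * indicator {r0..r0 + real i} r) \<partial>lborel)"
    by (simp only: SUP_eq)
  also have "... = (SUP i. \<integral>\<^sup>+r. ennreal (e\<^sup>2 * g r) * indicator {r0..r0 + real i} r \<partial>lborel)"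
    by (intro nn_integral_monotone_convergence_SUP) (auto simp: incseq_def indicator_def le_fun_def)
  also have "... \<le> ennreal (K2 * W r2)" using fin by (intro SUP_least)
  finally have "ennreal (1 / e\<^sup>2) * (\<integral>\<^sup>+r. ennreal (e\<^sup>2 * g r) * indicator {r0..} r \<partial>lborel)
      \<le> ennreal (1 / e\<^sup>2) * ennreal (K2 * W r2)"
    by (intro mult_left_mono) auto
  moreover have "ennreal (1 / e\<^sup>2) * (\<integral>\<^sup>+r. ennreal (e\<^sup>2 * g r) * indicator {r0..} r \<partial>lborel)
     = (\<integral>\<^sup>+r. ennreal (g r) * indicator {r0..} r \<partial>lborel)"
    using e_pos by (subst nn_integral_cmult[symmetric])
      (auto intro!: nn_integral_cong simp: indicator_def ennreal_mult[symmetric] g_nonneg)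
  moreover have "ennreal (1 / e\<^sup>2) * ennreal (K2 * W r2) = ennreal (K2 * W r2 / e\<^sup>2)"
    using K1_K2_ge_one W_nonneg[of r2] r2_bounds by (simp add: ennreal_mult[symmetric])
  ultimately show ?thesis by simp
qed

section \<open>The amplitude is controlled by the mass\<close>

text \<open>The mass of \<open>g\<close> on the interval from \<open>e ^ 3 / 4\<close> to \<open>e ^ 3 / 2\<close> bounds the integral of
  \<open>\<eta>\<^sup>2 * h\<close> for a cutoff \<open>\<eta>\<close> (a Caccioppoli inequality), hence it bounds the integral of
  \<open>\<eta>\<^sup>2 * W\<close>. Since \<open>W\<close> is nearly constant, this controls its value at \<open>r1\<close>. The whole estimate is
  arranged as the monotonicity of one function \<open>\<Psi> + C * G\<close>, where \<open>G\<close> is a primitive of \<open>g\<close>.\<close>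

lemma W_r1_le_mass: "W r1 \<le> K1 * (122880 * (1 + \<kappa>\<^sup>2) * M)"
proof -
  define l where "l = e ^ 3 / 4"
  define w where "w = W r1 / K1"
  define \<eta> where "\<eta> r = (r - l) * (2 * l - r)" for r
  define \<eta>' where "\<eta>' r = 3 * l - 2 * r" for r
  define S where "S r = l\<^sup>2 * (r - l) ^ 3 / 3 - l * (r - l) ^ 4 / 2 + (r - l) ^ 5 / 5" for r
  define \<Psi> where "\<Psi> r = (\<eta> r)\<^sup>2 * m r - w * l * S r" for r
  define Q where "Q r = e ^ 6 - r\<^sup>2 - c / r\<^sup>2" for r
  \<comment> \<open>The function \<open>S\<close> is the primitive of \<open>\<eta>\<^sup>2\<close> that vanishes at \<open>l\<close>.\<close>
  define C where "C = (1 + \<kappa>\<^sup>2) * e ^ 18"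
  have l: "l > 0" "r1 \<le> l" "2 * l \<le> r2" "l\<^sup>2 = e ^ 6 / 16"
    using e_pos r1_bounds r2_bounds by (auto simp: l_def power_divide simp flip: power_mult)
  have "w * K1 = W r1" using K1_K2_ge_one by (simp add: w_def)
  have w_le: "w \<le> W r" if "r \<in> {l..2 * l}" for r
    using W_comparison[of r1 r, folded K1_def] that l r1_bounds K1_K2_ge_one
    by (auto simp: w_def divide_le_eq mult.commute)
  have w0: "w \<ge> 0" using W_nonneg[of r1] r1_bounds K1_K2_ge_one by (simp add: w_def)
  have d\<Psi>: "(\<Psi> has_real_derivative 2 * \<eta> r * \<eta>' r * m r + (\<eta> r)\<^sup>2 * (h r - Q r * g r) - w * l * (\<eta> r)\<^sup>2) (at r)"
    if "r \<in> {l..2 * l}" for r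
  proof -
    have r: "r > 0" using that l by auto
    have D1: "(S has_real_derivative (\<eta> r)\<^sup>2) (at r)" unfolding S_def[abs_def] \<eta>_def
      by (auto intro!: derivative_eq_intros) (simp add: algebra_simps eval_nat_numeral)
    have D2: "((\<lambda>r. (\<eta> r)\<^sup>2) has_real_derivative 2 * \<eta> r * \<eta>' r) (at r)"
      unfolding \<eta>_def \<eta>'_def by (auto intro!: derivative_eq_intros)
    have D3: "(m has_real_derivative h r - Q r * g r) (at r)"
      using m_deriv[OF r] by (simp add: Q_def c_def)
    show ?thesis unfolding \<Psi>_def[abs_def]
      using DERIV_diff[OF DERIV_mult[OF D2 D3] DERIV_cmult[OF D1, of "w * l"]]
      by (simp add: mult.commute)
  qed
  have lower: "- C * g r \<le> 2 * \<eta> r * \<eta>' r * m r + (\<eta> r)\<^sup>2 * (h r - Q r * g r) - w * l * (\<eta> r)\<^sup>2"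
    if r: "r \<in> {l..2 * l}" for r
  proof -
    have r': "r > 0" "r \<in> {r1..r2}" using r l by auto
    have rsq: "l\<^sup>2 \<le> r\<^sup>2" "r\<^sup>2 \<le> (2 * l)\<^sup>2" using r l by (intro power_mono; simp)+
    have P: "P r \<ge> (2 * l)\<^sup>2" "P r \<le> e ^ 6" using rsq l e_pos by (auto simp: P_def power_mult_distrib)
    then have sP: "sqrt (P r) \<ge> 2 * l" using l by (intro real_le_rsqrt) auto
    have "(2 * l)\<^sup>2 > 0" using l by simp
    then have Ppos: "P r > 0" using P(1) by linarith
    have h_ge: "2 * l * w - P r * g r \<le> h r"
    proof -
      have "2 * l * w \<le> sqrt (P r) * W r" using sP w_le[OF r] w0 l Ppos by (intro mult_mono) auto
      also have "... = P r * g r + h r" using Ppos by (simp add: W_def algebra_simps)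
      finally show ?thesis by simp
    qed
    have \<eta>: "0 \<le> \<eta> r" "\<eta> r \<le> l\<^sup>2"
      using r l by (auto simp: \<eta>_def power2_eq_square intro!: mult_mono mult_nonneg_nonneg)
    have \<eta>2: "(\<eta> r)\<^sup>2 \<le> e ^ 12 / 256"
    proof -
      have "(\<eta> r)\<^sup>2 \<le> (l\<^sup>2)\<^sup>2" using \<eta> by (intro power_mono) auto
      then show ?thesis using l by (simp add: power_divide flip: power_mult)
    qed
    have \<eta>'2: "(\<eta>' r)\<^sup>2 \<le> e ^ 6 / 16"
    proof -
      have "\<bar>\<eta>' r\<bar> \<le> \<bar>l\<bar>" using r l by (auto simp: \<eta>'_def)
      then have "(\<eta>' r)\<^sup>2 \<le> l\<^sup>2" by (simp add: abs_le_square_iff)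
      then show ?thesis using l by simp
    qed
    \<comment> \<open>The cross term is absorbed by half of \<open>\<eta>\<^sup>2 * h\<close>, by the arithmetic-geometric mean inequality.\<close>
    define X Y z where "X = (\<eta> r)\<^sup>2 * h r / 2" and "Y = 2 * (\<eta>' r)\<^sup>2 * g r" and "z = \<eta> r * \<eta>' r * m r"
    have XY: "X \<ge> 0" "Y \<ge> 0" using g_nonneg h_nonneg by (auto simp: X_def Y_def)
    have cross: "- (X + Y) \<le> 2 * z"
    proof -
      have "(2 * z)\<^sup>2 = 4 * ((\<eta> r)\<^sup>2 * (\<eta>' r)\<^sup>2 * (m r)\<^sup>2)" by (simp add: z_def power_mult_distrib)
      also have "... \<le> 4 * ((\<eta> r)\<^sup>2 * (\<eta>' r)\<^sup>2 * (g r * h r))"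
        using m_bound by (intro mult_left_mono) auto
      also have "... = 4 * (X * Y)" by (simp add: X_def Y_def)
      also have "... \<le> (X + Y)\<^sup>2" using sum_squares_bound[of X Y] by (simp add: power2_sum)
      finally have "\<bar>2 * z\<bar> \<le> \<bar>X + Y\<bar>" by (simp only: abs_le_square_iff)
      then show ?thesis using XY by linarith
    qed
    have Q: "Q r \<le> (1 + 16 * \<kappa>\<^sup>2) * e ^ 6"
    proof -
      have "l\<^sup>2 \<ge> 1 / 16" using l e_large by simp
      then have "- c / r\<^sup>2 \<le> \<kappa>\<^sup>2 / (1 / 16)"
        using rsq c_bounds by (intro frac_le) auto
      also have "... \<le> 16 * \<kappa>\<^sup>2 * e ^ 6" using e_large by (simp add: mult_le_cancel_left1)
      finally have "- c / r\<^sup>2 \<le> 16 * \<kappa>\<^sup>2 * e ^ 6" .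
      moreover have "(1 + 16 * \<kappa>\<^sup>2) * e ^ 6 = e ^ 6 + 16 * \<kappa>\<^sup>2 * e ^ 6" by (simp add: algebra_simps)
      ultimately show ?thesis using zero_le_power2[of r] unfolding Q_def by linarith
    qed
    have Cg: "((\<eta> r)\<^sup>2 * (P r / 2 + Q r) + 2 * (\<eta>' r)\<^sup>2) * g r \<le> C * g r"
    proof (intro mult_right_mono g_nonneg)
      have "(\<eta> r)\<^sup>2 * (P r / 2 + Q r) \<le> (\<eta> r)\<^sup>2 * (e ^ 6 / 2 + (1 + 16 * \<kappa>\<^sup>2) * e ^ 6)"
        using P Q by (intro mult_left_mono add_mono) auto
      also have "... \<le> e ^ 12 / 256 * (e ^ 6 / 2 + (1 + 16 * \<kappa>\<^sup>2) * e ^ 6)"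
        using \<eta>2 e_pos by (intro mult_right_mono) auto
      also have "... = (3 / 512 + \<kappa>\<^sup>2 / 16) * e ^ 18" by (simp add: field_simps)
      finally have 1: "(\<eta> r)\<^sup>2 * (P r / 2 + Q r) \<le> (3 / 512 + \<kappa>\<^sup>2 / 16) * e ^ 18" .
      have "e ^ 6 \<le> e ^ 18" using e_large by (intro power_increasing) auto
      then have 2: "2 * (\<eta>' r)\<^sup>2 \<le> (1 / 8) * e ^ 18" using \<eta>'2 by linarith
      have "(3 / 512 + \<kappa>\<^sup>2 / 16) * e ^ 18 + (1 / 8) * e ^ 18 = (3 / 512 + \<kappa>\<^sup>2 / 16 + 1 / 8) * e ^ 18"
        by (simp add: algebra_simps)
      also have "... \<le> C" unfolding C_def
        using e_pos zero_le_power2[of \<kappa>] by (intro mult_right_mono) (linarith, simp)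
      finally show "(\<eta> r)\<^sup>2 * (P r / 2 + Q r) + 2 * (\<eta>' r)\<^sup>2 \<le> C" using 1 2 by linarith
    qed
    have "(\<eta> r)\<^sup>2 / 2 * (2 * l * w - P r * g r) \<le> (\<eta> r)\<^sup>2 / 2 * h r"
      using h_ge by (intro mult_left_mono) auto
    then have "w * l * (\<eta> r)\<^sup>2 - (\<eta> r)\<^sup>2 * (P r / 2) * g r \<le> X" by (simp add: X_def algebra_simps)
    moreover have "2 * \<eta> r * \<eta>' r * m r = 2 * z" "(\<eta> r)\<^sup>2 * (h r - Q r * g r)
        = 2 * X - (\<eta> r)\<^sup>2 * Q r * g r"
      by (simp_all add: z_def X_def algebra_simps)
    moreover have "((\<eta> r)\<^sup>2 * (P r / 2 + Q r) + 2 * (\<eta>' r)\<^sup>2) * g r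
       = (\<eta> r)\<^sup>2 * (P r / 2) * g r + (\<eta> r)\<^sup>2 * Q r * g r + Y" by (simp add: Y_def algebra_simps)
    ultimately show ?thesis using cross Cg by linarith
  qed
  have contg: "continuous_on {l / 2..3 * l} g"
    using l by (intro continuous_at_imp_continuous_on ballI DERIV_isCont[OF g_deriv]) auto
  obtain G where G: "\<And>x. x \<in> {l / 2..3 * l} \<Longrightarrow> (G has_vector_derivative g x) (at x within {l / 2..3 * l})"
    using antiderivative_continuous[OF contg] by blast
  have dG: "(G has_real_derivative g r) (at r)" if "r \<in> {l..2 * l}" for r
  proof -
    have "r \<in> interior {l / 2..3 * l}" using that l by auto
    then have "at r within {l / 2..3 * l} = at r" by (rule at_within_interior)
    then show ?thesis using G[of r] that l by (simp add: has_real_derivative_iff_has_vector_derivative)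
  qed
  have "ennreal (G (2 * l) - G l) = (\<integral>\<^sup>+r. ennreal (g r) * indicator {l..2 * l} r \<partial>lborel)"
    by (rule nn_integral_FTC_Icc[symmetric]) (use dG g_nonneg l in auto)
  also have "... \<le> (\<integral>\<^sup>+r. ennreal (g r) * indicator {0<..} r \<partial>lborel)"
    using l by (intro nn_integral_mono) (auto simp: indicator_def)
  also have "... = ennreal M" by (rule mass)
  finally have GM: "G (2 * l) - G l \<le> M" using M_pos by (simp add: ennreal_le_iff2)
  have "\<Psi> l + C * G l \<le> \<Psi> (2 * l) + C * G (2 * l)"
  proof (rule DERIV_nonneg_imp_nondecreasing[where f = "\<lambda>x. \<Psi> x + C * G x"])
    show "l \<le> 2 * l" using l by simp
    fix x assume "l \<le> x" "x \<le> 2 * l"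
    then have x: "x \<in> {l..2 * l}" by simp
    show "\<exists>D. ((\<lambda>x. \<Psi> x + C * G x) has_real_derivative D) (at x) \<and> 0 \<le> D"
      using DERIV_add[OF d\<Psi>[OF x] DERIV_cmult[OF dG[OF x], of C]] lower[OF x] by fastforce
  qed
  moreover have "\<Psi> l = 0" "\<Psi> (2 * l) = - (w * (l ^ 6 / 30))"
    by (simp_all add: \<Psi>_def \<eta>_def S_def) (simp add: eval_nat_numeral)
  moreover have "C * G (2 * l) - C * G l \<le> C * M"
    unfolding right_diff_distrib[symmetric] using GM e_pos by (intro mult_left_mono) (auto simp: C_def)
  ultimately have "w * (l ^ 6 / 30) \<le> C * M" by linarith
  moreover have "l ^ 6 = e ^ 18 / 4096" by (simp add: l_def power_divide flip: power_mult)
  ultimately have "w * e ^ 18 \<le> (122880 * (1 + \<kappa>\<^sup>2) * M) * e ^ 18" by (simp add: C_def algebra_simps)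
  then have "w \<le> 122880 * (1 + \<kappa>\<^sup>2) * M" using e_pos by simp
  then have "w * K1 \<le> (122880 * (1 + \<kappa>\<^sup>2) * M) * K1" using K1_K2_ge_one by (intro mult_right_mono) auto
  then show ?thesis using \<open>w * K1 = W r1\<close> by (simp add: mult_ac)
qed

section \<open>Power integrals away from the origin\<close>

lemma W_le_W_r1: "r \<in> {r1..r2} \<Longrightarrow> W r \<le> K1 * W r1"
  using W_comparison[of r r1] r1_bounds by (simp add: K1_def)

lemma K1_K2_product: "K1 \<le> K1 * K2" "1 \<le> K1 * K2"
proof -
  show *: "K1 \<le> K1 * K2" using K1_K2_ge_one by (simp add: mult_le_cancel_left1)
  show "1 \<le> K1 * K2" using * K1_K2_ge_one by linarith
qed

lemma W_r1_nonneg: "W r1 \<ge> 0" using W_nonneg r1_bounds by auto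

lemma g_bulk: assumes "r \<in> {r1..r2}" shows "g r \<le> K1 * K2 * W r1 / sqrt (P r)"
proof -
  have r: "0 < r" "r \<le> r2" using assms r1_bounds by auto
  have P: "sqrt (P r) > 0" using P_ge[OF r] by simp
  have "sqrt (P r) * g r \<le> W r" using h_nonneg[of r] P by (simp add: W_def)
  also have "... \<le> K1 * W r1" using W_le_W_r1 assms by auto
  also have "... \<le> K1 * K2 * W r1" using K1_K2_product W_r1_nonneg by (intro mult_right_mono) auto
  finally show ?thesis using P by (simp add: pos_le_divide_eq mult.commute)
qed

lemma g_far: assumes "r \<ge> r2" shows "g r \<le> K1 * K2 * W r1 / e"
proof -
  have *: "g r \<le> K1 * K2 * W r1 / e" if "r \<in> {r2..r0}" for r
  proof -
    have "e * g r \<le> e * g r + h r / e" using h_nonneg e_pos by simp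
    also have "... \<le> K2 * W r2" by (rule airy_zone[OF that])
    also have "... \<le> K2 * (K1 * W r1)" using W_le_W_r1[of r2] r1_bounds K1_K2_ge_one
      by (intro mult_left_mono) auto
    finally show ?thesis using e_pos by (simp add: field_simps)
  qed
  show ?thesis
  proof (cases "r \<le> r0")
    case True then show ?thesis using * assms by auto
  next
    case False
    then have "g r \<le> g r0" by (intro tail_sup) auto
    also have "... \<le> K1 * K2 * W r1 / e" using * r0_bounds by auto
    finally show ?thesis .
  qed
qed

lemma mass_far: "(\<integral>\<^sup>+r. ennreal (g r) * indicator {r2..} r \<partial>lborel)
    \<le> ennreal (5 * (K1 * K2 * W r1) / e\<^sup>2)"
proof -
  define A where "A = K1 * K2 * W r1"
  have A: "A \<ge> 0" using K1_K2_product W_r1_nonneg by (simp add: A_def)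
  have "(\<integral>\<^sup>+r. ennreal (g r) * indicator {r2..} r \<partial>lborel)
    \<le> (\<integral>\<^sup>+r. (ennreal (A / e) * indicator {r2..r0} r + ennreal (g r) * indicator {r0..} r) \<partial>lborel)"
    using g_far
    by (intro nn_integral_mono) (auto simp: indicator_def A_def intro!: ennreal_leI add_increasing2)
  also have "...
      = (\<integral>\<^sup>+r. ennreal (A / e) * indicator {r2..r0} r \<partial>lborel) + (\<integral>\<^sup>+r. ennreal (g r) * indicator {r0..} r \<partial>lborel)"
    by (intro nn_integral_add) auto
  also have "... \<le> ennreal (A / e * (r0 - r2)) + ennreal (K2 * W r2 / e\<^sup>2)"
    using tail_mass r0_bounds A e_pos
    by (intro add_mono) (auto simp: nn_integral_cmult ennreal_mult[symmetric])
  also have "... \<le> ennreal (A / e * (4 / e)) + ennreal (A / e\<^sup>2)"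
  proof (intro add_mono ennreal_leI)
    show "A / e * (r0 - r2) \<le> A / e * (4 / e)" using r0_bounds A e_pos by (intro mult_left_mono) auto
    have "K2 * W r2 \<le> K2 * (K1 * W r1)" using W_le_W_r1[of r2] r1_bounds K1_K2_ge_one
      by (intro mult_left_mono) auto
    then show "K2 * W r2 / e\<^sup>2 \<le> A / e\<^sup>2" by (intro divide_right_mono) (auto simp: A_def mult_ac)
  qed
  also have "... = ennreal (5 * A / e\<^sup>2)"
    using A e_pos by (subst ennreal_plus[symmetric]) (auto simp: power2_eq_square)
  finally show ?thesis by (simp only: A_def)
qed

lemma sqrt_P_ge: assumes "0 < r" "r \<le> e ^ 3 / 2" shows "sqrt (P r) \<ge> e ^ 3 / 2"
proof (rule real_le_rsqrt)
  have "r\<^sup>2 \<le> (e ^ 3 / 2)\<^sup>2" using assms by (intro power_mono) auto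
  moreover have "(e ^ 3 / 2)\<^sup>2 = e ^ 6 / 4" by (simp add: power_divide flip: power_mult)
  moreover have "e ^ 6 \<ge> 0" by simp
  ultimately show "(e ^ 3 / 2)\<^sup>2 \<le> P r" unfolding P_def by linarith
qed

lemma turning_point_gap: "1 / (2 * e) \<le> e ^ 3 - r2" "1 / (2 * e) \<le> e ^ 3"
proof -
  have "e\<^sup>2 = (e ^ 3)\<^sup>2 - r2\<^sup>2" by (simp add: r2_sq flip: power_mult)
  also have "... = (e ^ 3 - r2) * (e ^ 3 + r2)" by (simp add: power2_eq_square algebra_simps)
  also have "... \<le> (e ^ 3 - r2) * (2 * e ^ 3)" using r2_bounds by (intro mult_left_mono) auto
  finally have "e\<^sup>2 * 1 \<le> e\<^sup>2 * ((e ^ 3 - r2) * (2 * e))" by (simp add: eval_nat_numeral mult_ac)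
  then have "1 \<le> (e ^ 3 - r2) * (2 * e)" using e_pos
    by (simp only: mult_le_cancel_left_pos zero_less_power)
  then show "1 / (2 * e) \<le> e ^ 3 - r2" using e_pos by (simp add: pos_divide_le_eq)
  then show "1 / (2 * e) \<le> e ^ 3" using r2_bounds by linarith
qed

abbreviation density :: "real \<Rightarrow> real \<Rightarrow> ennreal" where
  "density p r \<equiv> ennreal (g r powr (p / 2) * r powr (- \<kappa> * (p - 2)))"

text \<open>The integrand \<open>g powr (p / 2) * r powr (- \<kappa> * (p - 2))\<close> is \<open>\<bar>u\<bar> powr p * r powr (2 * \<kappa>)\<close>
  written in terms of \<open>v\<close>. Up to \<open>e ^ 3 / 2\<close> the factor \<open>P\<close> is of order \<open>e ^ 6\<close>, so only the
  weight varies.\<close>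

lemma Lp_bulk:
  assumes p: "p \<ge> 2"
  shows "(\<integral>\<^sup>+r. density p r * indicator {r1..e ^ 3 / 2} r \<partial>lborel)
    \<le> ennreal ((2 * K1 * K2 * W r1) powr (p / 2) * (e powr (- 3 * p / 2) * power_bound (\<kappa> * (p - 2)) r1 (e ^ 3)))"
proof -
  define A where "A = 2 * K1 * K2 * W r1"
  have A: "A \<ge> 0" using K1_K2_ge_one W_r1_nonneg by (simp add: A_def)
  have pt: "g r powr (p / 2) * r powr (- \<kappa> * (p - 2))
      \<le> A powr (p / 2) * e powr (- 3 * p / 2) * r powr (- (\<kappa> * (p - 2)))"
    if r: "r \<in> {r1..e ^ 3 / 2}" for r
  proof -
    have r': "0 < r" "r \<in> {r1..r2}" using r r1_bounds r2_bounds by auto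
    have "g r \<le> K1 * K2 * W r1 / sqrt (P r)" by (rule g_bulk[OF r'(2)])
    also have "... \<le> K1 * K2 * W r1 / (e ^ 3 / 2)"
      using sqrt_P_ge[OF r'(1)] P_ge(2)[OF r'(1)] r r'(2) e_pos K1_K2_ge_one W_r1_nonneg
      by (intro divide_left_mono mult_pos_pos) auto
    also have "... = A / e ^ 3" by (simp add: A_def)
    also have "... = A * e powr (- 3)" using e_pos by (simp add: powr_minus powr_numeral divide_inverse)
    finally have "g r powr (p / 2) \<le> (A * e powr (- 3)) powr (p / 2)"
      using p g_nonneg by (intro powr_mono2) auto
    also have "... = A powr (p / 2) * e powr (- 3 * p / 2)" using A by (simp add: powr_mult powr_powr)
    finally show ?thesis by (intro mult_mono) auto
  qed
  have "(\<integral>\<^sup>+r. density p r * indicator {r1..e ^ 3 / 2} r \<partial>lborel)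
    \<le> (\<integral>\<^sup>+r. ennreal (A powr (p / 2) * e powr (- 3 * p / 2)) * (ennreal (r powr (- (\<kappa> * (p - 2)))) * indicator {r1..e ^ 3} r) \<partial>lborel)"
  proof (intro nn_integral_mono)
    fix r
    have "r \<in> {r1..e ^ 3 / 2} \<Longrightarrow> r \<in> {r1..e ^ 3}" using zero_less_power[OF e_pos, of 3]
      unfolding atLeastAtMost_iff by linarith
    then show "density p r * indicator {r1..e ^ 3 / 2} r
      \<le> ennreal (A powr (p / 2) * e powr (- 3 * p / 2)) * (ennreal (r powr (- (\<kappa> * (p - 2)))) * indicator {r1..e ^ 3} r)"
      using pt[of r] by (cases "r \<in> {r1..e ^ 3 / 2}") (simp_all add: ennreal_mult[symmetric] ennreal_leI)
  qed
  also have "...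
      = ennreal (A powr (p / 2) * e powr (- 3 * p / 2)) * (\<integral>\<^sup>+r. ennreal (r powr (- (\<kappa> * (p - 2)))) * indicator {r1..e ^ 3} r \<partial>lborel)"
    by (intro nn_integral_cmult) auto
  also have "...
      \<le> ennreal (A powr (p / 2) * e powr (- 3 * p / 2)) * ennreal (power_bound (\<kappa> * (p - 2)) r1 (e ^ 3))"
    using r1_bounds r2_bounds by (intro mult_left_mono nn_integral_inverse_power_le) auto
  also have "...
      = ennreal (A powr (p / 2) * (e powr (- 3 * p / 2) * power_bound (\<kappa> * (p - 2)) r1 (e ^ 3)))"
    using r1_bounds r2_bounds
    by (subst ennreal_mult[symmetric]) (auto intro!: power_bound_nonneg simp: mult_ac)
  finally show ?thesis by (simp only: A_def)
qed

lemma cube_powr: "(e ^ 3) powr x = e powr (3 * x)"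
  using e_pos by (simp add: powr_powr[symmetric])

lemma weight_le:
  assumes "p \<ge> 2" "e ^ 3 / 2 \<le> r"
  shows "r powr (- \<kappa> * (p - 2)) \<le> 2 powr (\<kappa> * (p - 2)) * e powr (- 3 * \<kappa> * (p - 2))"
proof -
  have "r powr (- \<kappa> * (p - 2)) \<le> (e ^ 3 / 2) powr (- \<kappa> * (p - 2))"
    using assms e_pos kappa_ge by (intro powr_mono2') (auto intro!: mult_nonneg_nonneg)
  also have "... = (e ^ 3 * (1 / 2)) powr (- (\<kappa> * (p - 2)))" by simp
  also have "... = (e ^ 3) powr (- (\<kappa> * (p - 2))) * (1 / 2) powr (- (\<kappa> * (p - 2)))"
    by (rule powr_mult)
  also have "(1 / 2) powr (- (\<kappa> * (p - 2))) = (2 :: real) powr (\<kappa> * (p - 2))"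
    by (simp add: powr_divide powr_minus_divide)
  also have "(e ^ 3) powr (- (\<kappa> * (p - 2))) = e powr (- 3 * \<kappa> * (p - 2))"
    unfolding cube_powr by (simp add: mult_ac)
  finally have "r powr (- \<kappa> * (p - 2)) \<le> e powr (- 3 * \<kappa> * (p - 2)) * 2 powr (\<kappa> * (p - 2))" .
  then show ?thesis by (simp only: mult.commute)
qed

text \<open>Here the weight is essentially constant, while \<open>P\<close> vanishes linearly at \<open>e ^ 3\<close>. The bound is a
  power integral in the distance \<open>e ^ 3 - r\<close> to the turning point, which is at least
  \<open>1 / (2 * e)\<close>.\<close>

lemma Lp_turning:
  assumes p: "p \<ge> 2"
  shows "(\<integral>\<^sup>+r. density p r * indicator {e ^ 3 / 2..r2} r \<partial>lborel)
    \<le> ennreal ((K1 * K2 * W r1) powr (p / 2) * 2 powr (\<kappa> * (p - 2)) *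
        (e powr (- 3 * \<kappa> * (p - 2)) * (e powr (- 3 * p / 4) * power_bound (p / 4) (1 / (2 * e)) (e ^ 3))))"
proof -
  define A where "A = K1 * K2 * W r1"
  have A: "A \<ge> 0" using K1_K2_ge_one W_r1_nonneg by (simp add: A_def)
  define B where "B
      = A powr (p / 2) * 2 powr (\<kappa> * (p - 2)) * (e powr (- 3 * \<kappa> * (p - 2)) * e powr (- 3 * p / 4))"
  have B: "B \<ge> 0" by (simp add: B_def)
  have pt: "g r powr (p / 2) * r powr (- \<kappa> * (p - 2)) \<le> B * (e ^ 3 - r) powr (- (p / 4))"
    if r: "r \<in> {e ^ 3 / 2..r2}" for r
  proof -
    have e3: "e ^ 3 > 0" using e_pos by simp
    have r': "0 < r" "r \<in> {r1..r2}" using r r1_bounds e3 by auto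
    have gap: "e ^ 3 - r > 0"
    proof -
      have "1 / (2 * e) > 0" using e_pos by simp
      then have "e ^ 3 - r2 > 0" using turning_point_gap(1) by (rule less_le_trans)
      then show ?thesis using r by simp
    qed
    have "P r = (e ^ 3)\<^sup>2 - r\<^sup>2" by (simp add: P_def flip: power_mult)
    also have "... = (e ^ 3 + r) * (e ^ 3 - r)" by (simp add: power2_eq_square algebra_simps)
    finally have "P r \<ge> e ^ 3 * (e ^ 3 - r)" using gap r' by (simp add: mult_right_mono)
    moreover have pos: "e ^ 3 * (e ^ 3 - r) > 0" using gap e3 by simp
    ultimately have sq: "sqrt (e ^ 3 * (e ^ 3 - r))
        \<le> sqrt (P r)" "0 < sqrt (e ^ 3 * (e ^ 3 - r))" "0 < sqrt (P r)"
      by auto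
    have "g r \<le> A / sqrt (P r)" unfolding A_def by (rule g_bulk[OF r'(2)])
    also have "... \<le> A / sqrt (e ^ 3 * (e ^ 3 - r))"
      using A sq by (intro divide_left_mono mult_pos_pos)
    also have "... = A * (e powr 3 * (e ^ 3 - r)) powr (- 1 / 2)"
    proof -
      have "x powr (- 1 / 2) = 1 / sqrt x" if "x > 0" for x :: real
        using powr_minus_divide[of x "1 / 2"] powr_half_sqrt[of x] that by simp
      moreover have "e powr 3 = e ^ 3" using e_pos by (simp add: powr_numeral)
      ultimately show ?thesis using pos by simp
    qed
    finally have "g r powr (p / 2) \<le> (A * (e powr 3 * (e ^ 3 - r)) powr (- 1 / 2)) powr (p / 2)"
      using p g_nonneg by (intro powr_mono2) auto
    also have "... = A powr (p / 2) * (e powr (- 3 * p / 4) * (e ^ 3 - r) powr (- (p / 4)))"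
      using A e_pos gap by (simp add: powr_mult powr_powr cube_powr)
    finally have "g r powr (p / 2) * r powr (- \<kappa> * (p - 2)) \<le>
       (A powr (p / 2) * (e powr (- 3 * p / 4) * (e ^ 3 - r) powr (- (p / 4)))) * (2 powr (\<kappa> * (p - 2)) * e powr (- 3 * \<kappa> * (p - 2)))"
      using weight_le[OF p, of r] r by (intro mult_mono) auto
    then show ?thesis by (simp only: B_def mult_ac)
  qed
  have "(\<integral>\<^sup>+r. density p r * indicator {e ^ 3 / 2..r2} r \<partial>lborel)
    \<le> (\<integral>\<^sup>+r. ennreal B * (ennreal ((e ^ 3 - r) powr (- (p / 4))) * indicator {1 / (2 * e)..e ^ 3} (e ^ 3 - r)) \<partial>lborel)"
  proof (intro nn_integral_mono)
    fix r
    show "density p r * indicator {e ^ 3 / 2..r2} r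
      \<le> ennreal B * (ennreal ((e ^ 3 - r) powr (- (p / 4))) * indicator {1 / (2 * e)..e ^ 3} (e ^ 3 - r))"
    proof (cases "r \<in> {e ^ 3 / 2..r2}")
      case True
      have "e ^ 3 > 0" using e_pos by simp
      then have "e ^ 3 - r \<in> {1 / (2 * e)..e ^ 3}"
        using True turning_point_gap(1) unfolding atLeastAtMost_iff by linarith
      moreover have "ennreal B * ennreal ((e ^ 3 - r) powr (- (p / 4)))
          = ennreal (B * (e ^ 3 - r) powr (- (p / 4)))"
        using B by (intro ennreal_mult[symmetric]) auto
      ultimately show ?thesis using ennreal_leI[OF pt[OF True]] True
        by (simp only: indicator_simps mult_1_right)
    qed auto
  qed
  also have "...
      = ennreal B * (\<integral>\<^sup>+r. ennreal ((e ^ 3 - r) powr (- (p / 4))) * indicator {1 / (2 * e)..e ^ 3} (e ^ 3 - r) \<partial>lborel)"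
    by (intro nn_integral_cmult) auto
  also have "(\<integral>\<^sup>+r. ennreal ((e ^ 3 - r) powr (- (p / 4))) * indicator {1 / (2 * e)..e ^ 3} (e ^ 3 - r) \<partial>lborel)
     = (\<integral>\<^sup>+s. ennreal (s powr (- (p / 4))) * indicator {1 / (2 * e)..e ^ 3} s \<partial>lborel)"
    using nn_integral_real_affine[of "\<lambda>s. ennreal (s powr (- (p / 4))) * indicator {1 / (2 * e)..e ^ 3} s" "-1" "e ^ 3"] by simp
  also have "ennreal B * ... \<le> ennreal B * ennreal (power_bound (p / 4) (1 / (2 * e)) (e ^ 3))"
    using e_pos turning_point_gap by (intro mult_left_mono nn_integral_inverse_power_le) auto
  also have "... = ennreal (B * power_bound (p / 4) (1 / (2 * e)) (e ^ 3))"
    using B e_pos turning_point_gap by (subst ennreal_mult[symmetric]) (auto intro!: power_bound_nonneg)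
  finally show ?thesis by (simp only: A_def B_def mult_ac)
qed

text \<open>One factor \<open>g\<close> is integrated with the help of its mass beyond \<open>r2\<close>, the others are estimated by
  their supremum.\<close>

lemma Lp_tail:
  assumes p: "p \<ge> 2"
  shows "(\<integral>\<^sup>+r. density p r * indicator {r2..} r \<partial>lborel)
    \<le> ennreal (5 * (K1 * K2 * W r1) powr (p / 2) * 2 powr (\<kappa> * (p - 2)) * (e powr (- 3 * \<kappa> * (p - 2)) * e powr (- p / 2 - 1)))"
proof -
  define A where "A = K1 * K2 * W r1"
  have A: "A \<ge> 0" using K1_K2_ge_one W_r1_nonneg by (simp add: A_def)
  define B where "B
      = (A * e powr (- 1)) powr (p / 2 - 1) * (2 powr (\<kappa> * (p - 2)) * e powr (- 3 * \<kappa> * (p - 2)))"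
  have B: "B \<ge> 0" by (simp add: B_def)
  have pt: "g r powr (p / 2) * r powr (- \<kappa> * (p - 2)) \<le> B * g r" if r: "r \<ge> r2" for r
  proof -
    have "g r powr (p / 2) = g r powr (p / 2 - 1) * g r"
    proof (cases "g r = 0")
      case False
      then have "g r > 0" using g_nonneg[of r] by simp
      then have "g r powr (p / 2 - 1) * g r powr 1 = g r powr (p / 2)"
        by (simp only: powr_add[symmetric]) simp
      then show ?thesis using \<open>g r > 0\<close> by simp
    qed simp
    also have "... \<le> (A * e powr (- 1)) powr (p / 2 - 1) * g r"
    proof (intro mult_right_mono powr_mono2 g_nonneg)
      show "g r \<le> A * e powr (- 1)" using g_far[OF r] e_pos by (simp add: A_def powr_minus divide_inverse)
    qed (use p in auto)
    finally have "g r powr (p / 2) * r powr (- \<kappa> * (p - 2)) \<le>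
      ((A * e powr (- 1)) powr (p / 2 - 1) * g r) * (2 powr (\<kappa> * (p - 2)) * e powr (- 3 * \<kappa> * (p - 2)))"
      using weight_le[OF p, of r] r r2_bounds g_nonneg[of r] by (intro mult_mono) auto
    then show ?thesis by (simp only: B_def mult_ac)
  qed
  have "(\<integral>\<^sup>+r. density p r * indicator {r2..} r \<partial>lborel)
    \<le> (\<integral>\<^sup>+r. ennreal B * (ennreal (g r) * indicator {r2..} r) \<partial>lborel)"
    using pt B g_nonneg
    by (intro nn_integral_mono) (auto simp: indicator_def ennreal_mult[symmetric] intro!: ennreal_leI)
  also have "... = ennreal B * (\<integral>\<^sup>+r. ennreal (g r) * indicator {r2..} r \<partial>lborel)"
    by (intro nn_integral_cmult) auto
  also have "... \<le> ennreal B * ennreal (5 * A / e\<^sup>2)" unfolding A_def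
    by (intro mult_left_mono mass_far) auto
  also have "... = ennreal (B * (5 * A / e\<^sup>2))" using A B by (subst ennreal_mult[symmetric]) auto
  also have "B * (5 * A / e\<^sup>2)
      = 5 * A powr (p / 2) * 2 powr (\<kappa> * (p - 2)) * (e powr (- 3 * \<kappa> * (p - 2)) * e powr (- p / 2 - 1))"
  proof (cases "A = 0")
    case False
    then have A': "A > 0" using A by simp
    have "A powr (p / 2) = A powr (p / 2 - 1) * A powr 1" by (simp only: powr_add[symmetric]) simp
    then have 1: "A powr (p / 2) = A powr (p / 2 - 1) * A" using A' by simp
    have "e powr (- p / 2 - 1) = e powr (- (p / 2 - 1)) * e powr (- 2)"
    proof -
      have "- p / 2 - 1 = - (p / 2 - 1) + - 2" by simp
      then show ?thesis by (simp only: powr_add)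
    qed
    then have 2: "e powr (- p / 2 - 1) = e powr (- (p / 2 - 1)) / e\<^sup>2"
      using e_pos powr_minus_divide[of e 2] by simp
    have 3: "(A * e powr (- 1)) powr (p / 2 - 1) = A powr (p / 2 - 1) * e powr (- (p / 2 - 1))"
    proof -
      have "(A * e powr (- 1)) powr (p / 2 - 1) = A powr (p / 2 - 1) * (e powr (- 1)) powr (p / 2 - 1)"
        by (rule powr_mult)
      then show ?thesis by (simp only: powr_powr mult_minus1)
    qed
    show ?thesis unfolding B_def 1 2 3 by (simp only: times_divide_eq_right times_divide_eq_left mult_ac)
  qed simp
  finally show ?thesis by (simp only: A_def)
qed

lemma Lp_beyond_origin:
  assumes p: "p \<ge> 2"
  shows "(\<integral>\<^sup>+r. density p r * indicator {r1..} r \<partial>lborel)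
    \<le> ennreal (5 * (2 * K1 * K2 * W r1) powr (p / 2) * 2 powr (\<kappa> * (p - 2)) *
        (e powr (- 3 * p / 2) * power_bound (\<kappa> * (p - 2)) r1 (e ^ 3)
         + e powr (- 3 * \<kappa> * (p - 2)) * (e powr (- 3 * p / 4) * power_bound (p / 4) (1 / (2 * e)) (e ^ 3)
           + e powr (- p / 2 - 1))))"
proof -
  let ?f = "density p"
  define A where "A = (2 * K1 * K2 * W r1) powr (p / 2)"
  define A' where "A' = (K1 * K2 * W r1) powr (p / 2)"
  define b where "b = 2 powr (\<kappa> * (p - 2))"
  define X where "X = e powr (- 3 * p / 2) * power_bound (\<kappa> * (p - 2)) r1 (e ^ 3)"
  define Y where "Y
      = e powr (- 3 * \<kappa> * (p - 2)) * (e powr (- 3 * p / 4) * power_bound (p / 4) (1 / (2 * e)) (e ^ 3))"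
  define Z where "Z = e powr (- 3 * \<kappa> * (p - 2)) * e powr (- p / 2 - 1)"
  have X: "X \<ge> 0" and Y: "Y \<ge> 0" and Z: "Z \<ge> 0"
    using r1_bounds r2_bounds turning_point_gap e_pos
    by (auto simp: X_def Y_def Z_def intro!: mult_nonneg_nonneg power_bound_nonneg)
  have A: "A' \<le> A" "A' \<ge> 0" unfolding A_def A'_def using K1_K2_ge_one W_r1_nonneg p
    by (auto intro!: powr_mono2)
  have b: "b \<ge> 1" using kappa_ge p by (simp add: b_def ge_one_powr_ge_zero)
  have "(\<integral>\<^sup>+r. ?f r * indicator {r1..} r \<partial>lborel)
    \<le> (\<integral>\<^sup>+r. (?f r * indicator {r1..e ^ 3 / 2} r + (?f r * indicator {e ^ 3 / 2..r2} r + ?f r * indicator {r2..} r)) \<partial>lborel)"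
    using r2_bounds by (intro nn_integral_mono) (auto simp: indicator_def)
  also have "... = (\<integral>\<^sup>+r. ?f r * indicator {r1..e ^ 3 / 2} r \<partial>lborel) +
     ((\<integral>\<^sup>+r. ?f r * indicator {e ^ 3 / 2..r2} r \<partial>lborel) + (\<integral>\<^sup>+r. ?f r * indicator {r2..} r \<partial>lborel))"
    by (subst nn_integral_add, measurable, subst nn_integral_add, measurable)
  also have "... \<le> ennreal (A * X) + (ennreal (A' * b * Y) + ennreal (5 * A' * b * Z))"
    using Lp_bulk[OF p] Lp_turning[OF p] Lp_tail[OF p] unfolding A_def A'_def b_def X_def Y_def Z_def
    by (intro add_mono)
  also have "... = ennreal (A * X + (A' * b * Y + 5 * A' * b * Z))"
    using X Y Z A b by (simp add: ennreal_plus)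
  also have "... \<le> ennreal (5 * A * b * (X + (Y + Z)))"
  proof (intro ennreal_leI)
    have "A * 1 \<le> A * (5 * b)" using A b by (intro mult_left_mono) auto
    then have "A * X \<le> (5 * A * b) * X" using X by (intro mult_right_mono) (auto simp: mult_ac)
    moreover have "A' * b * Y \<le> (5 * A * b) * Y" using Y A b by (intro mult_right_mono) auto
    moreover have "5 * A' * b * Z \<le> (5 * A * b) * Z" using Z A b by (intro mult_right_mono) auto
    ultimately show "A * X + (A' * b * Y + 5 * A' * b * Z) \<le> 5 * A * b * (X + (Y + Z))"
      by (simp only: distrib_left)
  qed
  also have "Y + Z
      = e powr (- 3 * \<kappa> * (p - 2)) * (e powr (- 3 * p / 4) * power_bound (p / 4) (1 / (2 * e)) (e ^ 3)
           + e powr (- p / 2 - 1))"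
    by (simp only: Y_def Z_def distrib_left)
  finally show ?thesis by (simp only: A_def b_def X_def)
qed

end

section \<open>Radial profiles near the origin\<close>

text \<open>The radial equation with \<open>2 * \<kappa> = d - 1\<close>. The condition \<open>u' 0 = 0\<close> selects the solutions that are
  regular at the origin.\<close>

locale radial_profile =
  fixes e \<kappa> M :: real and u u' :: "real \<Rightarrow> complex"
  assumes e_ge: "e \<ge> 1" "e ^ 4 \<ge> 2"
    and kappa_half: "\<kappa> \<ge> 1 / 2"
    and M_positive: "M > 0"
    and u_deriv: "\<And>r. (u has_vector_derivative u' r) (at r)"
    and u'_cont: "continuous_on UNIV u'"
    and u'_zero: "u' 0 = 0"
    and u'_deriv: "\<And>r. r > 0 \<Longrightarrow>
      (u' has_vector_derivative - (2 * \<kappa> / r) *\<^sub>R u' r - (e ^ 6 - r\<^sup>2) *\<^sub>R u r) (at r)"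
    and u_mass: "(\<integral>\<^sup>+r. ennreal (r powr (2 * \<kappa>) * (norm (u r))\<^sup>2) * indicator {0<..} r \<partial>lborel)
        = ennreal M"
begin

lemma u_cont: "continuous_on A u"
  using u_deriv by (meson continuous_at_imp_continuous_on has_vector_derivative_continuous)

lemma u_meas [measurable]: "u \<in> borel_measurable borel" "u' \<in> borel_measurable borel"
  using u_cont u'_cont by (auto intro: borel_measurable_continuous_onI)

definition v where "v r = r powr \<kappa> *\<^sub>R u r"
definition v' where "v' r = r powr \<kappa> *\<^sub>R (u' r + (\<kappa> / r) *\<^sub>R u r)"

lemma v_sq: "v r \<bullet> v r = r powr (2 * \<kappa>) * (norm (u r))\<^sup>2"
  by (simp only: v_def power2_norm_eq_inner mult_2 powr_add mult.assoc inner_scaleR_left inner_scaleR_right)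

lemma powr_kappa_deriv:
  assumes r: "r > 0"
  shows "((\<lambda>r. r powr \<kappa>) has_real_derivative r powr \<kappa> * (\<kappa> / r)) (at r)"
proof -
  have "((\<lambda>r. r powr \<kappa>) has_real_derivative \<kappa> * r powr (\<kappa> - 1)) (at r)"
    using r by (auto intro!: derivative_eq_intros)
  then show ?thesis using r by (simp add: powr_diff mult.commute)
qed

lemma v_deriv: assumes r: "r > 0" shows "(v has_vector_derivative v' r) (at r)"
proof -
  from has_vector_derivative_scaleR[OF powr_kappa_deriv[OF r] u_deriv]
  show ?thesis unfolding v_def[abs_def] v'_def by (simp add: scaleR_add_right)
qed

lemma v'_deriv: assumes r: "r > 0"
  shows "(v' has_vector_derivative - (e ^ 6 - r\<^sup>2 - \<kappa> * (\<kappa> - 1) / r\<^sup>2) *\<^sub>R v r) (at r)"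
proof -
  have "((\<lambda>r. \<kappa> / r) has_real_derivative - \<kappa> / r\<^sup>2) (at r)"
    using r by (auto intro!: derivative_eq_intros simp: power2_eq_square)
  from has_vector_derivative_scaleR[OF this u_deriv[of r]]
  have 2: "((\<lambda>r. u' r + (\<kappa> / r) *\<^sub>R u r) has_vector_derivative
     (- (2 * \<kappa> / r) *\<^sub>R u' r - (e ^ 6 - r\<^sup>2) *\<^sub>R u r) + ((\<kappa> / r) *\<^sub>R u' r + (- \<kappa> / r\<^sup>2) *\<^sub>R u r)) (at r)"
    by (intro has_vector_derivative_add u'_deriv[OF r])
  have "r powr \<kappa> *\<^sub>R ((- (2 * \<kappa> / r) *\<^sub>R u' r - (e ^ 6 - r\<^sup>2) *\<^sub>R u r) + ((\<kappa> / r) *\<^sub>R u' r + (- \<kappa> / r\<^sup>2) *\<^sub>R u r))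
      + (r powr \<kappa> * (\<kappa> / r)) *\<^sub>R (u' r + (\<kappa> / r) *\<^sub>R u r)
    = r powr \<kappa> *\<^sub>R ((- (2 * \<kappa> / r) + \<kappa> / r + \<kappa> / r) *\<^sub>R u' r + (- (e ^ 6 - r\<^sup>2) - \<kappa> / r\<^sup>2 + \<kappa> / r * (\<kappa> / r)) *\<^sub>R u r)"
    by (simp add: complex_eq_iff algebra_simps)
  also have "- (2 * \<kappa> / r) + \<kappa> / r + \<kappa> / r = 0" by simp
  also have "- (e ^ 6 - r\<^sup>2) - \<kappa> / r\<^sup>2 + \<kappa> / r * (\<kappa> / r) = - (e ^ 6 - r\<^sup>2 - \<kappa> * (\<kappa> - 1) / r\<^sup>2)"
    using r by (simp add: field_simps power2_eq_square)
  finally show ?thesis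
    using has_vector_derivative_scaleR[OF powr_kappa_deriv[OF r] 2] unfolding v'_def[abs_def] v_def
    by (simp add: mult.commute)
qed

lemma inner_deriv:
  fixes a b :: "real \<Rightarrow> complex"
  assumes "(a has_vector_derivative a') (at r)" "(b has_vector_derivative b') (at r)"
  shows "((\<lambda>r. a r \<bullet> b r) has_real_derivative a r \<bullet> b' + a' \<bullet> b r) (at r)"
  using bounded_bilinear.has_vector_derivative[OF bounded_bilinear_inner assms]
  by (simp add: has_real_derivative_iff_has_vector_derivative)

sublocale liouville_solution e \<kappa> M "\<lambda>r. v r \<bullet> v r" "\<lambda>r. v r \<bullet> v' r" "\<lambda>r. v' r \<bullet> v' r"
proof
  have [measurable]: "v \<in> borel_measurable borel" "v' \<in> borel_measurable borel"
    unfolding v_def[abs_def] v'_def[abs_def] by measurable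
  show "(\<lambda>r. v r \<bullet> v r) \<in> borel_measurable borel" "(\<lambda>r. v' r \<bullet> v' r) \<in> borel_measurable borel"
    by measurable
  show "(v r \<bullet> v' r)\<^sup>2 \<le> v r \<bullet> v r * (v' r \<bullet> v' r)" for r by (rule Cauchy_Schwarz_ineq)
  show "((\<lambda>r. v r \<bullet> v r) has_real_derivative 2 * (v r \<bullet> v' r)) (at r)" if "r > 0" for r
    using inner_deriv[OF v_deriv[OF that] v_deriv[OF that]] by (simp add: inner_commute)
  show "((\<lambda>r. v r \<bullet> v' r) has_real_derivative v' r \<bullet> v' r - (e ^ 6 - r\<^sup>2 - \<kappa> * (\<kappa> - 1) / r\<^sup>2) * (v r \<bullet> v r)) (at r)"
    if "r > 0" for r
    using inner_deriv[OF v_deriv[OF that] v'_deriv[OF that]] by (simp add: algebra_simps)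
  show "((\<lambda>r. v' r \<bullet> v' r) has_real_derivative - 2 * (e ^ 6 - r\<^sup>2 - \<kappa> * (\<kappa> - 1) / r\<^sup>2) * (v r \<bullet> v' r)) (at r)"
    if "r > 0" for r
  proof -
    have "x \<bullet> (- q *\<^sub>R y) + (- q *\<^sub>R y) \<bullet> x = - 2 * q * (y \<bullet> x)" for q and x y :: complex
      by (simp add: inner_commute)
    note eq = this
    from inner_deriv[OF v'_deriv[OF that] v'_deriv[OF that]] show ?thesis by (simp only: eq)
  qed
  show "(\<integral>\<^sup>+r. ennreal (v r \<bullet> v r) * indicator {0<..} r \<partial>lborel) = ennreal M"
    unfolding u_mass[symmetric]
    by (simp only: v_sq)
qed (use e_ge kappa_half M_positive in auto)

definition a where "a = (norm (u 0))\<^sup>2"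

lemma a_nonneg: "a \<ge> 0" by (simp add: a_def)

text \<open>The damping term \<open>2 * \<kappa> / r\<close> and the growth of the potential both dissipate the energy, and at
  the origin the kinetic part vanishes.\<close>

lemma energy:
  assumes "r \<ge> 0"
  shows "(norm (u' r))\<^sup>2 + (e ^ 6 - r\<^sup>2) * (norm (u r))\<^sup>2 \<le> e ^ 6 * a"
proof -
  define En where "En r = u' r \<bullet> u' r + (e ^ 6 - r\<^sup>2) * (u r \<bullet> u r)" for r
  have "En r \<le> En 0"
  proof (cases "r = 0")
    case False
    with assms have r: "0 < r" by simp
    show ?thesis
    proof (rule DERIV_nonpos_imp_decreasing_open[where f = En and a = 0 and b = r])
      show "0 \<le> r" using r by simp
      fix x assume x: "0 < x" "x < r"
      have "((\<lambda>x. e ^ 6 - x\<^sup>2) has_real_derivative - 2 * x) (at x)"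
        by (auto intro!: derivative_eq_intros)
      from DERIV_add[OF inner_deriv[OF u'_deriv[OF x(1)] u'_deriv[OF x(1)]] DERIV_mult[OF this inner_deriv[OF u_deriv u_deriv]]]
      have D: "(En has_real_derivative (u' x \<bullet> (- (2 * \<kappa> / x) *\<^sub>R u' x - (e ^ 6 - x\<^sup>2) *\<^sub>R u x) +
         (- (2 * \<kappa> / x) *\<^sub>R u' x - (e ^ 6 - x\<^sup>2) *\<^sub>R u x) \<bullet> u' x) +
         (- 2 * x * (u x \<bullet> u x) + (u x \<bullet> u' x + u' x \<bullet> u x) * (e ^ 6 - x\<^sup>2))) (at x)"
        unfolding En_def[abs_def] .
      have "(u' x \<bullet> (- (2 * \<kappa> / x) *\<^sub>R u' x - (e ^ 6 - x\<^sup>2) *\<^sub>R u x) +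
         (- (2 * \<kappa> / x) *\<^sub>R u' x - (e ^ 6 - x\<^sup>2) *\<^sub>R u x) \<bullet> u' x) +
         (- 2 * x * (u x \<bullet> u x) + (u x \<bullet> u' x + u' x \<bullet> u x) * (e ^ 6 - x\<^sup>2))
        = - (4 * \<kappa> / x * (u' x \<bullet> u' x) + 2 * x * (u x \<bullet> u x))"
        by (simp add: inner_diff_left inner_diff_right inner_commute[of "u' x" "u x"])
      also have "... \<le> 0"
      proof -
        have "4 * \<kappa> / x * (u' x \<bullet> u' x) \<ge> 0" "2 * x * (u x \<bullet> u x) \<ge> 0"
          using x kappa_half by (auto intro!: mult_nonneg_nonneg)
        then show ?thesis by linarith
      qed
      finally show "\<exists>D. (En has_real_derivative D) (at x) \<and> D \<le> 0" using D by blast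
    next
      show "continuous_on {0..r} En" unfolding En_def[abs_def]
        by (intro continuous_intros u_cont continuous_on_subset[OF u'_cont]) auto
    qed
  qed simp
  then show ?thesis by (simp add: En_def u'_zero a_def power2_norm_eq_inner)
qed

lemma near_origin:
  assumes "0 \<le> r" "r \<le> e ^ 3 / 2"
  shows "(norm (u r))\<^sup>2 \<le> 2 * a" "norm (u' r) \<le> e ^ 3 * norm (u 0)"
proof -
  have "r\<^sup>2 \<le> (e ^ 3 / 2)\<^sup>2" using assms by (intro power_mono) auto
  moreover have "(e ^ 3 / 2)\<^sup>2 = e ^ 6 / 4" by (simp add: power_divide flip: power_mult)
  moreover have e6: "e ^ 6 > 0" using e_pos by simp
  ultimately have r: "e ^ 6 / 2 \<le> e ^ 6 - r\<^sup>2" by linarith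
  have "e ^ 6 / 2 * (norm (u r))\<^sup>2 \<le> (e ^ 6 - r\<^sup>2) * (norm (u r))\<^sup>2"
    using r by (intro mult_right_mono) auto
  also have "... \<le> e ^ 6 * a" using energy[OF assms(1)] zero_le_power2[of "norm (u' r)"] by linarith
  also have "... = e ^ 6 / 2 * (2 * a)" by simp
  finally show "(norm (u r))\<^sup>2 \<le> 2 * a" by (rule mult_left_le_imp_le) (use e6 in simp)
  have "(e ^ 6 - r\<^sup>2) * (norm (u r))\<^sup>2 \<ge> 0" using r e6 by (intro mult_nonneg_nonneg) (linarith, simp)
  then have "(norm (u' r))\<^sup>2 \<le> e ^ 6 * a" using energy[OF assms(1)] by linarith
  also have "... = (e ^ 3 * norm (u 0))\<^sup>2" by (simp add: a_def power_mult_distrib flip: power_mult)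
  finally show "norm (u' r) \<le> e ^ 3 * norm (u 0)" by (rule power2_le_imp_le) (use e_pos in auto)
qed

text \<open>The energy bounds \<open>\<bar>u'\<bar>\<close> by \<open>e ^ 3 * \<bar>u 0\<bar>\<close>, so \<open>u\<close> cannot lose more than half of its size over a
  length \<open>1 / (2 * e ^ 3)\<close>. The definition of \<open>r1\<close> is chosen for this.\<close>

lemma near_origin_ge:
  assumes "0 \<le> r" "r \<le> r1"
  shows "norm (u r) \<ge> norm (u 0) / 2"
proof -
  have e3: "e ^ 3 > 0" using e_pos by simp
  have "norm (u r - u 0) \<le> (e ^ 3 * norm (u 0)) * norm (r - 0)"
  proof (rule differentiable_bound[where S = "{0..r}" and f' = "\<lambda>x h. h *\<^sub>R u' x"])
    fix x assume x: "x \<in> {0..r}"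
    show "(u has_derivative (\<lambda>h. h *\<^sub>R u' x)) (at x within {0..r})"
      using u_deriv[of x] unfolding has_vector_derivative_def by (rule has_derivative_at_withinI)
    have "x \<le> e ^ 3 / 2" using x assms r1_bounds e3 by (simp del: zero_less_power)
    then have "norm (u' x) \<le> e ^ 3 * norm (u 0)" using near_origin(2)[of x] x by auto
    then have "\<And>h. norm (h *\<^sub>R u' x) \<le> e ^ 3 * norm (u 0) * norm h"
      by (simp add: mult.commute mult_left_mono)
    then show "onorm (\<lambda>h. h *\<^sub>R u' x) \<le> e ^ 3 * norm (u 0)" by (rule onorm_le)
  qed (use assms in auto)
  also have "... \<le> (e ^ 3 * norm (u 0)) * r1" using assms e_pos by (intro mult_left_mono) auto
  also have "... = norm (u 0) / 2" using e_pos by (simp add: r1_def)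
  finally have "norm (u r - u 0) \<le> norm (u 0) / 2" .
  then show ?thesis using norm_triangle_ineq2[of "u 0" "u r"] by (simp add: norm_minus_commute)
qed

lemma r1_powr: "r1 powr (2 * \<kappa>) * (2 powr (2 * \<kappa>) * e powr (6 * \<kappa>)) = 1"
proof -
  have "r1 powr (2 * \<kappa>) = 1 / (2 * e ^ 3) powr (2 * \<kappa>)" using e_pos by (simp add: r1_def powr_divide)
  also have "(2 * e ^ 3) powr (2 * \<kappa>) = 2 powr (2 * \<kappa>) * (e ^ 3) powr (2 * \<kappa>)" by (rule powr_mult)
  also have "(e ^ 3) powr (2 * \<kappa>) = e powr (6 * \<kappa>)" unfolding cube_powr by simp
  finally show ?thesis using e_pos by simp
qed

text \<open>Together with \<open>W_le_a\<close> this connects the two descriptions of the solution at \<open>r1\<close>: the value at the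
  origin and the WKB energy.\<close>

lemma a_le_W: "a \<le> 8 * 2 powr (2 * \<kappa>) * e powr (6 * \<kappa> - 3) * W r1"
proof -
  have e3: "e ^ 3 > 0" using e_pos by simp
  have "norm (u 0) / 2 \<le> norm (u r1)" using near_origin_ge[of r1] r1_bounds by auto
  then have "(norm (u 0) / 2)\<^sup>2 \<le> (norm (u r1))\<^sup>2" by (intro power_mono) auto
  then have "a / 4 \<le> (norm (u r1))\<^sup>2" by (simp add: a_def power_divide)
  then have "r1 powr (2 * \<kappa>) * (a / 4) \<le> v r1 \<bullet> v r1"
    using r1_bounds by (simp add: v_sq mult_left_mono)
  moreover have "sqrt (P r1) \<ge> e ^ 3 / 2" using r1_bounds e3 by (intro sqrt_P_ge) auto
  ultimately have "e ^ 3 / 2 * (r1 powr (2 * \<kappa>) * (a / 4)) \<le> sqrt (P r1) * (v r1 \<bullet> v r1)"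
    using a_nonneg e3 P_ge(2)[of r1] r1_bounds by (intro mult_mono) auto
  also have "... \<le> W r1" using P_ge[of r1] r1_bounds by (simp add: W_def)
  finally have "(2 powr (2 * \<kappa>) * e powr (6 * \<kappa>)) * (e ^ 3 / 2 * (r1 powr (2 * \<kappa>) * (a / 4)))
      \<le> (2 powr (2 * \<kappa>) * e powr (6 * \<kappa>)) * W r1"
    by (intro mult_left_mono) auto
  moreover have "(2 powr (2 * \<kappa>) * e powr (6 * \<kappa>)) * (e ^ 3 / 2 * (r1 powr (2 * \<kappa>) * (a / 4)))
     = (r1 powr (2 * \<kappa>) * (2 powr (2 * \<kappa>) * e powr (6 * \<kappa>))) * (e ^ 3 * a / 8)" by (simp only: mult_ac times_divide_eq_right times_divide_eq_left)
  ultimately have "e ^ 3 * a / 8 \<le> 2 powr (2 * \<kappa>) * e powr (6 * \<kappa>) * W r1"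
    by (simp only: r1_powr mult_1_left)
  then have "a \<le> 8 * 2 powr (2 * \<kappa>) * (e powr (6 * \<kappa>) / e ^ 3) * W r1" using e3 by (simp add: field_simps)
  also have "e powr (6 * \<kappa>) / e ^ 3 = e powr (6 * \<kappa> - 3)" using e_pos by (simp add: powr_diff)
  finally show ?thesis .
qed

lemma W_le_a: "W r1 \<le> (6 + 32 * \<kappa>\<^sup>2) * e powr (3 - 6 * \<kappa>) * a"
proof -
  have e3: "e ^ 3 > 0" using e_pos by simp
  have r: "0 \<le> r1" "r1 \<le> e ^ 3 / 2" using r1_bounds e3 by auto
  define w where "w = r1 powr (2 * \<kappa>)"
  have w: "w \<ge> 0" by (simp add: w_def)
  have g: "v r1 \<bullet> v r1 \<le> w * (2 * a)" using near_origin(1)[OF r] r1_bounds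
    by (simp add: v_sq w_def mult_left_mono)
  have r1': "\<kappa> / r1 = 2 * e ^ 3 * \<kappa>" by (simp add: r1_def)
  have h: "v' r1 \<bullet> v' r1 \<le> w * ((2 + 16 * \<kappa>\<^sup>2) * e ^ 6 * a)"
  proof -
    have "(norm (u' r1 + (\<kappa> / r1) *\<^sub>R u r1))\<^sup>2 \<le> (norm (u' r1) + norm ((\<kappa> / r1) *\<^sub>R u r1))\<^sup>2"
      by (intro power_mono norm_triangle_ineq) auto
    also have "... \<le> 2 * (norm (u' r1))\<^sup>2 + 2 * (norm ((\<kappa> / r1) *\<^sub>R u r1))\<^sup>2"
      using sum_squares_bound[of "norm (u' r1)" "norm ((\<kappa> / r1) *\<^sub>R u r1)"] by (simp add: power2_sum)
    also have "... \<le> 2 * (e ^ 6 * a) + 2 * (4 * e ^ 6 * \<kappa>\<^sup>2 * (2 * a))"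
    proof (intro add_mono mult_left_mono)
      have "(norm (u' r1))\<^sup>2 \<le> (e ^ 3 * norm (u 0))\<^sup>2" using near_origin(2)[OF r]
        by (intro power_mono) auto
      then show "(norm (u' r1))\<^sup>2 \<le> e ^ 6 * a" by (simp add: a_def power_mult_distrib flip: power_mult)
      have "(norm ((\<kappa> / r1) *\<^sub>R u r1))\<^sup>2 = 4 * e ^ 6 * \<kappa>\<^sup>2 * (norm (u r1))\<^sup>2"
        unfolding r1' by (simp add: power_mult_distrib flip: power_mult)
      also have "... \<le> 4 * e ^ 6 * \<kappa>\<^sup>2 * (2 * a)" using near_origin(1)[OF r]
        by (intro mult_left_mono) auto
      finally show "(norm ((\<kappa> / r1) *\<^sub>R u r1))\<^sup>2 \<le> 4 * e ^ 6 * \<kappa>\<^sup>2 * (2 * a)" .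
    qed auto
    also have "... = (2 + 16 * \<kappa>\<^sup>2) * e ^ 6 * a" by (simp add: algebra_simps)
    finally have *: "(norm (u' r1 + (\<kappa> / r1) *\<^sub>R u r1))\<^sup>2 \<le> (2 + 16 * \<kappa>\<^sup>2) * e ^ 6 * a" .
    have "v' r1 \<bullet> v' r1 = w * (norm (u' r1 + (\<kappa> / r1) *\<^sub>R u r1))\<^sup>2"
      by (simp only: v'_def w_def power2_norm_eq_inner mult_2 powr_add inner_scaleR_left inner_scaleR_right mult.assoc)
    also have "... \<le> w * ((2 + 16 * \<kappa>\<^sup>2) * e ^ 6 * a)" using * w by (rule mult_left_mono)
    finally show ?thesis .
  qed
  have sP: "sqrt (P r1) \<ge> e ^ 3 / 2" using r r1_bounds by (intro sqrt_P_ge) auto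
  have sP': "sqrt (P r1) \<le> e ^ 3"
  proof -
    have "P r1 \<le> (e ^ 3)\<^sup>2" by (simp add: P_def flip: power_mult)
    then show ?thesis using e3 by (intro real_le_lsqrt) auto
  qed
  have "W r1 \<le> e ^ 3 * (w * (2 * a)) + (w * ((2 + 16 * \<kappa>\<^sup>2) * e ^ 6 * a)) / (e ^ 3 / 2)"
    unfolding W_def
    using sP sP' g h e3 w a_nonneg by (intro add_mono mult_mono frac_le) auto
  also have "... = (6 + 32 * \<kappa>\<^sup>2) * (w * e ^ 3) * a"
  proof -
    have "(w * ((2 + 16 * \<kappa>\<^sup>2) * (t * t) * a)) / (t / 2)
        = 2 * w * (2 + 16 * \<kappa>\<^sup>2) * a * t" if "t > 0" for t
      using that by (simp add: field_simps)
    from this[OF e3] have "(w * ((2 + 16 * \<kappa>\<^sup>2) * e ^ 6 * a)) / (e ^ 3 / 2)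
        = 2 * w * (2 + 16 * \<kappa>\<^sup>2) * a * e ^ 3"
      by (simp only: power_add[symmetric]) simp
    then show ?thesis by (simp add: algebra_simps)
  qed
  also have "... \<le> (6 + 32 * \<kappa>\<^sup>2) * e powr (3 - 6 * \<kappa>) * a"
  proof (intro mult_right_mono mult_left_mono a_nonneg)
    have "w * e powr (6 * \<kappa>) * 1 \<le> w * e powr (6 * \<kappa>) * 2 powr (2 * \<kappa>)"
      using w kappa_half by (intro mult_left_mono) (auto intro: ge_one_powr_ge_zero)
    also have "... = 1" using r1_powr by (simp add: w_def mult_ac)
    finally have "w \<le> 1 / e powr (6 * \<kappa>)" using e_pos by (simp add: pos_le_divide_eq)
    then have "w * e ^ 3 \<le> 1 / e powr (6 * \<kappa>) * e ^ 3" using e3 by (intro mult_right_mono) auto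
    also have "... = e powr (3 - 6 * \<kappa>)" using e_pos by (simp add: powr_diff)
    finally show "w * e ^ 3 \<le> e powr (3 - 6 * \<kappa>)" .
  qed auto
  finally show ?thesis .
qed

end

section \<open>Bounds for a radial profile in terms of its mass\<close>

abbreviation Lp_integral :: "real \<Rightarrow> real \<Rightarrow> (real \<Rightarrow> complex) \<Rightarrow> ennreal" where
  "Lp_integral \<kappa> p u \<equiv>
     (\<integral>\<^sup>+r. ennreal (norm (u r) powr p * r powr (2 * \<kappa>)) * indicator {0<..} r \<partial>lborel)"

abbreviation origin_exponent :: "real \<Rightarrow> real \<Rightarrow> real" where
  "origin_exponent \<kappa> p \<equiv> (6 * \<kappa> - 3) * p / 2 - 3 * (2 * \<kappa> + 1)"

text \<open>The predicted size of the \<open>p\<close>-th power integral at frequency \<open>e\<close>. The four summands belong to the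
  neighbourhood of the origin, the bulk, the approach to the turning point, and the Airy zone
  together with the forbidden region.\<close>

definition Lp_size :: "real \<Rightarrow> real \<Rightarrow> real \<Rightarrow> real" where
  "Lp_size \<kappa> p e = e powr (origin_exponent \<kappa> p)
     + (e powr (- 3 * p / 2) * power_bound (\<kappa> * (p - 2)) (1 / (2 * e ^ 3)) (e ^ 3)
     + e powr (- 3 * \<kappa> * (p - 2)) *
         (e powr (- 3 * p / 4) * power_bound (p / 4) (1 / (2 * e)) (e ^ 3) + e powr (- p / 2 - 1)))"

context radial_profile begin

text \<open>A constant that depends on \<open>\<kappa>\<close> alone and dominates the products that arise when \<open>W_r1_le_mass\<close> is
  combined with \<open>a_le_W\<close> and with the bounds on \<open>g\<close>: it is \<open>8 * 122880\<close> times the remaining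
  factors.\<close>

definition K where "K = 983040 * K1 * K1 * K2 * (1 + \<kappa>\<^sup>2) * 2 powr (2 * \<kappa>)"

lemma K_pos: "K > 0"
proof -
  have "K1 > 0" "K2 > 0" using K1_K2_ge_one by linarith+
  moreover have "1 + \<kappa>\<^sup>2 > 0" by (simp add: add_pos_nonneg)
  ultimately show ?thesis unfolding K_def by (intro mult_pos_pos) auto
qed

lemma W_r1_le_M: "K1 * K2 * W r1 \<le> K * M"
proof -
  have "K1 * K2 * W r1 \<le> K1 * K2 * (K1 * (122880 * (1 + \<kappa>\<^sup>2) * M))"
    using W_r1_le_mass K1_K2_product by (intro mult_left_mono) auto
  also have "... = (122880 * K1 * K1 * K2 * (1 + \<kappa>\<^sup>2) * M) * 1" by (simp only: mult_ac mult_1_right)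
  also have "... \<le> (122880 * K1 * K1 * K2 * (1 + \<kappa>\<^sup>2) * M) * (8 * 2 powr (2 * \<kappa>))"
  proof (rule mult_left_mono)
    have "2 powr (2 * \<kappa>) \<ge> 1" using kappa_half by (intro ge_one_powr_ge_zero) auto
    then show "1 \<le> 8 * 2 powr (2 * \<kappa>)" by linarith
    show "0 \<le> 122880 * K1 * K1 * K2 * (1 + \<kappa>\<^sup>2) * M" using K1_K2_ge_one M_positive
      by (intro mult_nonneg_nonneg) auto
  qed
  also have "... = K * M" by (simp add: K_def mult_ac)
  finally show ?thesis .
qed

lemma a_le_M: "a \<le> K * e powr (6 * \<kappa> - 3) * M"
proof -
  have "a \<le> 8 * 2 powr (2 * \<kappa>) * e powr (6 * \<kappa> - 3) * W r1" by (rule a_le_W)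
  also have "... \<le> 8 * 2 powr (2 * \<kappa>) * e powr (6 * \<kappa> - 3) * (K1 * (122880 * (1 + \<kappa>\<^sup>2) * M))"
    using W_r1_le_mass by (intro mult_left_mono) auto
  also have "... = (8 * 2 powr (2 * \<kappa>) * e powr (6 * \<kappa> - 3) * (K1 * (122880 * (1 + \<kappa>\<^sup>2) * M))) * 1"
    by simp
  also have "...
      \<le> (8 * 2 powr (2 * \<kappa>) * e powr (6 * \<kappa> - 3) * (K1 * (122880 * (1 + \<kappa>\<^sup>2) * M))) * (K1 * K2)"
    using K1_K2_ge_one K1_K2_product M_positive by (intro mult_left_mono mult_nonneg_nonneg) auto
  also have "... = K * e powr (6 * \<kappa> - 3) * M" by (simp add: K_def mult_ac)
  finally show ?thesis .
qed

lemma r1_volume: "r1 powr (2 * \<kappa>) * r1 \<le> e powr (- 3 * (2 * \<kappa> + 1))"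
proof -
  have "r1 powr (2 * \<kappa>) * r1 powr 1 = r1 powr (2 * \<kappa> + 1)" by (simp only: powr_add)
  then have "r1 powr (2 * \<kappa>) * r1 = r1 powr (2 * \<kappa> + 1)" using r1_bounds by simp
  also have "... \<le> (e powr (- 3)) powr (2 * \<kappa> + 1)"
  proof (intro powr_mono2)
    have "r1 \<le> 1 / e ^ 3" using e_pos by (simp add: r1_def field_simps)
    also have "... = e powr (- 3)" using e_pos powr_minus_divide[of e 3] by simp
    finally show "r1 \<le> e powr (- 3)" .
  qed (use r1_bounds kappa_half in auto)
  also have "... = e powr (- 3 * (2 * \<kappa> + 1))" by (simp only: powr_powr)
  finally show ?thesis .
qed

lemma integral_near_origin:
  assumes p: "p \<ge> 2"
  shows "(\<integral>\<^sup>+r. ennreal (norm (u r) powr p * r powr (2 * \<kappa>)) * indicator {0<..r1} r \<partial>lborel)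
    \<le> ennreal ((2 * a) powr (p / 2) * e powr (- 3 * (2 * \<kappa> + 1)))"
proof -
  have e3: "e ^ 3 > 0" using e_pos by simp
  have "(\<integral>\<^sup>+r. ennreal (norm (u r) powr p * r powr (2 * \<kappa>)) * indicator {0<..r1} r \<partial>lborel)
    \<le> (\<integral>\<^sup>+r. ennreal ((2 * a) powr (p / 2) * r1 powr (2 * \<kappa>)) * indicator {0..r1} r \<partial>lborel)"
  proof (intro nn_integral_mono)
    fix r
    show "ennreal (norm (u r) powr p * r powr (2 * \<kappa>)) * indicator {0<..r1} r
      \<le> ennreal ((2 * a) powr (p / 2) * r1 powr (2 * \<kappa>)) * indicator {0..r1} r"
    proof (cases "r \<in> {0<..r1}")
      case True
      then have "0 \<le> r" "r \<le> e ^ 3 / 2" using r1_bounds e3 by auto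
      from near_origin(1)[OF this] have "((norm (u r))\<^sup>2) powr (p / 2) \<le> (2 * a) powr (p / 2)"
        using p by (intro powr_mono2) auto
      moreover have "((norm (u r))\<^sup>2) powr (p / 2) = norm (u r) powr p"
      proof -
        have "((norm (u r))\<^sup>2) = norm (u r) powr 2" by simp
        then show ?thesis by (simp only: powr_powr) simp
      qed
      ultimately have "norm (u r) powr p * r powr (2 * \<kappa>) \<le> (2 * a) powr (p / 2) * r1 powr (2 * \<kappa>)"
        using True kappa_half by (intro mult_mono powr_mono2) auto
      from ennreal_leI[OF this] show ?thesis using True by simp
    qed auto
  qed
  also have "... = ennreal ((2 * a) powr (p / 2) * (r1 powr (2 * \<kappa>) * r1))"
    using r1_bounds by (simp add: nn_integral_cmult ennreal_mult[symmetric] mult.assoc)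
  also have "... \<le> ennreal ((2 * a) powr (p / 2) * e powr (- 3 * (2 * \<kappa> + 1)))"
    using r1_volume by (intro ennreal_leI mult_left_mono) auto
  finally show ?thesis .
qed

lemma Lp_integrand:
  assumes "r > 0"
  shows "norm (u r) powr p * r powr (2 * \<kappa>) = (v r \<bullet> v r) powr (p / 2) * r powr (- \<kappa> * (p - 2))"
proof -
  have "(v r \<bullet> v r) powr (p / 2) = (r powr (2 * \<kappa>)) powr (p / 2) * ((norm (u r))\<^sup>2) powr (p / 2)"
    unfolding v_sq by (rule powr_mult)
  also have "(norm (u r))\<^sup>2 = norm (u r) powr 2" by simp
  also have "(norm (u r) powr 2) powr (p / 2) = norm (u r) powr p" by (simp only: powr_powr) simp
  also have "(r powr (2 * \<kappa>)) powr (p / 2) = r powr (\<kappa> * p)" by (simp only: powr_powr) simp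
  finally have "(v r \<bullet> v r) powr (p / 2) * r powr (- \<kappa> * (p - 2))
    = norm (u r) powr p * (r powr (\<kappa> * p) * r powr (- \<kappa> * (p - 2)))" by (simp only: mult_ac)
  also have "r powr (\<kappa> * p) * r powr (- \<kappa> * (p - 2)) = r powr (2 * \<kappa>)"
    by (simp only: powr_add[symmetric]) (simp add: algebra_simps)
  finally show ?thesis by simp
qed

lemma Lp_split:
  assumes p: "p \<ge> 2"
  shows "Lp_integral \<kappa> p u
    \<le> ennreal ((2 * a) powr (p / 2) * e powr (- 3 * (2 * \<kappa> + 1)))
      + (\<integral>\<^sup>+r. density p r * indicator {r1..} r \<partial>lborel)"
proof -
  have [measurable]: "v \<in> borel_measurable borel" unfolding v_def[abs_def] by measurable
  have "Lp_integral \<kappa> p u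
    \<le> (\<integral>\<^sup>+r. (ennreal (norm (u r) powr p * r powr (2 * \<kappa>)) * indicator {0<..r1} r
        + density p r * indicator {r1..} r) \<partial>lborel)"
  proof (intro nn_integral_mono)
    fix r
    consider "r \<le> 0" | "0 < r" "r \<le> r1" | "0 < r" "r1 < r" by linarith
    then show "ennreal (norm (u r) powr p * r powr (2 * \<kappa>)) * indicator {0<..} r \<le>
      ennreal (norm (u r) powr p * r powr (2 * \<kappa>)) * indicator {0<..r1} r
        + density p r * indicator {r1..} r"
    proof cases
      case 3
      then show ?thesis unfolding Lp_integrand[OF 3(1)] by simp
    qed auto
  qed
  also have "... = (\<integral>\<^sup>+r. ennreal (norm (u r) powr p * r powr (2 * \<kappa>)) * indicator {0<..r1} r \<partial>lborel)
        + (\<integral>\<^sup>+r. density p r * indicator {r1..} r \<partial>lborel)"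
    by (intro nn_integral_add) measurable
  also have "... \<le> ennreal ((2 * a) powr (p / 2) * e powr (- 3 * (2 * \<kappa> + 1)))
      + (\<integral>\<^sup>+r. density p r * indicator {r1..} r \<partial>lborel)"
    by (intro add_right_mono integral_near_origin p)
  finally show ?thesis .
qed

lemma Lp_upper:
  assumes p: "p \<ge> 2"
  shows "Lp_integral \<kappa> p u
    \<le> ennreal (5 * (2 * K * M) powr (p / 2) * 2 powr (\<kappa> * (p - 2)) * Lp_size \<kappa> p e)"
proof -
  define D where "D = 5 * (2 * K * M) powr (p / 2) * 2 powr (\<kappa> * (p - 2))"
  define S1 where "S1 = e powr (origin_exponent \<kappa> p)"
  define S2 where "S2 = e powr (- 3 * p / 2) * power_bound (\<kappa> * (p - 2)) r1 (e ^ 3)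
     + e powr (- 3 * \<kappa> * (p - 2)) *
         (e powr (- 3 * p / 4) * power_bound (p / 4) (1 / (2 * e)) (e ^ 3) + e powr (- p / 2 - 1))"
  have size: "Lp_size \<kappa> p e = S1 + S2" unfolding Lp_size_def S1_def S2_def r1_def ..
  have S: "S1 \<ge> 0" "S2 \<ge> 0"
    using r1_bounds r2_bounds turning_point_gap e_pos
    by (auto simp: S1_def S2_def intro!: mult_nonneg_nonneg power_bound_nonneg add_nonneg_nonneg)
  have b: "2 powr (\<kappa> * (p - 2)) \<ge> 1" using kappa_half p by (intro ge_one_powr_ge_zero) auto
  have KM: "K * M > 0" using K_pos M_positive by simp
  have "(2 * a) powr (p / 2) * e powr (- 3 * (2 * \<kappa> + 1)) \<le> D * S1"
  proof -
    have "(2 * a) powr (p / 2) \<le> ((2 * K * M) * e powr (6 * \<kappa> - 3)) powr (p / 2)"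
      using a_le_M a_nonneg p by (intro powr_mono2) (auto simp: mult_ac)
    also have "... = (2 * K * M) powr (p / 2) * (e powr (6 * \<kappa> - 3)) powr (p / 2)" by (rule powr_mult)
    also have "(e powr (6 * \<kappa> - 3)) powr (p / 2) = e powr ((6 * \<kappa> - 3) * p / 2)"
      by (simp only: powr_powr) simp
    finally have "(2 * a) powr (p / 2) * e powr (- 3 * (2 * \<kappa> + 1))
      \<le> (2 * K * M) powr (p / 2) * e powr ((6 * \<kappa> - 3) * p / 2) * e powr (- 3 * (2 * \<kappa> + 1))"
      by (intro mult_right_mono) auto
    also have "... = (2 * K * M) powr (p / 2) * S1"
    proof -
      have "origin_exponent \<kappa> p = (6 * \<kappa> - 3) * p / 2 + - 3 * (2 * \<kappa> + 1)" by simp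
      then show ?thesis unfolding S1_def by (simp only: powr_add mult.assoc)
    qed
    also have "... \<le> D * S1"
    proof (intro mult_right_mono S)
      have "(2 * K * M) powr (p / 2) * 1 \<le> (2 * K * M) powr (p / 2) * (5 * 2 powr (\<kappa> * (p - 2)))"
        using b by (intro mult_left_mono) auto
      then show "(2 * K * M) powr (p / 2) \<le> D" by (simp only: D_def mult_ac mult_1_right mult_1_left)
    qed
    finally show ?thesis .
  qed
  moreover have "5 * (2 * K1 * K2 * W r1) powr (p / 2) * 2 powr (\<kappa> * (p - 2)) * S2 \<le> D * S2"
    unfolding D_def
  proof (intro mult_right_mono mult_left_mono powr_mono2 S)
    show "2 * K1 * K2 * W r1 \<le> 2 * K * M" using W_r1_le_M by simp
    show "0 \<le> 2 * K1 * K2 * W r1" using K1_K2_product W_r1_nonneg by simp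
  qed (use p in auto)
  moreover have "(\<integral>\<^sup>+r. density p r * indicator {r1..} r \<partial>lborel)
    \<le> ennreal (5 * (2 * K1 * K2 * W r1) powr (p / 2) * 2 powr (\<kappa> * (p - 2)) * S2)"
    using Lp_beyond_origin[OF p] unfolding S2_def .
  ultimately have "Lp_integral \<kappa> p u
     \<le> ennreal (D * S1) + ennreal (D * S2)"
    by (intro order_trans[OF Lp_split[OF p] add_mono]) (auto intro: ennreal_leI order_trans)
  also have "... = ennreal (D * (S1 + S2))"
    using S by (subst ennreal_plus[symmetric]) (auto simp: D_def distrib_left)
  finally show ?thesis unfolding D_def size .
qed

text \<open>For \<open>p = 2\<close> the power integral is the mass itself, and the three summands of the bound are at most
  \<open>1\<close>, \<open>2\<close> and \<open>1\<close>. So the upper bound for \<open>p = 2\<close> is a lower bound for the amplitude.\<close>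

lemma M_le_a: "M \<le> (2 + 40 * (K1 * K2) * (6 + 32 * \<kappa>\<^sup>2)) * e powr (3 - 6 * \<kappa>) * a"
proof -
  have w0: "W r1 \<ge> 0" by (rule W_r1_nonneg)
  have far: "(\<integral>\<^sup>+r. ennreal ((v r \<bullet> v r) powr (2 / 2) * r powr (- \<kappa> * (2 - 2))) * indicator {r1..} r \<partial>lborel)
    \<le> ennreal (40 * (K1 * K2) * W r1)"
  proof -
    have "(\<integral>\<^sup>+r. ennreal ((v r \<bullet> v r) powr (2 / 2) * r powr (- \<kappa> * (2 - 2))) * indicator {r1..} r \<partial>lborel)
     \<le> ennreal (5 * (2 * K1 * K2 * W r1) powr (2 / 2) * 2 powr (\<kappa> * (2 - 2)) *
        (e powr (- 3 * 2 / 2) * power_bound (\<kappa> * (2 - 2)) r1 (e ^ 3)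
         + e powr (- 3 * \<kappa> * (2 - 2)) * (e powr (- 3 * 2 / 4) * power_bound (2 / 4) (1 / (2 * e)) (e ^ 3)
           + e powr (- 2 / 2 - 1))))" (is "_ \<le> ennreal (?A * (?x + ?y * (?z + ?t)))")
      by (rule Lp_beyond_origin) simp
    also have "... \<le> ennreal (10 * (K1 * K2) * W r1 * (1 + 1 * (2 + 1)))"
    proof (intro ennreal_leI)
      have A: "?A \<le> 10 * (K1 * K2) * W r1" using w0 K1_K2_ge_one by simp
      have "power_bound (\<kappa> * (2 - 2)) r1 (e ^ 3) = e ^ 3" by (simp add: power_bound_def e_pos less_imp_le)
      moreover have "e powr (- 3 * 2 / 2) = 1 / e ^ 3" using powr_minus_divide[of e 3] e_pos by simp
      ultimately have x: "?x \<le> 1" using e_pos by simp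
      have "power_bound (2 / 4) (1 / (2 * e)) (e ^ 3) = 2 * (e ^ 3) powr (1 / 2)"
        by (simp add: power_bound_def)
      also have "(e ^ 3) powr (1 / 2) = e powr (3 / 2)" unfolding cube_powr by simp
      finally have "?z = 2 * (e powr (- 3 * 2 / 4) * e powr (3 / 2))" by simp
      also have "e powr (- 3 * 2 / 4) * e powr (3 / 2) = 1" using e_pos
        by (simp only: powr_add[symmetric]) simp
      finally have z: "?z \<le> 2" by simp
      have y: "?y \<le> 1" by simp
      have "?t \<le> e powr 0" using e_large by (intro powr_mono) auto
      then have t: "?t \<le> 1" using e_pos by simp
      have nn: "0 \<le> ?x + ?y * (?z + ?t)" "0 \<le> ?z + ?t"
        using r1_bounds r2_bounds turning_point_gap e_pos
        by (intro add_nonneg_nonneg mult_nonneg_nonneg power_bound_nonneg; simp)+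
      have B: "0 \<le> 10 * (K1 * K2) * W r1" using w0 K1_K2_product by simp
      show "?A * (?x + ?y * (?z + ?t)) \<le> 10 * (K1 * K2) * W r1 * (1 + 1 * (2 + 1))"
        by (rule mult_mono[OF A add_mono[OF x mult_mono[OF y add_mono[OF z t]]]])
          (use nn B in simp_all)
    qed
    finally show ?thesis by (simp add: mult_ac)
  qed
  have "ennreal M = (\<integral>\<^sup>+r. ennreal (norm (u r) powr 2 * r powr (2 * \<kappa>)) * indicator {0<..} r \<partial>lborel)"
    unfolding u_mass[symmetric] by (simp add: mult.commute)
  also have "...
      \<le> ennreal ((2 * a) powr (2 / 2) * e powr (- 3 * (2 * \<kappa> + 1))) + ennreal (40 * (K1 * K2) * W r1)"
    by (intro order_trans[OF Lp_split add_left_mono[OF far]]) simp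
  also have "... = ennreal (2 * a * e powr (- 3 * (2 * \<kappa> + 1)) + 40 * (K1 * K2) * W r1)"
    using a_nonneg w0 K1_K2_product by (subst ennreal_plus[symmetric]) auto
  finally have "M \<le> 2 * a * e powr (- 3 * (2 * \<kappa> + 1)) + 40 * (K1 * K2) * W r1"
    using a_nonneg w0 K1_K2_product by (subst (asm) ennreal_le_iff) auto
  also have "...
      \<le> 2 * a * e powr (3 - 6 * \<kappa>) + 40 * (K1 * K2) * ((6 + 32 * \<kappa>\<^sup>2) * e powr (3 - 6 * \<kappa>) * a)"
    using e_large a_nonneg W_le_a K1_K2_product by (intro add_mono mult_left_mono powr_mono) auto
  also have "... = (2 + 40 * (K1 * K2) * (6 + 32 * \<kappa>\<^sup>2)) * e powr (3 - 6 * \<kappa>) * a"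
  proof -
    have "2 * a * E + 40 * k * (l * E * a) = (2 + 40 * k * l) * E * a" for k l E
      by (simp add: algebra_simps)
    then show ?thesis .
  qed
  finally show ?thesis .
qed

text \<open>Beyond \<open>e ^ 3 / 2\<close> the transform \<open>v\<close> is bounded by the amplitude, and dividing by
  \<open>r powr \<kappa>\<close> only gains.\<close>

lemma sup_bound:
  assumes "r \<ge> 0"
  shows "(norm (u r))\<^sup>2 \<le> (2 + K1 * K2 * (6 + 32 * \<kappa>\<^sup>2) * 2 powr (2 * \<kappa>)) * a"
proof (cases "r \<le> e ^ 3 / 2")
  case True
  have "(norm (u r))\<^sup>2 \<le> 2 * a" by (rule near_origin(1)[OF assms True])
  also have "... \<le> (2 + K1 * K2 * (6 + 32 * \<kappa>\<^sup>2) * 2 powr (2 * \<kappa>)) * a"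
    using a_nonneg K1_K2_product by (intro mult_right_mono) auto
  finally show ?thesis .
next
  case False
  have e3: "e ^ 3 > 0" using e_pos by simp
  then have r: "r > 0" "r \<ge> r1" "e ^ 3 / 2 \<le> r" using False r1_bounds by auto
  have A0: "K1 * K2 * W r1 \<ge> 0" using K1_K2_product W_r1_nonneg by simp
  have g: "v r \<bullet> v r \<le> K1 * K2 * W r1"
  proof (cases "r \<le> r2")
    case True
    have "v r \<bullet> v r \<le> K1 * K2 * W r1 / sqrt (P r)" using True r by (intro g_bulk) auto
    also have "... \<le> K1 * K2 * W r1 / 1"
      using P_ge[of r] True r A0 by (intro divide_left_mono) auto
    finally show ?thesis by simp
  next
    case False
    then have "v r \<bullet> v r \<le> K1 * K2 * W r1 / e" by (intro g_far) auto
    also have "... \<le> K1 * K2 * W r1 / 1" using e_large A0 by (intro divide_left_mono) auto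
    finally show ?thesis by simp
  qed
  have rp: "r powr (2 * \<kappa>) > 0" using r by simp
  have "(e ^ 3 / 2) powr (2 * \<kappa>) \<le> r powr (2 * \<kappa>)" using r e3 kappa_half by (intro powr_mono2) auto
  also have "(e ^ 3 / 2) powr (2 * \<kappa>) = (e ^ 3) powr (2 * \<kappa>) / 2 powr (2 * \<kappa>)" using e3
    by (simp add: powr_divide)
  also have "(e ^ 3) powr (2 * \<kappa>) = e powr (6 * \<kappa>)" unfolding cube_powr by simp
  finally have w: "e powr (6 * \<kappa>) / 2 powr (2 * \<kappa>) \<le> r powr (2 * \<kappa>)" .
  have "(e powr (6 * \<kappa>) / 2 powr (2 * \<kappa>)) * (norm (u r))\<^sup>2 \<le> r powr (2 * \<kappa>) * (norm (u r))\<^sup>2"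
    using w by (intro mult_right_mono) auto
  also have "... = v r \<bullet> v r" by (simp only: v_sq)
  also have "... \<le> K1 * K2 * W r1" by (rule g)
  also have "... \<le> K1 * K2 * ((6 + 32 * \<kappa>\<^sup>2) * e powr (3 - 6 * \<kappa>) * a)" using W_le_a K1_K2_product
    by (intro mult_left_mono) auto
  also have "... \<le> K1 * K2 * ((6 + 32 * \<kappa>\<^sup>2) * e powr (6 * \<kappa>) * a)"
    using e_large kappa_half a_nonneg K1_K2_product
    by (intro mult_left_mono mult_right_mono powr_mono) auto
  finally have "e powr (6 * \<kappa>) * (norm (u r))\<^sup>2
      \<le> e powr (6 * \<kappa>) * (K1 * K2 * (6 + 32 * \<kappa>\<^sup>2) * 2 powr (2 * \<kappa>) * a)"
    by (simp add: pos_divide_le_eq mult_ac)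
  then have "(norm (u r))\<^sup>2 \<le> K1 * K2 * (6 + 32 * \<kappa>\<^sup>2) * 2 powr (2 * \<kappa>) * a" using e_pos by simp
  then show ?thesis using a_nonneg unfolding distrib_right by linarith
qed

text \<open>The outer half of the interval up to \<open>r1\<close> carries a fixed fraction of the weight.\<close>

lemma Lp_lower:
  assumes p: "p > 0"
  shows "ennreal ((norm (u 0) / 2) powr p * (r1 / 2) powr (2 * \<kappa> + 1))
    \<le> Lp_integral \<kappa> p u"
proof -
  have "(r1 / 2) powr (2 * \<kappa>) * (r1 / 2) powr 1 = (r1 / 2) powr (2 * \<kappa> + 1)" by (simp only: powr_add)
  then have "(r1 / 2) powr (2 * \<kappa> + 1) = (r1 / 2) powr (2 * \<kappa>) * (r1 / 2)" using r1_bounds by simp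
  then have "ennreal ((norm (u 0) / 2) powr p * (r1 / 2) powr (2 * \<kappa> + 1))
    = ennreal ((norm (u 0) / 2) powr p * (r1 / 2) powr (2 * \<kappa>)) * ennreal (r1 - r1 / 2)"
    using r1_bounds by (subst ennreal_mult[symmetric]) auto
  also have "...
      = (\<integral>\<^sup>+r. ennreal ((norm (u 0) / 2) powr p * (r1 / 2) powr (2 * \<kappa>)) * indicator {r1 / 2..r1} r \<partial>lborel)"
    using r1_bounds by (subst nn_integral_cmult) auto
  also have "... \<le> Lp_integral \<kappa> p u"
  proof (intro nn_integral_mono)
    fix r
    show "ennreal ((norm (u 0) / 2) powr p * (r1 / 2) powr (2 * \<kappa>)) * indicator {r1 / 2..r1} r
      \<le> ennreal (norm (u r) powr p * r powr (2 * \<kappa>)) * indicator {0<..} r"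
    proof (cases "r \<in> {r1 / 2..r1}")
      case True
      then have r: "0 < r" "r \<le> r1" "r1 / 2 \<le> r" using r1_bounds by auto
      have "(norm (u 0) / 2) powr p * (r1 / 2) powr (2 * \<kappa>) \<le> norm (u r) powr p * r powr (2 * \<kappa>)"
        using r near_origin_ge[of r] r1_bounds p kappa_half by (intro mult_mono powr_mono2) auto
      from ennreal_leI[OF this] show ?thesis using True r by simp
    qed auto
  qed
  finally show ?thesis .
qed

end

section \<open>Growth of the size function\<close>

lemma power_bound_below_one:
  assumes "e > 0" "q < 1"
  shows "power_bound q a (e ^ 3) = e powr (3 * (1 - q)) / (1 - q)"
proof -
  have "(e ^ 3) powr (1 - q) = (e powr 3) powr (1 - q)" using assms by simp
  then show ?thesis using assms by (simp only: powr_powr power_bound_def) simp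
qed

lemma power_bound_above_one:
  assumes "e > 0" "q > 1"
  shows "power_bound q (1 / (2 * e ^ k)) b = 2 powr (q - 1) * e powr (real k * (q - 1)) / (q - 1)"
proof -
  have "(1 / (2 * e ^ k)) powr (1 - q) = 1 / (2 * e ^ k) powr (1 - q)" using assms
    by (simp add: powr_divide)
  also have "... = (2 * e ^ k) powr (q - 1)" using powr_minus_divide[of "2 * e ^ k" "1 - q"] by simp
  also have "... = 2 powr (q - 1) * (e ^ k) powr (q - 1)" by (rule powr_mult)
  also have "(e ^ k) powr (q - 1) = (e powr real k) powr (q - 1)" using assms by (simp add: powr_realpow)
  also have "... = e powr (real k * (q - 1))" by (simp only: powr_powr)
  finally show ?thesis using assms by (simp add: power_bound_def)
qed

lemma power_bound_one:
  assumes "e > 0"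
  shows "power_bound 1 (1 / (2 * e ^ k)) (e ^ 3) = ln 2 + (real k + 3) * ln e"
  using assms by (simp add: power_bound_def ln_mult ln_realpow distrib_right)

text \<open>The bulk and the approach to the turning point have exactly the claimed order; the other two
  summands are smaller because \<open>\<kappa> * (p - 2) < 1\<close> and \<open>p < 4\<close>.\<close>

lemma Lp_size_subcritical:
  assumes \<kappa>: "\<kappa> \<ge> 1 / 2" and p: "p \<ge> 2" and sub: "\<kappa> * (p - 2) < 1" and e: "e \<ge> 1"
  shows "Lp_size \<kappa> p e
      \<le> (2 + 1 / (1 - \<kappa> * (p - 2)) + 1 / (1 - p / 4)) * e powr (- 3 * (2 * \<kappa> + 1) * (p - 2) / 2)"
proof -
  define T where "T = e powr (- 3 * (2 * \<kappa> + 1) * (p - 2) / 2)"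
  have "(1 / 2) * (p - 2) \<le> \<kappa> * (p - 2)" using \<kappa> p by (intro mult_right_mono) auto
  then have "(1 / 2) * (p - 2) < 1" using sub by (rule le_less_trans)
  then have p4: "p < 4" by simp
  have e0: "e > 0" using e by simp
  have 1: "e powr (origin_exponent \<kappa> p) \<le> T"
    unfolding T_def using sub by (intro powr_mono e) (simp add: field_simps)
  have 2: "e powr (- 3 * p / 2) * power_bound (\<kappa> * (p - 2)) (1 / (2 * e ^ 3)) (e ^ 3)
      = 1 / (1 - \<kappa> * (p - 2)) * T"
  proof -
    have "e powr (- 3 * p / 2) * e powr (3 * (1 - \<kappa> * (p - 2))) = T"
      unfolding T_def powr_add[symmetric]
      by (rule arg_cong[where f = "\<lambda>x. e powr x"]) (simp add: field_simps)
    then show ?thesis unfolding power_bound_below_one[OF e0 sub] by simp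
  qed
  have 3: "e powr (- 3 * \<kappa> * (p - 2)) * (e powr (- 3 * p / 4) * power_bound (p / 4) (1 / (2 * e)) (e ^ 3))
      = 1 / (1 - p / 4) * T"
  proof -
    have "e powr (- 3 * \<kappa> * (p - 2)) * (e powr (- 3 * p / 4) * e powr (3 * (1 - p / 4))) = T"
      unfolding T_def powr_add[symmetric]
      by (rule arg_cong[where f = "\<lambda>x. e powr x"]) (simp add: field_simps)
    then show ?thesis using p4 by (subst power_bound_below_one[OF e0]) (simp_all add: field_simps)
  qed
  have 4: "e powr (- 3 * \<kappa> * (p - 2)) * e powr (- p / 2 - 1) \<le> T"
    unfolding T_def powr_add[symmetric] using p4 by (intro powr_mono e) (simp add: field_simps)
  have "Lp_size \<kappa> p e \<le> T + (1 / (1 - \<kappa> * (p - 2)) * T + (1 / (1 - p / 4) * T + T))"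
    unfolding Lp_size_def distrib_left[of "e powr (- 3 * \<kappa> * (p - 2))"] 2 3 using 1 4 by linarith
  also have "... = (2 + 1 / (1 - \<kappa> * (p - 2)) + 1 / (1 - p / 4)) * T"
    unfolding distrib_right by simp
  finally show ?thesis unfolding T_def .
qed

text \<open>The logarithm comes from the bulk and, in dimension two, where \<open>p = 4\<close>, also from the turning
  point. For \<open>p = 4\<close> the constant contains \<open>1 / 0 = 0\<close>, so the same formula serves both cases.\<close>

lemma Lp_size_critical:
  assumes \<kappa>: "\<kappa> \<ge> 1 / 2" and p: "p \<ge> 2" and crit: "\<kappa> * (p - 2) = 1" and e: "e \<ge> 1"
  shows "Lp_size \<kappa> p e \<le> (14 + 1 / (1 - p / 4)) * (e powr (- 3 * p / 2) * (1 + ln e))"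
proof -
  define T where "T = e powr (- 3 * p / 2)"
  have "(1 / 2) * (p - 2) \<le> \<kappa> * (p - 2)" using \<kappa> p by (intro mult_right_mono) auto
  then have "(1 / 2) * (p - 2) \<le> 1" unfolding crit .
  then have p4: "p \<le> 4" by simp
  have e0: "e > 0" using e by simp
  have L: "ln e \<ge> 0" using e by simp
  have T0: "T \<ge> 0" by (simp add: T_def)
  have \<kappa>p: "\<kappa> * p = 1 + 2 * \<kappa>" using crit by (simp add: algebra_simps)
  have ln2: "ln 2 \<le> (1::real)" using ln_le_minus_one[of 2] by simp
  have 1: "e powr (origin_exponent \<kappa> p) = T"
    unfolding T_def by (rule arg_cong[where f = "\<lambda>x. e powr x"]) (use \<kappa>p in \<open>simp add: field_simps\<close>)
  have 2: "e powr (- 3 * p / 2) * power_bound (\<kappa> * (p - 2)) (1 / (2 * e ^ 3)) (e ^ 3)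
      \<le> T * (1 + 6 * ln e)"
    unfolding crit power_bound_one[OF e0] T_def using ln2 by (intro mult_left_mono) auto
  have 3: "e powr (- 3 * \<kappa> * (p - 2)) * (e powr (- 3 * p / 4) * power_bound (p / 4) (1 / (2 * e)) (e ^ 3))
      \<le> T * (1 + 6 * ln e) + 1 / (1 - p / 4) * T"
  proof (cases "p = 4")
    case True
    have "e powr (- 3 * \<kappa> * (p - 2)) * e powr (- 3 * p / 4) = T"
    proof -
      have k: "\<kappa> = 1 / 2" using True crit by simp
      show ?thesis unfolding T_def powr_add[symmetric] True k by simp
    qed
    moreover have "power_bound (p / 4) (1 / (2 * e)) (e ^ 3) = ln 2 + 4 * ln e"
      using power_bound_one[OF e0, of 1] True by simp
    ultimately have "e powr (- 3 * \<kappa> * (p - 2)) * (e powr (- 3 * p / 4) * power_bound (p / 4) (1 / (2 * e)) (e ^ 3))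
      = T * (ln 2 + 4 * ln e)" by (simp only: mult.assoc[symmetric])
    also have "... \<le> T * (1 + 6 * ln e)" using ln2 L T0 by (intro mult_left_mono) auto
    finally show ?thesis using True by simp
  next
    case False
    then have p4': "p / 4 < 1" using p4 by simp
    have "e powr (- 3 * \<kappa> * (p - 2)) * (e powr (- 3 * p / 4) * e powr (3 * (1 - p / 4))) = T"
      unfolding T_def powr_add[symmetric]
      by (rule arg_cong[where f = "\<lambda>x. e powr x"]) (use \<kappa>p in \<open>simp add: field_simps\<close>)
    then have "e powr (- 3 * \<kappa> * (p - 2)) * (e powr (- 3 * p / 4) * power_bound (p / 4) (1 / (2 * e)) (e ^ 3)) = 1 / (1 - p / 4) * T"
      using p4' by (subst power_bound_below_one[OF e0 p4']) (simp add: field_simps)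
    moreover have "0 \<le> T * (1 + 6 * ln e)" using T0 L by simp
    ultimately show ?thesis by linarith
  qed
  have 4: "e powr (- 3 * \<kappa> * (p - 2)) * e powr (- p / 2 - 1) \<le> T"
    unfolding T_def powr_add[symmetric] using p4 \<kappa>p by (intro powr_mono e) (simp add: field_simps)
  have "Lp_size \<kappa> p e \<le> T + (T * (1 + 6 * ln e) + ((T * (1 + 6 * ln e) + 1 / (1 - p / 4) * T) + T))"
    unfolding Lp_size_def distrib_left[of "e powr (- 3 * \<kappa> * (p - 2))"] using 1 2 3 4 by linarith
  also have "... = (4 + 12 * ln e + 1 / (1 - p / 4)) * T" by (simp add: algebra_simps)
  also have "... \<le> ((14 + 1 / (1 - p / 4)) * (1 + ln e)) * T"
  proof (intro mult_right_mono T0)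
    define D where "D = 1 / (1 - p / 4)"
    have "D \<ge> 0" using p4 by (simp add: D_def)
    then have "D * ln e \<ge> 0" using L by simp
    then have "4 + 12 * ln e + D \<le> (14 + D) * (1 + ln e)" using L by (simp add: algebra_simps)
    then show "4 + 12 * ln e + 1 / (1 - p / 4) \<le> (14 + 1 / (1 - p / 4)) * (1 + ln e)"
      unfolding D_def .
  qed
  finally show ?thesis by (simp only: T_def mult_ac)
qed

text \<open>The origin dominates. For \<open>p \<ge> 4\<close> the turning point gains weight, and the stated order is only
  derived in dimension two, that is for \<open>\<kappa> = 1 / 2\<close>. Interpolation with the supremum supplies the
  remaining cases in \<open>uniform_Lp_bound_supercritical\<close>.\<close>

lemma Lp_size_supercritical:
  assumes \<kappa>: "\<kappa> \<ge> 1 / 2" and p: "p \<ge> 2" and super: "\<kappa> * (p - 2) > 1"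
    and p4: "p < 4 \<or> \<kappa> = 1 / 2"
  shows "\<exists>C>0. \<forall>e\<ge>1. Lp_size \<kappa> p e \<le> C * e powr (origin_exponent \<kappa> p)"
proof -
  define t where "t = origin_exponent \<kappa> p"
  define c1 where "c1 = 2 powr (\<kappa> * (p - 2) - 1) / (\<kappa> * (p - 2) - 1)"
  define c2 where "c2 = (if p < 4 then 1 / (1 - p / 4) else 2 powr (p / 4 - 1) / (p / 4 - 1))"
  have c: "c1 \<ge> 0" "c2 \<ge> 0" using super by (auto simp: c1_def c2_def)
  have "p > 4" if "\<kappa> = 1 / 2" using super unfolding that by simp
  then have p4': "p < 4 \<or> \<kappa> = 1 / 2 \<and> p > 4" using p4 by auto
  have "Lp_size \<kappa> p e \<le> (2 + c1 + c2) * e powr t" if e: "e \<ge> 1" for e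
  proof -
    define T where "T = e powr t"
    have e0: "e > 0" using e by simp
    have 2: "e powr (- 3 * p / 2) * power_bound (\<kappa> * (p - 2)) (1 / (2 * e ^ 3)) (e ^ 3) = c1 * T"
    proof -
      have "e powr (- 3 * p / 2) * e powr (real 3 * (\<kappa> * (p - 2) - 1)) = T"
        unfolding T_def powr_add[symmetric]
        by (rule arg_cong[where f = "\<lambda>x. e powr x"]) (simp add: t_def field_simps)
      then show ?thesis unfolding power_bound_above_one[OF e0 super] c1_def by (simp add: mult_ac)
    qed
    have 3: "e powr (- 3 * \<kappa> * (p - 2)) * (e powr (- 3 * p / 4) * power_bound (p / 4) (1 / (2 * e)) (e ^ 3)) \<le> c2 * T"
    proof (cases "p < 4")
      case True
      have "e powr (- 3 * \<kappa> * (p - 2)) * (e powr (- 3 * p / 4) * e powr (3 * (1 - p / 4))) \<le> T"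
        unfolding T_def powr_add[symmetric] using super
        by (intro powr_mono e) (simp add: t_def field_simps)
      then have "(e powr (- 3 * \<kappa> * (p - 2)) * (e powr (- 3 * p / 4) * e powr (3 * (1 - p / 4)))) * (1 / (1 - p / 4)) \<le> T * (1 / (1 - p / 4))"
        using True by (intro mult_right_mono) auto
      moreover have "power_bound (p / 4) (1 / (2 * e)) (e ^ 3)
          = e powr (3 * (1 - p / 4)) * (1 / (1 - p / 4))"
        using power_bound_below_one[OF e0, of "p / 4"] True by simp
      ultimately show ?thesis using True unfolding c2_def by (simp only: mult_ac if_True)
    next
      case False
      then have k: "\<kappa> = 1 / 2" "p > 4" using p4' by auto
      have "- 3 * \<kappa> * (p - 2) + (- 3 * p / 4 + real 1 * (p / 4 - 1)) \<le> t"
        unfolding k(1) t_def using k(2) by (simp add: field_simps)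
      then have "e powr (- 3 * \<kappa> * (p - 2)) * (e powr (- 3 * p / 4) * e powr (real 1 * (p / 4 - 1))) \<le> T"
        unfolding T_def powr_add[symmetric] by (rule powr_mono[OF _ e])
      then have "(e powr (- 3 * \<kappa> * (p - 2)) * (e powr (- 3 * p / 4) * e powr (real 1 * (p / 4 - 1)))) * (2 powr (p / 4 - 1) / (p / 4 - 1)) \<le> T * (2 powr (p / 4 - 1) / (p / 4 - 1))"
        using k(2) by (intro mult_right_mono) auto
      moreover have "power_bound (p / 4) (1 / (2 * e)) (e ^ 3)
          = e powr (real 1 * (p / 4 - 1)) * (2 powr (p / 4 - 1) / (p / 4 - 1))"
        using power_bound_above_one[OF e0, of "p / 4" 1 "e ^ 3"] k(2) by simp
      ultimately show ?thesis using False unfolding c2_def by (simp only: mult_ac if_False)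
    qed
    have 4: "e powr (- 3 * \<kappa> * (p - 2)) * e powr (- p / 2 - 1) \<le> T"
      unfolding T_def powr_add[symmetric]
    proof (rule powr_mono[OF _ e])
      show "- 3 * \<kappa> * (p - 2) + (- p / 2 - 1) \<le> t"
      proof (cases "p < 4")
        case True then show ?thesis using super by (simp add: t_def field_simps)
      next
        case False
        then have k: "\<kappa> = 1 / 2" "p > 4" using p4' by auto
        show ?thesis unfolding k(1) t_def using k(2) by (simp add: field_simps)
      qed
    qed
    have "Lp_size \<kappa> p e \<le> T + (c1 * T + (c2 * T + T))"
      unfolding Lp_size_def distrib_left[of "e powr (- 3 * \<kappa> * (p - 2))"] 2 t_def[symmetric] T_def[symmetric] using 3 4 by linarith
    also have "... = (2 + c1 + c2) * T" by (simp add: algebra_simps)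
    finally show ?thesis unfolding T_def .
  qed
  moreover have "2 + c1 + c2 > 0" using c by linarith
  ultimately show ?thesis unfolding t_def by blast
qed

section \<open>Bounds uniform in the frequency\<close>

lemma Lp_size_nonneg: assumes "e \<ge> 1" shows "Lp_size \<kappa> p e \<ge> 0"
proof -
  have "1 \<le> e ^ 3" using assms by simp
  moreover from this have "1 \<le> 2 * e ^ 3" by linarith
  then have "1 / (2 * e ^ 3) \<le> 1" "1 / (2 * e) \<le> 1"
    using assms by (simp_all add: divide_le_eq_1)
  ultimately have "1 / (2 * e ^ 3) \<le> e ^ 3" "1 / (2 * e) \<le> e ^ 3" by linarith+
  then show ?thesis unfolding Lp_size_def using assms
    by (intro add_nonneg_nonneg mult_nonneg_nonneg power_bound_nonneg) auto
qed

lemma uniform_Lp_bound: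
  assumes "p \<ge> 2"
  shows "\<exists>C>0. \<forall>e u u'. radial_profile e \<kappa> M u u' \<longrightarrow>
    Lp_integral \<kappa> p u \<le> ennreal (C * Lp_size \<kappa> p e)"
proof -
  define C where "C = max 1 (5 * (2 * radial_profile.K \<kappa> * M) powr (p / 2) * 2 powr (\<kappa> * (p - 2)))"
  have "Lp_integral \<kappa> p u \<le> ennreal (C * Lp_size \<kappa> p e)"
    if "radial_profile e \<kappa> M u u'" for e u u'
  proof -
    interpret radial_profile e \<kappa> M u u' by fact
    show ?thesis
      by (rule order_trans[OF Lp_upper[OF assms]], intro ennreal_leI mult_right_mono)
        (auto simp: C_def intro: Lp_size_nonneg e_large)
  qed
  moreover have "C > 0" by (simp add: C_def)
  ultimately show ?thesis by blast
qed

lemma uniform_sup_bound: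
  "\<exists>C>0. \<forall>e u u'. radial_profile e \<kappa> M u u' \<longrightarrow> (\<forall>r\<ge>0. norm (u r) \<le> C * e powr (3 * \<kappa> - 3 / 2))"
proof -
  define D where "D
      = (2 + liouville_solution.K1 \<kappa> * liouville_solution.K2 \<kappa> * (6 + 32 * \<kappa>\<^sup>2) * 2 powr (2 * \<kappa>)) * (radial_profile.K \<kappa> * M)"
  define C where "C = max 1 (sqrt D)"
  have "norm (u r) \<le> C * e powr (3 * \<kappa> - 3 / 2)"
    if "radial_profile e \<kappa> M u u'" "r \<ge> 0" for e u u' r
  proof -
    interpret radial_profile e \<kappa> M u u' by fact
    have "(norm (u r))\<^sup>2 \<le> (2 + K1 * K2 * (6 + 32 * \<kappa>\<^sup>2) * 2 powr (2 * \<kappa>)) * a"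
      by (rule sup_bound[OF that(2)])
    also have "... \<le> (2 + K1 * K2 * (6 + 32 * \<kappa>\<^sup>2) * 2 powr (2 * \<kappa>)) * (K * e powr (6 * \<kappa> - 3) * M)"
      using a_le_M K1_K2_product by (intro mult_left_mono) auto
    also have "... = D * (e powr (3 * \<kappa> - 3 / 2))\<^sup>2"
      by (simp add: D_def power2_eq_square powr_add[symmetric])
    finally have "norm (u r) \<le> sqrt (D * (e powr (3 * \<kappa> - 3 / 2))\<^sup>2)" by (rule real_le_rsqrt)
    also have "... = sqrt D * e powr (3 * \<kappa> - 3 / 2)" by (simp add: real_sqrt_mult)
    also have "... \<le> C * e powr (3 * \<kappa> - 3 / 2)" by (intro mult_right_mono) (auto simp: C_def)
    finally show ?thesis .
  qed
  moreover have "C > 0" by (simp add: C_def)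
  ultimately show ?thesis by blast
qed

lemma uniform_origin_bound:
  assumes "M > 0"
  shows "\<exists>c>0. \<forall>e u u'. radial_profile e \<kappa> M u u' \<longrightarrow>
    (\<forall>r. 0 \<le> r \<and> r \<le> 1 / (2 * e ^ 3) \<longrightarrow> c * e powr (3 * \<kappa> - 3 / 2) \<le> norm (u r))"
proof -
  define D where "D
      = max 1 (2 + 40 * (liouville_solution.K1 \<kappa> * liouville_solution.K2 \<kappa>) * (6 + 32 * \<kappa>\<^sup>2))"
  have D: "D > 0" by (simp add: D_def)
  define b where "b = sqrt (M / D) / 2"
  have "b * e powr (3 * \<kappa> - 3 / 2) \<le> norm (u r)"
    if "radial_profile e \<kappa> M u u'" "0 \<le> r" "r \<le> 1 / (2 * e ^ 3)" for e u u' r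
  proof -
    interpret radial_profile e \<kappa> M u u' by fact
    have "M \<le> (2 + 40 * (K1 * K2) * (6 + 32 * \<kappa>\<^sup>2)) * e powr (3 - 6 * \<kappa>) * a" by (rule M_le_a)
    also have "... \<le> D * e powr (3 - 6 * \<kappa>) * a"
      using a_nonneg by (intro mult_right_mono) (auto simp: D_def)
    finally have "M * e powr (6 * \<kappa> - 3) \<le> (D * e powr (3 - 6 * \<kappa>) * a) * e powr (6 * \<kappa> - 3)"
      by (intro mult_right_mono) auto
    also have "... = D * a * (e powr (3 - 6 * \<kappa>) * e powr (6 * \<kappa> - 3))" by (simp only: mult_ac)
    also have "e powr (3 - 6 * \<kappa>) * e powr (6 * \<kappa> - 3) = 1" using e_pos by (simp add: powr_add[symmetric])
    finally have "M / D * e powr (6 * \<kappa> - 3) \<le> (norm (u 0))\<^sup>2"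
      using D by (simp add: a_def field_simps)
    moreover have "e powr (6 * \<kappa> - 3) = (e powr (3 * \<kappa> - 3 / 2))\<^sup>2"
      by (simp add: power2_eq_square powr_add[symmetric])
    ultimately have "M / D * (e powr (3 * \<kappa> - 3 / 2))\<^sup>2 \<le> (norm (u 0))\<^sup>2" by simp
    then have "sqrt (M / D * (e powr (3 * \<kappa> - 3 / 2))\<^sup>2) \<le> norm (u 0)"
      using real_sqrt_le_mono by fastforce
    moreover have "sqrt (M / D * x\<^sup>2) = sqrt (M / D) * x" if "x \<ge> 0" for x
      using that by (simp only: real_sqrt_mult real_sqrt_abs abs_of_nonneg)
    ultimately have "sqrt (M / D) * e powr (3 * \<kappa> - 3 / 2) \<le> norm (u 0)" by simp
    then have "b * e powr (3 * \<kappa> - 3 / 2) \<le> norm (u 0) / 2" by (simp add: b_def)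
    also have "... \<le> norm (u r)" using that by (intro near_origin_ge) (auto simp: r1_def)
    finally show ?thesis .
  qed
  moreover have "b > 0" using D assms by (simp add: b_def)
  ultimately show ?thesis by blast
qed

text \<open>In dimension at least three the critical exponent is at most \<open>3\<close>, so some supercritical exponent
  \<open>q \<le> p\<close> lies below \<open>4\<close>. Estimating \<open>\<bar>u\<bar> powr (p - q)\<close> by its supremum loses nothing, because both
  the supremum and the integral are governed by the origin.\<close>

lemma uniform_Lp_bound_supercritical:
  assumes \<kappa>: "\<kappa> = 1 / 2 \<or> \<kappa> \<ge> 1" and p: "p \<ge> 2" "\<kappa> * (p - 2) > 1"
  shows "\<exists>C>0. \<forall>e u u'. radial_profile e \<kappa> M u u' \<longrightarrow>
    Lp_integral \<kappa> p u
      \<le> ennreal (C * e powr (origin_exponent \<kappa> p))"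
proof -
  \<comment> \<open>For \<open>\<kappa> \<ge> 1\<close> the exponent \<open>7 / 2\<close> is supercritical, since \<open>\<kappa> * (7 / 2 - 2) \<ge> 3 / 2\<close>.\<close>
  define q where "q = (if \<kappa> = 1 / 2 then p else min p (7 / 2))"
  have q: "q \<ge> 2" "q \<le> p" "q < 4 \<or> \<kappa> = 1 / 2" using p by (auto simp: q_def)
  have q1: "\<kappa> * (q - 2) > 1"
  proof (cases "q = p")
    case False
    then have "q = 7 / 2" "\<kappa> \<ge> 1" using \<kappa> by (auto simp: q_def min_def split: if_splits)
    then show ?thesis by (simp only: ) simp
  qed (use p in simp)
  have k: "\<kappa> \<ge> 1 / 2" using \<kappa> by auto
  obtain C1 where C1: "C1 > 0" "\<And>e u u'. radial_profile e \<kappa> M u u' \<Longrightarrow>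
    Lp_integral \<kappa> q u \<le> ennreal (C1 * Lp_size \<kappa> q e)"
    using uniform_Lp_bound[OF q(1), of \<kappa> M] by blast
  obtain C2 where C2: "C2 > 0" "\<And>e. e \<ge> 1 \<Longrightarrow> Lp_size \<kappa> q e \<le> C2 * e powr (origin_exponent \<kappa> q)"
    using Lp_size_supercritical[OF k q(1) q1 q(3)] by blast
  obtain C3 where C3: "C3 > 0" "\<And>e u u' r. radial_profile e \<kappa> M u u' \<Longrightarrow> r \<ge> 0 \<Longrightarrow> norm (u r)
      \<le> C3 * e powr (3 * \<kappa> - 3 / 2)"
    using uniform_sup_bound[of \<kappa> M] by blast
  define C where "C = C3 powr (p - q) * (C1 * C2)"
  have "Lp_integral \<kappa> p u
      \<le> ennreal (C * e powr (origin_exponent \<kappa> p))"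
    if prof: "radial_profile e \<kappa> M u u'" for e u u'
  proof -
    interpret radial_profile e \<kappa> M u u' by fact
    define S where "S = C3 powr (p - q) * e powr ((3 * \<kappa> - 3 / 2) * (p - q))"
    have pt: "norm (u r) powr p * r powr (2 * \<kappa>)
        \<le> S * (norm (u r) powr q * r powr (2 * \<kappa>))" if "r > 0" for r
    proof -
      have "norm (u r) powr p = norm (u r) powr (p - q) * norm (u r) powr q"
        by (simp only: powr_add[symmetric]) simp
      also have "... \<le> (C3 * e powr (3 * \<kappa> - 3 / 2)) powr (p - q) * norm (u r) powr q"
        using C3(2)[OF prof, of r] that q by (intro mult_right_mono powr_mono2) auto
      also have "(C3 * e powr (3 * \<kappa> - 3 / 2)) powr (p - q) = S"
        unfolding S_def powr_mult powr_powr ..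
      finally show ?thesis by (simp add: mult_right_mono mult.assoc[symmetric])
    qed
    have S: "S \<ge> 0" by (simp add: S_def)
    have "Lp_integral \<kappa> p u
      \<le> (\<integral>\<^sup>+r. ennreal S * (ennreal (norm (u r) powr q * r powr (2 * \<kappa>)) * indicator {0<..} r) \<partial>lborel)"
    proof (intro nn_integral_mono)
      fix r
      show "ennreal (norm (u r) powr p * r powr (2 * \<kappa>)) * indicator {0<..} r
        \<le> ennreal S * (ennreal (norm (u r) powr q * r powr (2 * \<kappa>)) * indicator {0<..} r)"
        using ennreal_leI[OF pt[of r]] S by (cases "r > 0") (simp_all add: ennreal_mult)
    qed
    also have "... = ennreal S * Lp_integral \<kappa> q u"
      by (intro nn_integral_cmult) measurable
    also have "... \<le> ennreal S * ennreal (C1 * (C2 * e powr (origin_exponent \<kappa> q)))"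
      using C1(1) C2(2)[OF e_large(1)]
      by (intro mult_left_mono order_trans[OF C1(2)[OF prof]] ennreal_leI) auto
    also have "... = ennreal (S * (C1 * (C2 * e powr (origin_exponent \<kappa> q))))"
      using S C1 C2 by (subst ennreal_mult[symmetric]) auto
    also have "S * (C1 * (C2 * e powr (origin_exponent \<kappa> q)))
      = C * (e powr ((3 * \<kappa> - 3 / 2) * (p - q)) * e powr (origin_exponent \<kappa> q))"
      by (simp only: S_def C_def mult_ac)
    also have "e powr ((3 * \<kappa> - 3 / 2) * (p - q)) * e powr (origin_exponent \<kappa> q)
      = e powr (origin_exponent \<kappa> p)"
      unfolding powr_add[symmetric] by (rule arg_cong[where f = "\<lambda>x. e powr x"]) (simp add: field_simps)
    finally show ?thesis .
  qed
  moreover have "C > 0" using C1 C2 C3 by (simp add: C_def)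
  ultimately show ?thesis by blast
qed

lemma uniform_Lp_lower:
  assumes "M > 0" "p > 0"
  shows "\<exists>c>0. \<forall>e u u'. radial_profile e \<kappa> M u u' \<longrightarrow>
    ennreal (c * e powr (origin_exponent \<kappa> p)) \<le>
    Lp_integral \<kappa> p u"
proof -
  obtain c0 where c0: "c0 > 0" "\<And>e u u' r. radial_profile e \<kappa> M u u' \<Longrightarrow> 0 \<le> r \<Longrightarrow> r \<le> 1 / (2 * e ^ 3) \<Longrightarrow>
     c0 * e powr (3 * \<kappa> - 3 / 2) \<le> norm (u r)"
    using uniform_origin_bound[OF assms(1), of \<kappa>] by blast
  define b where "b = (c0 / 2) powr p * (1 / 4) powr (2 * \<kappa> + 1)"
  have "ennreal (b * e powr (origin_exponent \<kappa> p)) \<le>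
    Lp_integral \<kappa> p u"
    if prof: "radial_profile e \<kappa> M u u'" for e u u'
  proof -
    interpret radial_profile e \<kappa> M u u' by fact
    have "r1 / 2 = 1 / 4 * e powr (- 3)" using e_pos powr_minus_divide[of e 3] by (simp add: r1_def)
    then have r: "(r1 / 2) powr (2 * \<kappa> + 1) = (1 / 4) powr (2 * \<kappa> + 1) * e powr (- 3 * (2 * \<kappa> + 1))"
      by (simp only: powr_mult powr_powr)
    have "c0 / 2 * e powr (3 * \<kappa> - 3 / 2) \<le> norm (u 0) / 2" using c0(2)[OF prof, of 0] e_pos by simp
    then have "(c0 / 2 * e powr (3 * \<kappa> - 3 / 2)) powr p \<le> (norm (u 0) / 2) powr p"
      using c0 assms by (intro powr_mono2) auto
    moreover have "(c0 / 2 * e powr (3 * \<kappa> - 3 / 2)) powr p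
        = (c0 / 2) powr p * e powr ((3 * \<kappa> - 3 / 2) * p)"
      by (simp only: powr_mult powr_powr)
    ultimately have "(c0 / 2) powr p * e powr ((3 * \<kappa> - 3 / 2) * p) * (r1 / 2) powr (2 * \<kappa> + 1)
       \<le> (norm (u 0) / 2) powr p * (r1 / 2) powr (2 * \<kappa> + 1)"
      by (intro mult_right_mono) auto
    moreover have "(c0 / 2) powr p * e powr ((3 * \<kappa> - 3 / 2) * p) * (r1 / 2) powr (2 * \<kappa> + 1)
       = b * (e powr ((3 * \<kappa> - 3 / 2) * p) * e powr (- 3 * (2 * \<kappa> + 1)))"
      unfolding r b_def by (simp only: mult_ac)
    moreover have "e powr ((3 * \<kappa> - 3 / 2) * p) * e powr (- 3 * (2 * \<kappa> + 1))
        = e powr (origin_exponent \<kappa> p)"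
      unfolding powr_add[symmetric] by (rule arg_cong[where f = "\<lambda>x. e powr x"]) (simp add: field_simps)
    ultimately have "b * e powr (origin_exponent \<kappa> p)
        \<le> (norm (u 0) / 2) powr p * (r1 / 2) powr (2 * \<kappa> + 1)"
      by simp
    then show ?thesis by (intro order_trans[OF ennreal_leI Lp_lower[OF assms(2)]])
  qed
  moreover have "b > 0" using c0 by (simp add: b_def)
  ultimately show ?thesis by blast
qed

section \<open>From radial eigenfunctions to profiles\<close>

text \<open>In dimension at least two the rotations act transitively on spheres.\<close>

lemma radial_norm_eq:
  fixes f :: "real ^ 'd \<Rightarrow> 'b"
  assumes "radial f" "CARD('d) \<ge> 2" "norm x = norm y"
  shows "f x = f y"
proof -
  obtain g where g: "orthogonal_transformation g" "det (matrix g) = 1" "g x = y"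
    using rotation_exists[OF assms(2,3)] by blast
  then have "rotation_matrix (matrix g)"
    by (simp add: rotation_matrix_def orthogonal_transformation_matrix)
  then have "f (matrix g *v x) = f x" using assms(1) by (simp add: radial_def)
  moreover have "matrix g *v x = y"
    using g by (simp add: matrix_works orthogonal_transformation_def)
  ultimately show ?thesis by simp
qed

lemma partial_derivative_line:
  fixes f :: "'a::euclidean_space \<Rightarrow> 'b::real_normed_vector"
  assumes "f differentiable_on UNIV"
  shows "((\<lambda>t. f (x + t *\<^sub>R b)) has_vector_derivative partial_derivative b f (x + t *\<^sub>R b)) (at t)"
proof -
  have "f differentiable (at (x + t *\<^sub>R b))" using assms by (simp add: differentiable_on_def)
  then have F: "(f has_derivative frechet_derivative f (at (x + t *\<^sub>R b))) (at (x + t *\<^sub>R b))"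
    by (simp add: frechet_derivative_works)
  interpret bounded_linear "frechet_derivative f (at (x + t *\<^sub>R b))"
    by (rule has_derivative_bounded_linear[OF F])
  have "((\<lambda>t. x + t *\<^sub>R b) has_derivative (\<lambda>h. h *\<^sub>R b)) (at t)"
    by (auto intro!: derivative_eq_intros)
  from diff_chain_at[OF this F] show ?thesis
    by (simp add: has_vector_derivative_def o_def scaleR partial_derivative_def)
qed

text \<open>The profile is the restriction of \<open>f\<close> to a line through the origin. The pure second derivative in
  an orthogonal direction equals \<open>u' r / r\<close>, as \<open>f\<close> is \<open>u (sqrt (r\<^sup>2 + t\<^sup>2))\<close> along that direction.
  The condition \<open>u' 0 = 0\<close> holds because the restriction is even.\<close>

lemma radial_profile_ode:
  fixes f :: "real ^ 'd \<Rightarrow> complex"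
  assumes f: "C2 f" "radial f" and d: "CARD('d) \<ge> 2"
    and H: "\<And>x. harmonic_oscillator f x = E *\<^sub>R f x"
  obtains u u' where "\<And>x. f x = u (norm x)" "\<And>r. (u has_vector_derivative u' r) (at r)"
    "continuous_on UNIV u'" "u' 0 = 0"
    "\<And>r. r > 0
        \<Longrightarrow> (u' has_vector_derivative - ((real CARD('d) - 1) / r) *\<^sub>R u' r - (E - r\<^sup>2) *\<^sub>R u r) (at r)"
proof -
  obtain k :: 'd where True by simp
  define b where "b i = (axis i 1 :: real ^ 'd)" for i
  have b: "b i \<in> Basis" "norm (b i) = 1" for i by (auto simp: b_def Basis_vec_def)
  define u where "u r = f (r *\<^sub>R b k)" for r
  define u' where "u' r = partial_derivative (b k) f (r *\<^sub>R b k)" for r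
  define u'' where "u'' r = partial_derivative (b k) (partial_derivative (b k) f) (r *\<^sub>R b k)" for r
  have fu: "f x = u r" if "norm x = \<bar>r\<bar>" for x r
    unfolding u_def using that b by (intro radial_norm_eq[OF f(2) d]) simp
  have df: "f differentiable_on UNIV" and dpf: "partial_derivative (b i) f differentiable_on UNIV" for i
    using f(1) b by (auto simp: C2_def)
  have du: "(u has_vector_derivative u' r) (at r)" for r
    using partial_derivative_line[OF df, of 0 "b k" r] by (simp add: u_def[abs_def] u'_def)
  have du': "(u' has_vector_derivative u'' r) (at r)" for r
    using partial_derivative_line[OF dpf, of k 0 "b k" r] by (simp add: u'_def[abs_def] u''_def)
  have cu': "continuous_on UNIV u'"
    using du' by (meson continuous_at_imp_continuous_on has_vector_derivative_continuous)
  have even: "u (- r) = u r" for r using fu[of "r *\<^sub>R b k" "- r"] b by (simp add: u_def)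
  have u'0: "u' 0 = 0"
  proof -
    have "((\<lambda>r. u (- r)) has_vector_derivative (-1) *\<^sub>R u' (- 0)) (at 0)"
    proof -
      have "((\<lambda>r. - r) has_vector_derivative (-1::real)) (at (0::real))"
        using DERIV_minus[OF DERIV_ident[of "at (0::real)"]]
        by (simp add: has_real_derivative_iff_has_vector_derivative)
      from vector_diff_chain_at[OF this du[of "- 0"]] show ?thesis by (simp only: o_def)
    qed
    then have "(u has_vector_derivative - u' 0) (at 0)" by (simp add: even)
    from vector_derivative_unique_at[OF this du[of 0]] show ?thesis
      by (simp add: complex_eq_iff)
  qed
  have cross: "partial_derivative (b j) (partial_derivative (b j) f) (r *\<^sub>R b k) = (1 / r) *\<^sub>R u' r"
    if jk: "j \<noteq> k" and r: "r > 0" for j r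
  proof -
    define q where "q t = sqrt (r\<^sup>2 + t\<^sup>2)" for t
    have q: "q t > 0" for t using r by (simp add: q_def add_pos_nonneg)
    have orth: "b k \<bullet> b j = 0" using jk by (simp add: b_def inner_axis_axis)
    have nrm: "norm (r *\<^sub>R b k + t *\<^sub>R b j) = q t" for t
    proof -
      have "(norm (r *\<^sub>R b k + t *\<^sub>R b j))\<^sup>2 = r\<^sup>2 + t\<^sup>2"
      proof -
        have 1: "b k \<bullet> b k = 1" "b j \<bullet> b j = 1" using b(2) by (simp_all add: norm_eq_1)
        show ?thesis unfolding power2_norm_eq_inner inner_add_left inner_add_right inner_scaleR_left
            inner_scaleR_right inner_commute[of "b j" "b k"] orth 1
          by (simp add: power2_eq_square)
      qed
      then show ?thesis unfolding q_def by (metis norm_ge_zero real_sqrt_unique)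
    qed
    have fq: "f (r *\<^sub>R b k + t *\<^sub>R b j) = u (q t)" for t
      using nrm q[of t] by (intro fu) (simp add: less_imp_le)
    have dq: "(q has_vector_derivative t / q t) (at t)" for t
    proof -
      have "r\<^sup>2 + t\<^sup>2 > 0" using r by (simp add: add_pos_nonneg)
      then show ?thesis unfolding q_def[abs_def] has_real_derivative_iff_has_vector_derivative[symmetric]
        by (auto intro!: derivative_eq_intros simp: field_simps)
    qed
    have 1: "partial_derivative (b j) f (r *\<^sub>R b k + t *\<^sub>R b j) = (t / q t) *\<^sub>R u' (q t)" for t
    proof -
      have "((\<lambda>t. f (r *\<^sub>R b k + t *\<^sub>R b j)) has_vector_derivative (t / q t) *\<^sub>R u' (q t)) (at t)"
        using vector_diff_chain_at[OF dq du] by (simp add: fq o_def)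
      then show ?thesis using partial_derivative_line[OF df, of "r *\<^sub>R b k" "b j" t]
        by (rule vector_derivative_unique_at[symmetric])
    qed
    have "((\<lambda>t. (t / q t) *\<^sub>R u' (q t)) has_vector_derivative (1 / r) *\<^sub>R u' r) (at 0)"
    proof -
      have "((\<lambda>t. t / q t) has_real_derivative (1 * q 0 - 0 * (0 / q 0)) / (q 0 * q 0)) (at 0)"
        using dq[of 0] q[of 0] unfolding has_real_derivative_iff_has_vector_derivative[symmetric]
        by (intro DERIV_divide DERIV_ident) auto
      then have "((\<lambda>t. t / q t) has_real_derivative 1 / r) (at 0)" using r by (simp add: q_def)
      moreover have "((\<lambda>t. u' (q t)) has_vector_derivative (0 / q 0) *\<^sub>R u'' (q 0)) (at 0)"
        using vector_diff_chain_at[OF dq[of 0] du'] by (simp add: o_def)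
      ultimately show ?thesis
        using has_vector_derivative_scaleR[of "\<lambda>t. t / q t" "1 / r" 0 UNIV "\<lambda>t. u' (q t)"] r
        by (simp add: q_def)
    qed
    moreover have "((\<lambda>t. (t / q t) *\<^sub>R u' (q t)) has_vector_derivative
        partial_derivative (b j) (partial_derivative (b j) f) (r *\<^sub>R b k + 0 *\<^sub>R b j)) (at 0)"
      using partial_derivative_line[OF dpf[of j], of "r *\<^sub>R b k" "b j" 0] unfolding 1 .
    ultimately show ?thesis using vector_derivative_unique_at by fastforce
  qed
  have ode: "u'' r = - ((real CARD('d) - 1) / r) *\<^sub>R u' r - (E - r\<^sup>2) *\<^sub>R u r" if r: "r > 0" for r
  proof -
    have "laplacian f (r *\<^sub>R b k)
        = (\<Sum>i\<in>UNIV. partial_derivative (b i) (partial_derivative (b i) f) (r *\<^sub>R b k))"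
    proof -
      have inj: "inj b" by (auto simp: inj_def b_def axis_eq_axis)
      have Bs: "(Basis :: (real ^ 'd) set) = range b" by (auto simp: Basis_vec_def b_def)
      show ?thesis unfolding laplacian_def Bs by (simp add: sum.reindex[OF inj])
    qed
    also have "...
        = u'' r + (\<Sum>i\<in>UNIV - {k}. partial_derivative (b i) (partial_derivative (b i) f) (r *\<^sub>R b k))"
      unfolding u''_def by (rule sum.remove) auto
    also have "(\<Sum>i\<in>UNIV - {k}. partial_derivative (b i) (partial_derivative (b i) f) (r *\<^sub>R b k))
        = (\<Sum>i\<in>UNIV - {k}. (1 / r) *\<^sub>R u' r)"
      using cross r by (intro sum.cong) auto
    also have "... = ((real CARD('d) - 1) / r) *\<^sub>R u' r"
      using d by (simp only: sum_constant_scaleR scaleR_scaleR) (simp add: of_nat_diff card_Diff_singleton)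
    finally have "laplacian f (r *\<^sub>R b k) = u'' r + ((real CARD('d) - 1) / r) *\<^sub>R u' r" .
    then have "- (u'' r + ((real CARD('d) - 1) / r) *\<^sub>R u' r) + r\<^sup>2 *\<^sub>R u r = E *\<^sub>R u r"
      using H[of "r *\<^sub>R b k"] b r by (simp add: harmonic_oscillator_def u_def)
    then show ?thesis by (simp add: algebra_simps)
  qed
  show ?thesis
  proof (rule that[of u u'])
    show "f x = u (norm x)" for x by (rule fu) simp
    show "(u' has_vector_derivative - ((real CARD('d) - 1) / r) *\<^sub>R u' r - (E - r\<^sup>2) *\<^sub>R u r) (at r)" if "r > 0" for r
      using du'[of r] unfolding ode[OF that] .
  qed (use du cu' u'0 in auto)
qed

lemma Lp_norm_le:
  assumes p: "p > 0" and X: "X \<ge> 0" and I: "(\<integral>\<^sup>+x. ennreal (norm (f x) powr p) \<partial>lborel) \<le> ennreal X"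
  shows "Lp_norm (ennreal p) f \<le> ennreal (X powr (1 / p))"
proof -
  have fin: "(\<integral>\<^sup>+x. ennreal (norm (f x) powr p) \<partial>lborel) \<noteq> \<infinity>" using I
    by (metis ennreal_neq_top infinity_ennreal_def neq_top_trans)
  have "enn2real (\<integral>\<^sup>+x. ennreal (norm (f x) powr p) \<partial>lborel) \<le> X"
    using I X by (simp add: enn2real_leI)
  then have "enn2real (\<integral>\<^sup>+x. ennreal (norm (f x) powr p) \<partial>lborel) powr (1 / p) \<le> X powr (1 / p)"
    using p by (intro powr_mono2) auto
  then show ?thesis using p fin by (simp add: Lp_norm_def recip_ennreal ennreal_leI)
qed

lemma Lp_norm_ge:
  assumes p: "p > 0" and X: "X \<ge> 0" and I: "ennreal X \<le> (\<integral>\<^sup>+x. ennreal (norm (f x) powr p) \<partial>lborel)"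
  shows "ennreal (X powr (1 / p)) \<le> Lp_norm (ennreal p) f"
proof (cases "(\<integral>\<^sup>+x. ennreal (norm (f x) powr p) \<partial>lborel) = \<infinity>")
  case True
  then show ?thesis using p by (simp add: Lp_norm_def)
next
  case False
  then have "X \<le> enn2real (\<integral>\<^sup>+x. ennreal (norm (f x) powr p) \<partial>lborel)"
    using I X by (metis enn2real_ennreal enn2real_mono ennreal_less_top infinity_ennreal_def less_top)
  then have "X powr (1 / p) \<le> enn2real (\<integral>\<^sup>+x. ennreal (norm (f x) powr p) \<partial>lborel) powr (1 / p)"
    using p X by (intro powr_mono2) auto
  then show ?thesis using p False by (simp add: Lp_norm_def recip_ennreal ennreal_leI)
qed

text \<open>The parameter \<open>e\<close> of the profile that belongs to the eigenvalue \<open>4 n + d\<close>.\<close>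

definition hermite_scale :: "real \<Rightarrow> nat \<Rightarrow> real" where
  "hermite_scale d n = (4 * real n + d) powr (1 / 6)"

definition sphere_area :: "real \<Rightarrow> real" where
  "sphere_area d = d * unit_ball_vol d"

lemma radial_hermite_function_profile:
  fixes f :: "real ^ 'd \<Rightarrow> complex"
  assumes f: "radial_hermite_function n f" and d: "CARD('d) \<ge> 2" and n: "n \<ge> 1"
  obtains u u' where "\<And>x. f x = u (norm x)"
    "radial_profile (hermite_scale (real CARD('d)) n) ((real CARD('d) - 1) / 2)
       (1 / sphere_area (real CARD('d))) u u'"
proof -
  define E where "E = 4 * real n + real CARD('d)"
  define e where "e = E powr (1 / 6)"
  have E: "E \<ge> 6" using d n by (simp add: E_def)
  have e6: "e ^ 6 = E" using E by (simp add: e_def powr_realpow[symmetric] powr_powr)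
  have e1: "e \<ge> 1" using E by (simp add: e_def ge_one_powr_ge_zero)
  have e4: "e ^ 4 \<ge> 2"
  proof (rule power_le_imp_le_base)
    have "(2::real) ^ Suc 2 \<le> E\<^sup>2" using power_mono[of 6 E 2] E by simp
    also have "E\<^sup>2 = (e ^ 4) ^ Suc 2" by (simp flip: e6 power_mult)
    finally show "2 ^ Suc 2 \<le> (e ^ 4) ^ Suc 2" .
  qed (use e1 in simp)
  have vol: "real CARD('d) * unit_ball_vol (real CARD('d)) > 0" using d by simp
  obtain u u' where u: "\<And>x. f x = u (norm x)" "\<And>r. (u has_vector_derivative u' r) (at r)"
    "continuous_on UNIV u'" "u' 0 = 0"
    "\<And>r. r > 0
        \<Longrightarrow> (u' has_vector_derivative - ((real CARD('d) - 1) / r) *\<^sub>R u' r - (E - r\<^sup>2) *\<^sub>R u r) (at r)"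
    using radial_profile_ode[of f E] f d unfolding radial_hermite_function_def E_def by metis
  have "continuous_on UNIV u" using u(2)
    by (meson continuous_at_imp_continuous_on has_vector_derivative_continuous)
  then have [measurable]: "u \<in> borel_measurable borel" by (rule borel_measurable_continuous_onI)
  have I1: "(\<integral>\<^sup>+x. ennreal ((norm (u (norm (x :: real ^ 'd))))\<^sup>2) \<partial>lborel) = 1"
  proof -
    define I where "I = (\<integral>\<^sup>+x. ennreal (norm (f x) powr 2) \<partial>lborel)"
    have "Lp_norm (ennreal 2) f = (if I = \<infinity> then \<infinity> else ennreal (enn2real I powr (1 / 2)))"
    proof -
      have 1: "enn2real (ennreal 2) = 2" "recip (ennreal 2) = 1 / 2" "ennreal 2 \<noteq> \<infinity>"
        using recip_ennreal[of 2] by simp_all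
      show ?thesis unfolding Lp_norm_def I_def Let_def 1(1,2) using 1(3) by (simp only: if_False)
    qed
    moreover have "Lp_norm (ennreal 2) f = 1" using f by (simp add: radial_hermite_function_def)
    ultimately have N: "(if I = \<infinity> then \<infinity> else ennreal (enn2real I powr (1 / 2))) = 1" by simp
    then have fin: "I \<noteq> \<infinity>" by (auto split: if_splits)
    with N have "enn2real I powr (1 / 2) = 1" by simp
    then have "enn2real I = 1" by (simp add: powr_half_sqrt)
    then have "I = 1" using fin ennreal_enn2real[of I] by (simp add: less_top)
    then show ?thesis by (simp add: I_def u(1))
  qed
  have "(\<integral>\<^sup>+r. ennreal ((norm (u r))\<^sup>2 * r powr (real CARD('d) - 1)) * indicator {0<..} r \<partial>lborel)
     = ennreal (1 / (real CARD('d) * unit_ball_vol (real CARD('d))))" (is "?J = ennreal (1 / ?s)")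
  proof -
    have "1 = ennreal ?s * ?J"
      using nn_integral_radial_powr[of "\<lambda>r. (norm (u r))\<^sup>2", where 'a = "real ^ 'd"] d
      unfolding I1 by simp
    then have "ennreal (1 / ?s) * 1 = ennreal (1 / ?s) * (ennreal ?s * ?J)" by simp
    also have "... = (ennreal (1 / ?s) * ennreal ?s) * ?J" by (simp only: mult.assoc)
    also have "ennreal (1 / ?s) * ennreal ?s = 1"
    proof -
      have "ennreal (1 / x) * ennreal x = 1" if "x > 0" for x
        using that by (simp add: ennreal_mult[symmetric])
      from this[OF vol] show ?thesis .
    qed
    finally show ?thesis by simp
  qed
  note J = this
  have two: "2 * ((real CARD('d) - 1) / 2) = real CARD('d) - 1" by simp
  have "radial_profile e ((real CARD('d) - 1) / 2) (1 / (real CARD('d) * unit_ball_vol (real CARD('d)))) u u'"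
  proof unfold_locales
    show "1 / (real CARD('d) * unit_ball_vol (real CARD('d))) > 0" using vol
      by (intro divide_pos_pos) auto
    show "(u' has_vector_derivative - (2 * ((real CARD('d) - 1) / 2) / r) *\<^sub>R u' r - (e ^ 6 - r\<^sup>2) *\<^sub>R u r) (at r)"
      if "r > 0" for r unfolding two e6 by (rule u(5)[OF that])
    show "(\<integral>\<^sup>+r. ennreal (r powr (2 * ((real CARD('d) - 1) / 2)) * (norm (u r))\<^sup>2) * indicator {0<..} r \<partial>lborel)
        = ennreal (1 / (real CARD('d) * unit_ball_vol (real CARD('d))))"
      unfolding two using J by (simp only: mult.commute[of "_ powr _"])
  qed (use e1 e4 d u in auto)
  then show ?thesis using that[of u u'] u(1)
    unfolding e_def E_def hermite_scale_def sphere_area_def by blast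
qed

lemma hermite_scale_ge_one: "d \<ge> 2 \<Longrightarrow> n \<ge> 1 \<Longrightarrow> hermite_scale d n \<ge> 1"
  by (simp add: hermite_scale_def ge_one_powr_ge_zero)

lemma sphere_area_pos: "d > 0 \<Longrightarrow> sphere_area d > 0"
  by (simp add: sphere_area_def)

lemma Lp_norm_radial_hermite_le:
  fixes f :: "real ^ 'd \<Rightarrow> complex"
  defines "d \<equiv> real CARD('d)"
  assumes f: "radial_hermite_function n f" and d: "CARD('d) \<ge> 2" and n: "n \<ge> 1" and p: "p > 0"
    and C: "C \<ge> 0" and \<Phi>: "\<Phi> (hermite_scale d n) \<ge> 0"
    and bound: "\<And>e u u'. radial_profile e ((d - 1) / 2) (1 / sphere_area d) u u' \<Longrightarrow>
      Lp_integral ((d - 1) / 2) p u \<le> ennreal (C * \<Phi> e)"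
  shows "Lp_norm (ennreal p) f
      \<le> ennreal ((sphere_area d * C) powr (1 / p) * \<Phi> (hermite_scale d n) powr (1 / p))"
proof -
  obtain u u' where u: "\<And>x. f x
      = u (norm x)" "radial_profile (hermite_scale d n) ((d - 1) / 2) (1 / sphere_area d) u u'"
    using radial_hermite_function_profile[OF f d n] unfolding d_def by blast
  interpret radial_profile "hermite_scale d n" "(d - 1) / 2" "1 / sphere_area d" u u' by (rule u(2))
  have two: "2 * ((d - 1) / 2) = d - 1" by simp
  have s: "sphere_area d > 0" using d by (intro sphere_area_pos) (simp add: d_def)
  have "(\<integral>\<^sup>+x. ennreal (norm (f x) powr p) \<partial>lborel)
    = ennreal (sphere_area d) * (\<integral>\<^sup>+r. ennreal (norm (u r) powr p * r powr (d - 1)) * indicator {0<..} r \<partial>lborel)"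
    using nn_integral_radial_powr[of "\<lambda>r. norm (u r) powr p", where 'a = "real ^ 'd"] d
    by (simp add: u(1) d_def sphere_area_def)
  also have "... \<le> ennreal (sphere_area d) * ennreal (C * \<Phi> (hermite_scale d n))"
    using bound[OF u(2), unfolded two] by (intro mult_left_mono) auto
  also have "... = ennreal (sphere_area d * C * \<Phi> (hermite_scale d n))"
    using s C \<Phi> by (simp add: ennreal_mult[symmetric] mult.assoc)
  finally have "Lp_norm (ennreal p) f
      \<le> ennreal ((sphere_area d * C * \<Phi> (hermite_scale d n)) powr (1 / p))"
    using s C \<Phi> p by (intro Lp_norm_le) auto
  then show ?thesis by (simp only: powr_mult)
qed

lemma Lp_norm_radial_hermite_ge:
  fixes f :: "real ^ 'd \<Rightarrow> complex"
  defines "d \<equiv> real CARD('d)"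
  assumes f: "radial_hermite_function n f" and d: "CARD('d) \<ge> 2" and n: "n \<ge> 1" and p: "p > 0"
    and C: "C \<ge> 0" and \<Phi>: "\<Phi> (hermite_scale d n) \<ge> 0"
    and bound: "\<And>e u u'. radial_profile e ((d - 1) / 2) (1 / sphere_area d) u u' \<Longrightarrow>
      ennreal (C * \<Phi> e) \<le> Lp_integral ((d - 1) / 2) p u"
  shows "ennreal ((sphere_area d * C) powr (1 / p) * \<Phi> (hermite_scale d n) powr (1 / p))
      \<le> Lp_norm (ennreal p) f"
proof -
  obtain u u' where u: "\<And>x. f x
      = u (norm x)" "radial_profile (hermite_scale d n) ((d - 1) / 2) (1 / sphere_area d) u u'"
    using radial_hermite_function_profile[OF f d n] unfolding d_def by blast
  interpret radial_profile "hermite_scale d n" "(d - 1) / 2" "1 / sphere_area d" u u' by (rule u(2))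
  have two: "2 * ((d - 1) / 2) = d - 1" by simp
  have s: "sphere_area d > 0" using d by (intro sphere_area_pos) (simp add: d_def)
  have "ennreal (sphere_area d * C * \<Phi> (hermite_scale d n))
      = ennreal (sphere_area d) * ennreal (C * \<Phi> (hermite_scale d n))"
    using s C \<Phi> by (simp add: ennreal_mult[symmetric] mult.assoc)
  also have "...
      \<le> ennreal (sphere_area d) * (\<integral>\<^sup>+r. ennreal (norm (u r) powr p * r powr (d - 1)) * indicator {0<..} r \<partial>lborel)"
    using bound[OF u(2), unfolded two] by (intro mult_left_mono) auto
  also have "... = (\<integral>\<^sup>+x. ennreal (norm (f x) powr p) \<partial>lborel)"
    using nn_integral_radial_powr[of "\<lambda>r. norm (u r) powr p", where 'a = "real ^ 'd"] d
    by (simp add: u(1) d_def sphere_area_def)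
  finally have "ennreal ((sphere_area d * C * \<Phi> (hermite_scale d n)) powr (1 / p))
      \<le> Lp_norm (ennreal p) f"
    using s C \<Phi> p by (intro Lp_norm_ge) auto
  then show ?thesis by (simp only: powr_mult)
qed

lemma hermite_scale_powr:
  assumes d: "d > 0"
  shows "\<exists>c>0. \<exists>C>0. \<forall>n\<ge>1. c * real n powr \<gamma>
      \<le> hermite_scale d n powr (6 * \<gamma>) \<and> hermite_scale d n powr (6 * \<gamma>) \<le> C * real n powr \<gamma>"
proof -
  define c where "c = min (4 powr \<gamma>) ((4 + d) powr \<gamma>)"
  define C where "C = max (4 powr \<gamma>) ((4 + d) powr \<gamma>)"
  have "c * real n powr \<gamma> \<le> hermite_scale d n powr (6 * \<gamma>) \<and> hermite_scale d n powr (6 * \<gamma>)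
      \<le> C * real n powr \<gamma>"
    if n: "n \<ge> 1" for n
  proof -
    have s: "hermite_scale d n powr (6 * \<gamma>) = (4 * real n + d) powr \<gamma>"
      unfolding hermite_scale_def powr_powr by simp
    have "d * 1 \<le> d * real n" using d n by (intro mult_left_mono) auto
    then have ord: "4 * real n \<le> 4 * real n + d" "4 * real n + d \<le> (4 + d) * real n" "4 * real n > 0"
      using d n by (auto simp: algebra_simps)
    have e: "(4 * real n) powr \<gamma> = 4 powr \<gamma> * real n powr \<gamma>" "((4 + d) * real n) powr \<gamma>
        = (4 + d) powr \<gamma> * real n powr \<gamma>"
      by (rule powr_mult)+
    have cC: "c * real n powr \<gamma> \<le> 4 powr \<gamma> * real n powr \<gamma>" "c * real n powr \<gamma>
        \<le> (4 + d) powr \<gamma> * real n powr \<gamma>"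
      "4 powr \<gamma> * real n powr \<gamma> \<le> C * real n powr \<gamma>" "(4 + d) powr \<gamma> * real n powr \<gamma> \<le> C * real n powr \<gamma>"
      by (intro mult_right_mono; simp add: c_def C_def)+
    show ?thesis
    proof (cases "\<gamma> \<ge> 0")
      case True
      have "(4 * real n) powr \<gamma> \<le> (4 * real n + d) powr \<gamma>" "(4 * real n + d) powr \<gamma>
          \<le> ((4 + d) * real n) powr \<gamma>"
        using True ord d by (intro powr_mono2; simp)+
      then show ?thesis using cC unfolding s e by linarith
    next
      case False
      have "(4 * real n + d) powr \<gamma> \<le> (4 * real n) powr \<gamma>" "((4 + d) * real n) powr \<gamma>
          \<le> (4 * real n + d) powr \<gamma>"
        using False ord d by (intro powr_mono2'; simp)+
      then show ?thesis using cC unfolding s e by linarith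
    qed
  qed
  moreover have "c > 0" "C > 0" using d by (auto simp: c_def C_def less_max_iff_disj)
  ultimately show ?thesis by blast
qed

section \<open>The norms of radial Hermite functions\<close>

lemma ex_in_positive_measure:
  assumes "AE x in M. Q x" "A \<in> sets M" "emeasure M A > 0"
  shows "\<exists>x\<in>A. Q x"
proof (rule ccontr)
  assume "\<not> (\<exists>x\<in>A. Q x)"
  then have "AE x in M. x \<notin> A" using assms(1) by (auto elim: eventually_mono)
  then have "emeasure M A = 0" using assms(2)
    by (simp add: AE_iff_measurable[OF _ refl] AE_iff_null_sets null_setsD1)
  then show False using assms(3) by simp
qed

theorem proposition2p4:
  fixes \<psi> :: "nat \<Rightarrow> real ^ 'd \<Rightarrow> complex"
    and d :: real
  assumes d_def: "d = real CARD('d)"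
    and d_ge_2: "CARD('d) \<ge> 2"
    and psi: "\<And>n. radial_hermite_function n (\<psi> n)"
  shows
    "(\<forall>p::ennreal. ennreal (2 * d / (d - 1)) < p \<longrightarrow>
        (\<exists>c>0. \<exists>C>0. \<forall>n\<ge>1.
           ennreal (c * real n powr (d / 2 * (1 / 2 - recip p) - 1 / 2)) \<le> Lp_norm p (\<psi> n) \<and>
           Lp_norm p (\<psi> n) \<le> ennreal (C * real n powr (d / 2 * (1 / 2 - recip p) - 1 / 2))))
     \<and> (\<forall>p::ennreal. p = ennreal (2 * d / (d - 1)) \<longrightarrow>
        (\<exists>C>0. \<forall>n\<ge>2.
           Lp_norm p (\<psi> n) \<le> ennreal (C * real n powr (- 1 / 4) * ln (real n) powr recip p)))
     \<and> (\<forall>p::ennreal. 2 \<le> p \<and> p < ennreal (2 * d / (d - 1)) \<longrightarrow>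
        (\<exists>C>0. \<forall>n\<ge>1.
           Lp_norm p (\<psi> n) \<le> ennreal (C * real n powr (- (d / 2) * (1 / 2 - recip p)))))"
proof -
  define \<kappa> where "\<kappa> = (d - 1) / 2"
  define s where "s = sphere_area d"
  define e where "e n = hermite_scale d n" for n
  have d2: "d \<ge> 2" using d_ge_2 by (simp add: d_def)
  have dk: "d = 2 * \<kappa> + 1" unfolding \<kappa>_def by (simp add: field_simps)
  have k: "\<kappa> \<ge> 1 / 2" using d2 by (simp add: \<kappa>_def)
  have k': "\<kappa> = 1 / 2 \<or> \<kappa> \<ge> 1"
  proof (cases "CARD('d) = 2")
    case False
    then have "CARD('d) \<ge> 3" using d_ge_2 by simp
    then show ?thesis by (simp add: \<kappa>_def d_def)
  qed (simp add: \<kappa>_def d_def)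
  have s: "s > 0" unfolding s_def using d2 by (intro sphere_area_pos) simp
  have e1: "e n \<ge> 1" if "n \<ge> 1" for n unfolding e_def using d2 that by (rule hermite_scale_ge_one)
  have upper: "Lp_norm (ennreal p) (\<psi> n) \<le> ennreal ((s * C) powr (1 / p) * \<Phi> (e n) powr (1 / p))"
    if "n \<ge> 1" "p > 0" "C \<ge> 0" "\<Phi> (e n) \<ge> 0" "\<And>e u u'. radial_profile e \<kappa> (1 / s) u u' \<Longrightarrow>
      Lp_integral \<kappa> p u \<le> ennreal (C * \<Phi> e)"
    for n p C \<Phi>
    using Lp_norm_radial_hermite_le[OF psi d_ge_2, of n p C \<Phi>] that
    unfolding \<kappa>_def s_def e_def d_def by blast
  have lower: "ennreal ((s * C) powr (1 / p) * \<Phi> (e n) powr (1 / p)) \<le> Lp_norm (ennreal p) (\<psi> n)"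
    if "n \<ge> 1" "p > 0" "C \<ge> 0" "\<Phi> (e n) \<ge> 0" "\<And>e u u'. radial_profile e \<kappa> (1 / s) u u' \<Longrightarrow>
      ennreal (C * \<Phi> e) \<le> Lp_integral \<kappa> p u"
    for n p C \<Phi>
    using Lp_norm_radial_hermite_ge[OF psi d_ge_2, of n p C \<Phi>] that
    unfolding \<kappa>_def s_def e_def d_def by blast
  have crit: "2 * d / (d - 1) = 2 + 1 / \<kappa>" using k by (simp add: dk field_simps)
  have crit_pos: "2 + 1 / \<kappa> > 2" using k by simp
  have crit_iff: "2 + 1 / \<kappa> < p \<longleftrightarrow> 1 < \<kappa> * (p - 2)" "p < 2 + 1 / \<kappa> \<longleftrightarrow> \<kappa> * (p - 2) < 1" for p
    using k by (auto simp: field_simps)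

  have super_finite: "\<exists>c>0. \<exists>C>0. \<forall>n\<ge>1.
      ennreal (c * real n powr (d / 2 * (1 / 2 - 1 / p) - 1 / 2)) \<le> Lp_norm (ennreal p) (\<psi> n) \<and>
      Lp_norm (ennreal p) (\<psi> n) \<le> ennreal (C * real n powr (d / 2 * (1 / 2 - 1 / p) - 1 / 2))"
    if p: "2 + 1 / \<kappa> < p" for p
  proof -
    define \<gamma> where "\<gamma> = d / 2 * (1 / 2 - 1 / p) - 1 / 2"
    define \<Phi> where "\<Phi> e = e powr (origin_exponent \<kappa> p)" for e :: real
    have p2: "p > 2" using p crit_pos by linarith
    have \<Phi>: "\<Phi> e powr (1 / p) = e powr (6 * \<gamma>)" for e
      unfolding \<Phi>_def powr_powr
      by (rule arg_cong[where f = "\<lambda>x. e powr x"]) (use p2 in \<open>simp add: \<gamma>_def dk field_simps\<close>)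
    obtain C1 where C1: "C1 > 0" "\<And>e u u'. radial_profile e \<kappa> (1 / s) u u' \<Longrightarrow>
      Lp_integral \<kappa> p u \<le> ennreal (C1 * \<Phi> e)"
      using uniform_Lp_bound_supercritical[OF k', of p "1 / s"] p2 p unfolding crit_iff \<Phi>_def by auto
    obtain c1 where c1: "c1 > 0" "\<And>e u u'. radial_profile e \<kappa> (1 / s) u u' \<Longrightarrow>
      ennreal (c1 * \<Phi> e) \<le> Lp_integral \<kappa> p u"
      using uniform_Lp_lower[of "1 / s" p \<kappa>] s p2 unfolding \<Phi>_def by auto
    obtain c2 C2 where c2: "c2 > 0" "C2 > 0"
      "\<And>n. n \<ge> 1 \<Longrightarrow> c2 * real n powr \<gamma> \<le> e n powr (6 * \<gamma>)"
      "\<And>n. n \<ge> 1 \<Longrightarrow> e n powr (6 * \<gamma>) \<le> C2 * real n powr \<gamma>"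
      using hermite_scale_powr[of d \<gamma>] d2 unfolding e_def by auto
    define c where "c = (s * c1) powr (1 / p) * c2"
    define C where "C = (s * C1) powr (1 / p) * C2"
    have "ennreal (c * real n powr \<gamma>) \<le> Lp_norm (ennreal p) (\<psi> n) \<and> Lp_norm (ennreal p) (\<psi> n)
        \<le> ennreal (C * real n powr \<gamma>)"
      if n: "n \<ge> 1" for n
    proof
      have "c * real n powr \<gamma> \<le> (s * c1) powr (1 / p) * \<Phi> (e n) powr (1 / p)"
        unfolding c_def \<Phi> mult.assoc using c2(3)[OF n] by (intro mult_left_mono) auto
      then show "ennreal (c * real n powr \<gamma>) \<le> Lp_norm (ennreal p) (\<psi> n)"
        using c1 p2 by (intro order_trans[OF ennreal_leI lower[OF n]]) (auto simp: \<Phi>_def)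
      have "(s * C1) powr (1 / p) * \<Phi> (e n) powr (1 / p) \<le> C * real n powr \<gamma>"
        unfolding C_def \<Phi> mult.assoc using c2(4)[OF n] by (intro mult_left_mono) auto
      then show "Lp_norm (ennreal p) (\<psi> n) \<le> ennreal (C * real n powr \<gamma>)"
        using C1 p2 by (intro order_trans[OF upper[OF n] ennreal_leI]) (auto simp: \<Phi>_def)
    qed
    moreover have "c > 0" "C > 0" using s c1 C1 c2 by (auto simp: c_def C_def)
    ultimately show ?thesis unfolding \<gamma>_def by blast
  qed

  have super_infinite: "\<exists>c>0. \<exists>C>0. \<forall>n\<ge>1.
      ennreal (c * real n powr (d / 4 - 1 / 2)) \<le> Lp_norm \<infinity> (\<psi> n) \<and>
      Lp_norm \<infinity> (\<psi> n) \<le> ennreal (C * real n powr (d / 4 - 1 / 2))"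
  proof -
    define \<gamma> where "\<gamma> = d / 4 - 1 / 2"
    have exponent: "3 * \<kappa> - 3 / 2 = 6 * \<gamma>" unfolding \<gamma>_def dk by (simp add: field_simps)
    obtain C1 where C1: "C1 > 0" "\<And>e u u' r. radial_profile e \<kappa> (1 / s) u u' \<Longrightarrow> r \<ge> 0 \<Longrightarrow> norm (u r)
        \<le> C1 * e powr (6 * \<gamma>)"
      using uniform_sup_bound[of \<kappa> "1 / s"] unfolding exponent by blast
    have "1 / s > 0" using s by simp
    from uniform_origin_bound[OF this, of \<kappa>] obtain c1 where c1: "c1 > 0"
      "\<And>e u u' r. radial_profile e \<kappa> (1 / s) u u' \<Longrightarrow> 0 \<le> r \<Longrightarrow> r \<le> 1 / (2 * e ^ 3) \<Longrightarrow> c1 * e powr (6 * \<gamma>)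
          \<le> norm (u r)"
      unfolding exponent by blast
    obtain c2 C2 where c2: "c2 > 0" "C2 > 0"
      "\<And>n. n \<ge> 1 \<Longrightarrow> c2 * real n powr \<gamma> \<le> e n powr (6 * \<gamma>)"
      "\<And>n. n \<ge> 1 \<Longrightarrow> e n powr (6 * \<gamma>) \<le> C2 * real n powr \<gamma>"
      using hermite_scale_powr[of d \<gamma>] d2 unfolding e_def by auto
    have "ennreal (c1 * c2 * real n powr \<gamma>) \<le> Lp_norm \<infinity> (\<psi> n) \<and> Lp_norm \<infinity> (\<psi> n)
        \<le> ennreal (C1 * C2 * real n powr \<gamma>)"
      if n: "n \<ge> 1" for n
    proof
      obtain u u' where u: "\<And>x. \<psi> n x = u (norm x)" "radial_profile (e n) \<kappa> (1 / s) u u'"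
        using radial_hermite_function_profile[OF psi d_ge_2 n] unfolding e_def \<kappa>_def s_def d_def by blast
      interpret radial_profile "e n" \<kappa> "1 / s" u u' by (rule u(2))
      have meas: "(\<lambda>x. ennreal (norm (\<psi> n x))) \<in> borel_measurable lborel" unfolding u(1) by measurable
      have N: "Lp_norm \<infinity> (\<psi> n) = esssup lborel (\<lambda>x. ennreal (norm (\<psi> n x)))" by (simp add: Lp_norm_def)
      show "Lp_norm \<infinity> (\<psi> n) \<le> ennreal (C1 * C2 * real n powr \<gamma>)"
        unfolding N
      proof (intro esssup_I[OF meas] AE_I2 ennreal_leI)
        fix x
        have "norm (\<psi> n x) \<le> C1 * e n powr (6 * \<gamma>)" unfolding u(1) by (rule C1(2)[OF u(2)]) simp
        also have "... \<le> C1 * C2 * real n powr \<gamma>" unfolding mult.assoc using c2(4)[OF n] C1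
          by (intro mult_left_mono) auto
        finally show "norm (\<psi> n x) \<le> C1 * C2 * real n powr \<gamma>" .
      qed
      define A where "A = ball (0 :: real ^ 'd) (1 / (2 * e n ^ 3))"
      have "emeasure lborel A > 0"
        unfolding A_def using e_pos by (simp add: emeasure_ball)
      moreover have "A \<in> sets lborel" by (simp add: A_def)
      ultimately obtain x where x: "x \<in> A" "ennreal (norm (\<psi> n x))
          \<le> esssup lborel (\<lambda>x. ennreal (norm (\<psi> n x)))"
        using ex_in_positive_measure[OF esssup_AE, of A lborel "\<lambda>x. ennreal (norm (\<psi> n x))"] by blast
      have "c1 * c2 * real n powr \<gamma> \<le> c1 * e n powr (6 * \<gamma>)"
        unfolding mult.assoc using c2(3)[OF n] c1 by (intro mult_left_mono) auto
      also have "... \<le> norm (\<psi> n x)" unfolding u(1) using x(1)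
        by (intro c1(2)[OF u(2)]) (auto simp: A_def)
      finally show "ennreal (c1 * c2 * real n powr \<gamma>) \<le> Lp_norm \<infinity> (\<psi> n)"
        unfolding N using x(2) by (meson ennreal_leI order_trans)
    qed
    moreover have "c1 * c2 > 0" "C1 * C2 > 0" using c1 C1 c2 by auto
    ultimately show ?thesis unfolding \<gamma>_def by blast
  qed

  have critical: "\<exists>C>0. \<forall>n\<ge>2. Lp_norm (ennreal p) (\<psi> n)
      \<le> ennreal (C * real n powr (- 1 / 4) * ln (real n) powr (1 / p))"
    if p: "p = 2 + 1 / \<kappa>" for p
  proof -
    define \<Phi> where "\<Phi> e = e powr (- 3 * p / 2) * (1 + ln e)" for e :: real
    have p2: "p > 2" using p crit_pos by linarith
    have kp: "\<kappa> * (p - 2) = 1" using k by (simp add: p)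
    obtain C1 where C1: "C1 > 0" "\<And>e u u'. radial_profile e \<kappa> (1 / s) u u' \<Longrightarrow>
      Lp_integral \<kappa> p u \<le> ennreal (C1 * Lp_size \<kappa> p e)"
      using uniform_Lp_bound[of p \<kappa> "1 / s"] p2 by auto
    define D where "D = max 1 (14 + 1 / (1 - p / 4))"
    have bound: "Lp_integral \<kappa> p u \<le> ennreal (C1 * D * \<Phi> e)"
      if prof: "radial_profile e \<kappa> (1 / s) u u'" for e u u'
    proof -
      interpret radial_profile e \<kappa> "1 / s" u u' by (rule prof)
      have "Lp_size \<kappa> p e \<le> (14 + 1 / (1 - p / 4)) * \<Phi> e"
        unfolding \<Phi>_def using p2 by (intro Lp_size_critical k kp e_large) simp
      also have "... \<le> D * \<Phi> e" using e_large by (intro mult_right_mono) (auto simp: D_def \<Phi>_def)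
      finally have "C1 * Lp_size \<kappa> p e \<le> C1 * D * \<Phi> e" using C1 by (simp add: mult.assoc)
      then show ?thesis by (intro order_trans[OF C1(2)[OF prof] ennreal_leI])
    qed
    obtain C2 where C2: "C2 > 0" "\<And>n. n \<ge> 1 \<Longrightarrow> e n powr (6 * (- 1 / 4)) \<le> C2 * real n powr (- 1 / 4)"
      using hermite_scale_powr[of d "- 1 / 4"] d2 unfolding e_def by auto
    \<comment> \<open>The three terms come from \<open>1 \<le> ln n / ln 2\<close> and \<open>ln (4 * n + d) \<le> ln (4 + d) + ln n\<close>.\<close>
    define B where "B = 1 / ln 2 + ln (4 + d) / ln 2 + 1"
    have B: "B > 0" using d2 by (auto simp: B_def intro!: add_nonneg_pos)
    have log: "1 + ln (e n) \<le> B * ln (real n)" if n: "n \<ge> 2" for n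
    proof -
      have l2: "ln 2 > (0::real)" "ln 2 \<le> ln (real n)" using n by auto
      have "4 * real n + d \<le> (4 + d) * real n"
        using n d2 mult_left_mono[of 1 "real n" d] by (simp add: algebra_simps)
      then have "ln (4 * real n + d) \<le> ln ((4 + d) * real n)" using n d2 by simp
      also have "... = ln (4 + d) + ln (real n)" using n d2 by (simp add: ln_mult)
      finally have 1: "ln (4 * real n + d) \<le> ln (4 + d) + ln (real n)" .
      have 2: "ln (4 * real n + d) \<ge> 0" using n d2 by simp
      have "ln (e n) = ln (4 * real n + d) / 6" using n d2 by (simp add: e_def hermite_scale_def ln_powr)
      then have "ln (e n) \<le> ln (4 + d) + ln (real n)" using 1 2 by linarith
      moreover have "1 \<le> ln (real n) / ln 2" using l2 by simp
      moreover have "ln (4 + d) * 1 \<le> ln (4 + d) * (ln (real n) / ln 2)"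
        using l2 d2 by (intro mult_left_mono) auto
      moreover have "B * ln (real n)
          = ln (real n) / ln 2 + ln (4 + d) * (ln (real n) / ln 2) + ln (real n)"
        by (simp add: B_def distrib_right)
      ultimately show ?thesis by linarith
    qed
    define C where "C = (s * (C1 * D)) powr (1 / p) * (C2 * B powr (1 / p))"
    have "Lp_norm (ennreal p) (\<psi> n) \<le> ennreal (C * real n powr (- 1 / 4) * ln (real n) powr (1 / p))"
      if n: "n \<ge> 2" for n
    proof -
      have n1: "n \<ge> 1" using n by simp
      have L: "1 + ln (e n) \<ge> 0" using e1[OF n1] by (simp add: add_nonneg_nonneg)
      have "\<Phi> (e n) powr (1 / p) = e n powr (6 * (- 1 / 4)) * (1 + ln (e n)) powr (1 / p)"
      proof -
        have "(e n powr (- 3 * p / 2)) powr (1 / p) = e n powr (6 * (- 1 / 4))"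
          unfolding powr_powr
          by (rule arg_cong[where f = "\<lambda>x. e n powr x"]) (use p2 in \<open>simp add: field_simps\<close>)
        then show ?thesis unfolding \<Phi>_def powr_mult by simp
      qed
      also have "... \<le> (C2 * real n powr (- 1 / 4)) * (B * ln (real n)) powr (1 / p)"
        using C2(2)[OF n1] log[OF n] L p2 C2(1) by (intro mult_mono powr_mono2) auto
      also have "(B * ln (real n)) powr (1 / p) = B powr (1 / p) * ln (real n) powr (1 / p)"
        by (rule powr_mult)
      finally have "(s * (C1 * D)) powr (1 / p) * \<Phi> (e n) powr (1 / p)
         \<le> (s * (C1 * D)) powr (1 / p) * ((C2 * real n powr (- 1 / 4)) * (B powr (1 / p) * ln (real n) powr (1 / p)))"
        by (intro mult_left_mono) auto
      also have "... = C * real n powr (- 1 / 4) * ln (real n) powr (1 / p)" by (simp only: C_def mult_ac)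
      finally show ?thesis
        using p2 C1 L bound by (intro order_trans[OF upper[OF n1] ennreal_leI]) (auto simp: \<Phi>_def D_def)
    qed
    moreover have "C > 0" using s C1 C2 B by (simp add: C_def D_def less_max_iff_disj)
    ultimately show ?thesis by blast
  qed

  have subcritical: "\<exists>C>0. \<forall>n\<ge>1. Lp_norm (ennreal p) (\<psi> n)
      \<le> ennreal (C * real n powr (- (d / 2) * (1 / 2 - 1 / p)))"
    if p: "2 \<le> p" "p < 2 + 1 / \<kappa>" for p
  proof -
    define \<gamma> where "\<gamma> = - (d / 2) * (1 / 2 - 1 / p)"
    define \<Phi> where "\<Phi> e = e powr (- 3 * (2 * \<kappa> + 1) * (p - 2) / 2)" for e :: real
    have \<Phi>: "\<Phi> e powr (1 / p) = e powr (6 * \<gamma>)" for e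
      unfolding \<Phi>_def powr_powr
      by (rule arg_cong[where f = "\<lambda>x. e powr x"]) (use p in \<open>simp add: \<gamma>_def dk field_simps\<close>)
    obtain C1 where C1: "C1 > 0" "\<And>e u u'. radial_profile e \<kappa> (1 / s) u u' \<Longrightarrow>
      Lp_integral \<kappa> p u \<le> ennreal (C1 * Lp_size \<kappa> p e)"
      using uniform_Lp_bound[of p \<kappa> "1 / s"] p by auto
    define D where "D = max 1 (2 + 1 / (1 - \<kappa> * (p - 2)) + 1 / (1 - p / 4))"
    have bound: "Lp_integral \<kappa> p u \<le> ennreal (C1 * D * \<Phi> e)"
      if prof: "radial_profile e \<kappa> (1 / s) u u'" for e u u'
    proof -
      interpret radial_profile e \<kappa> "1 / s" u u' by (rule prof)
      have "Lp_size \<kappa> p e \<le> (2 + 1 / (1 - \<kappa> * (p - 2)) + 1 / (1 - p / 4)) * \<Phi> e"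
        unfolding \<Phi>_def using p by (intro Lp_size_subcritical k e_large) (auto simp: crit_iff)
      also have "... \<le> D * \<Phi> e" by (intro mult_right_mono) (auto simp: D_def \<Phi>_def)
      finally have "C1 * Lp_size \<kappa> p e \<le> C1 * D * \<Phi> e" using C1 by (simp add: mult.assoc)
      then show ?thesis by (intro order_trans[OF C1(2)[OF prof] ennreal_leI])
    qed
    obtain C2 where C2: "C2 > 0" "\<And>n. n \<ge> 1 \<Longrightarrow> e n powr (6 * \<gamma>) \<le> C2 * real n powr \<gamma>"
      using hermite_scale_powr[of d \<gamma>] d2 unfolding e_def by auto
    define C where "C = (s * (C1 * D)) powr (1 / p) * C2"
    have "Lp_norm (ennreal p) (\<psi> n) \<le> ennreal (C * real n powr \<gamma>)" if n: "n \<ge> 1" for n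
    proof -
      have "(s * (C1 * D)) powr (1 / p) * \<Phi> (e n) powr (1 / p) \<le> C * real n powr \<gamma>"
        unfolding C_def \<Phi> mult.assoc using C2(2)[OF n] by (intro mult_left_mono) auto
      then show ?thesis
        using C1 p bound by (intro order_trans[OF upper[OF n] ennreal_leI]) (auto simp: \<Phi>_def D_def)
    qed
    moreover have "C > 0" using s C1 C2 by (simp add: C_def D_def less_max_iff_disj)
    ultimately show ?thesis unfolding \<gamma>_def by blast
  qed

  show ?thesis
    unfolding crit
  proof (intro conjI allI impI)
    fix p :: ennreal assume p: "ennreal (2 + 1 / \<kappa>) < p"
    show "\<exists>c>0. \<exists>C>0. \<forall>n\<ge>1.
           ennreal (c * real n powr (d / 2 * (1 / 2 - recip p) - 1 / 2)) \<le> Lp_norm p (\<psi> n) \<and>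
           Lp_norm p (\<psi> n) \<le> ennreal (C * real n powr (d / 2 * (1 / 2 - recip p) - 1 / 2))"
    proof (cases p)
      case (real q)
      then have "2 + 1 / \<kappa> < q" using p crit_pos by (simp add: ennreal_less_iff)
      moreover from this have "recip p = 1 / q" using crit_pos unfolding real
        by (intro recip_ennreal) linarith
      ultimately show ?thesis using super_finite[of q] by (simp only: real)
    next
      case top
      then have p_inf: "p = \<infinity>" by simp
      have "d / 2 * (1 / 2 - recip \<infinity>) - 1 / 2 = d / 4 - 1 / 2" unfolding recip_top by simp
      then show ?thesis unfolding p_inf using super_infinite by (simp only:)
    qed
  next
    fix p assume p: "p = ennreal (2 + 1 / \<kappa>)"
    have "recip p = 1 / (2 + 1 / \<kappa>)" using crit_pos unfolding p by (intro recip_ennreal) linarith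
    then show "\<exists>C>0. \<forall>n\<ge>2. Lp_norm p (\<psi> n)
        \<le> ennreal (C * real n powr (- 1 / 4) * ln (real n) powr recip p)"
      using critical[OF refl] by (simp only: p)
  next
    fix p :: ennreal assume p: "2 \<le> p \<and> p < ennreal (2 + 1 / \<kappa>)"
    show "\<exists>C>0. \<forall>n\<ge>1. Lp_norm p (\<psi> n) \<le> ennreal (C * real n powr (- (d / 2) * (1 / 2 - recip p)))"
    proof (cases p)
      case (real q)
      then have q: "2 \<le> q" "q < 2 + 1 / \<kappa>" using p
        by (auto simp: ennreal_less_iff simp flip: ennreal_numeral)
      then have "recip p = 1 / q" unfolding real by (intro recip_ennreal) linarith
      then show ?thesis using subcritical[OF q] by (simp only: real)
    next
      case top
      then show ?thesis using p by simp
    qed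
  qed
qed

end
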